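(* Let $\Omega\subset\mathbb{C}^n$ be a bounded pseudoconvex domain with Hölder boundary. Then its log-hyperconvexity index is positive: $\alpha_l(\Omega)>0$.
   Context: For a bounded domain $\Omega\subset\mathbb{C}^n$, let $d(z)$ denote the Euclidean distance from $z\in\Omega$ to $\partial\Omega$. The log-hyperconvexity index $\alpha_l(\Omega)$ is the supremum of all $\alpha\ge 0$ for which there exist a continuous plurisubharmonic function $\phi:\Omega\to(-\infty,0)$, a constant $C>0$ and $\delta\in(0,1)$ such that $-\phi(z)\le C(-\log d(z))^{-\alpha}$ for all $z\in\Omega$ with $d(z)<\delta$. A bounded domain $\Omega\subset\mathbb{C}^n$ has Hölder boundary if locally $\partial\Omega$ can be written as the graph of a Hölder continuous function in suitable holomorphic coordinates. Precisely: for every $p\in\partial\Omega$ there are an open neighborhood $U$ of $p$ in $\mathbb{C}^n$, a radius $r>0$, holomorphic coordinates $z=(z',z_n)$ on $U$, $z'=(z_1,\dots,z_{n-1})$, in which $p=0$ and $U$ corresponds to the ball $B(0,r)$, and a function $g$ on $\{(z',x_n)\in\mathbb{C}^{n-1}\times\mathbb{R} : |z'|^2+x_n^2<r^2\}$ that is Hölder continuous with some exponent $\beta\in(0,1)$, with $g(0',0)=0$, such that $$U\cap\Omega=\{z\in B(0,r) : \operatorname{Im} z_n<g(z',\operatorname{Re} z_n)\}.$$ *)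

theory Defs
  imports "HOL-Analysis.Analysis"
begin

text \<open>
  Complex Euclidean \<open>n\<close>-space is \<open>complex ^ 'n\<close>, where \<open>n\<close> is the cardinality of \<open>'n\<close>; its norm is
  the Euclidean one, and \<open>c *s v\<close> is multiplication by a complex scalar.
\<close>

text \<open>
  Submean value inequality on all closed discs in \<open>U\<close>. Only continuous functions occur below,
  so upper semicontinuity and the value \<open>-\<infinity>\<close> are not needed; continuity also guarantees that
  the circle integral exists.
\<close>

definition continuous_subharmonic_on :: "complex set \<Rightarrow> (complex \<Rightarrow> real) \<Rightarrow> bool" where
  "continuous_subharmonic_on U u \<longleftrightarrow>
     continuous_on U u \<and>
     (\<forall>a r. 0 < r \<longrightarrow> cball a r \<subseteq> U \<longrightarrow>
        u a \<le> integral {0..2 * pi} (\<lambda>t. u (a + of_real r * cis t)) / (2 * pi))"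

definition continuous_plurisubharmonic_on ::
    "(complex ^ 'n) set \<Rightarrow> (complex ^ 'n \<Rightarrow> real) \<Rightarrow> bool" where
  "continuous_plurisubharmonic_on \<Omega> \<phi> \<longleftrightarrow>
     continuous_on \<Omega> \<phi> \<and>
     (\<forall>a b. continuous_subharmonic_on {\<zeta>. a + \<zeta> *s b \<in> \<Omega>} (\<lambda>\<zeta>. \<phi> (a + \<zeta> *s b)))"

text \<open>Existence of a continuous plurisubharmonic exhaustion function.\<close>

definition pseudoconvex :: "(complex ^ 'n) set \<Rightarrow> bool" where
  "pseudoconvex \<Omega> \<longleftrightarrow>
     open \<Omega> \<and>
     (\<exists>\<phi>. continuous_plurisubharmonic_on \<Omega> \<phi> \<and>
          (\<forall>c. compact (closure {z \<in> \<Omega>. \<phi> z < c}) \<and> closure {z \<in> \<Omega>. \<phi> z < c} \<subseteq> \<Omega>))"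

definition holomorphic_map_on ::
    "(complex ^ 'n) set \<Rightarrow> (complex ^ 'n \<Rightarrow> complex ^ 'm) \<Rightarrow> bool" where
  "holomorphic_map_on U F \<longleftrightarrow>
     (\<forall>z\<in>U. \<exists>D. (F has_derivative D) (at z) \<and> (\<forall>c v. D (c *s v) = c *s D v))"

definition biholomorphic_onto ::
    "(complex ^ 'n) set \<Rightarrow> (complex ^ 'n) set \<Rightarrow> (complex ^ 'n \<Rightarrow> complex ^ 'n) \<Rightarrow> bool" where
  "biholomorphic_onto U V F \<longleftrightarrow>
     open U \<and> open V \<and> bij_betw F U V \<and>
     holomorphic_map_on U F \<and> holomorphic_map_on V (inv_into U F)"

definition holder_continuous_on :: "real \<Rightarrow> 'a::metric_space set \<Rightarrow> ('a \<Rightarrow> real) \<Rightarrow> bool" where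
  "holder_continuous_on \<beta> S g \<longleftrightarrow>
     (\<exists>L. \<forall>x\<in>S. \<forall>y\<in>S. \<bar>g x - g y\<bar> \<le> L * dist x y powr \<beta>)"

text \<open>
  A pair \<open>(z', x_n)\<close> with \<open>x_n\<close> real is encoded as the vector whose \<open>k\<close>-th coordinate is the real
  number \<open>x_n\<close> and whose remaining coordinates are those of \<open>z'\<close>; the map below sends \<open>z\<close> to
  \<open>(z', Re z_n)\<close>.
\<close>

definition real_part_at :: "'n \<Rightarrow> complex ^ 'n \<Rightarrow> complex ^ 'n" where
  "real_part_at k z = (\<chi> i. if i = k then of_real (Re (z $ i)) else z $ i)"

text \<open>
  The index type is unordered, so \<open>k\<close> designates the coordinate playing the role of \<open>z_n\<close>;
  permuting the coordinates shows that its choice is immaterial. The domain of \<open>g\<close> is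
  \<open>|z'|^2 + x_n^2 < r^2\<close> in the above encoding.
\<close>

definition holder_boundary :: "(complex ^ 'n) set \<Rightarrow> bool" where
  "holder_boundary \<Omega> \<longleftrightarrow>
     (\<forall>p\<in>frontier \<Omega>. \<exists>U r F k g \<beta>.
        p \<in> U \<and> 0 < r \<and> biholomorphic_onto U (ball 0 r) F \<and> F p = 0 \<and>
        0 < \<beta> \<and> \<beta> < 1 \<and>
        holder_continuous_on \<beta> {w. Im (w $ k) = 0 \<and> norm w < r} g \<and> g 0 = 0 \<and>
        F ` (U \<inter> \<Omega>) = {w \<in> ball 0 r. Im (w $ k) < g (real_part_at k w)})"

definition log_hyperconvexity_index :: "(complex ^ 'n) set \<Rightarrow> ereal" where
  "log_hyperconvexity_index \<Omega> =
     Sup (ereal ` {\<alpha>. 0 \<le> \<alpha> \<and>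
       (\<exists>\<phi> C \<delta>. continuous_plurisubharmonic_on \<Omega> \<phi> \<and> (\<forall>z\<in>\<Omega>. \<phi> z < 0) \<and>
          0 < C \<and> 0 < \<delta> \<and> \<delta> < 1 \<and>
          (\<forall>z\<in>\<Omega>. infdist z (frontier \<Omega>) < \<delta> \<longrightarrow>
             - \<phi> z \<le> C * (- ln (infdist z (frontier \<Omega>))) powr (- \<alpha>)))})"

end

theory Submission
  imports Defs "HOL-Complex_Analysis.Complex_Analysis"
begin

text \<open>
  Write \<open>d\<close> for the boundary distance and \<open>L = - ln d\<close>. In a boundary chart, shift the graph domain
  by \<open>e\<^sup>-\<^sup>l\<close> in its vertical direction: minus the logarithm of the distance to the boundary of the
  shifted domain is plurisubharmonic (Hartogs, Oka) and, by the Hoelder condition, comparable to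
  \<open>min L l\<close> up to a multiplicative constant \<open>A\<close>. After normalisation it is a negative function that is
  at most \<open>-1\<close> where \<open>L < 2 l / M\<close> and at least \<open>-q\<close>, with \<open>q < 1\<close>, where \<open>L \<ge> l\<close>. Pasting such functions
  at the scales \<open>l, M l, M\<^sup>2 l, ...\<close> gains a factor \<open>q\<close> per scale.

  Near a boundary point this gives a barrier \<open>\<psi>\<close> with \<open>- \<psi>\<close> of the order \<open>q\<^sup>j\<close> from both sides on the
  \<open>j\<close>-th scale, so the functions \<open>- ln (- \<psi>)\<close> of different charts differ by a bounded amount, however
  many scales are used. Hence they can be glued, at the cost of a bounded error, to one function
  whose range is as large as we please; it serves as a global function with \<open>q = 1/2\<close>, and
  a second iteration of the same kind produces a negative plurisubharmonic function that decays
  like a power of \<open>1 / L\<close>.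
\<close>

section \<open>Circle means and submean functions of one variable\<close>

text \<open>A Hoelder graph relates the height \<open>h\<close> of the graph over a point and the
  boundary distance \<open>d\<close> only through \<open>d \<le> K * h\<close> and a bound of
  \<open>h\<close> by a power of \<open>d\<close>. Taking logarithms turns the exponent into a
  factor; hence all estimates are made in \<open>L\<close>, and the decay obtained is a power of
  \<open>1 / L\<close> rather than of \<open>d\<close>. The shift bounds the chart function:
  \<open>d + exp (- l)\<close> is comparable to \<open>exp (- min L l)\<close>, and only a function
  bounded above can be normalised to be negative. The obstacle is the passage from charts to the
  domain. A maximum over charts is plurisubharmonic only if a function about to leave its ball is
  already beaten by another one. Since chart functions agree only up to constants, this takes a
  correction of fixed size, whereas one scale gains no more than \<open>- ln q\<close>, which may be
  tiny. So the charts are not pasted scale by scale: \<open>K\<close> scales of the charts together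
  yield a single global scale, with ratio \<open>M ^ K\<close> in place of \<open>M\<close>. As
  \<open>K\<close> is fixed, the final exponent \<open>ln 2 / ln (M ^ K)\<close> is
  positive.\<close>

definition circle_mean :: "(complex \<Rightarrow> real) \<Rightarrow> real \<Rightarrow> real" where
  "circle_mean f s = integral {0..2 * pi} (\<lambda>t. f (of_real s * cis t)) / (2 * pi)"

lemma circle_in_sphere: "0 \<le> s \<Longrightarrow> of_real s * cis t \<in> sphere 0 s"
  by (simp add: norm_mult)

lemma continuous_on_circle:
  assumes "continuous_on (sphere 0 s) f" "0 \<le> s"
  shows "continuous_on A (\<lambda>t. f (of_real s * cis t))"
  by (rule continuous_on_compose2[OF assms(1)])
     (use assms(2) in \<open>auto intro!: continuous_intros simp: norm_mult\<close>)

lemma circle_integrable: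
  fixes f :: "complex \<Rightarrow> real"
  assumes "continuous_on (sphere 0 s) f" "0 \<le> s"
  shows "(\<lambda>t. f (of_real s * cis t)) integrable_on {0..2*pi}"
  by (intro integrable_continuous_real continuous_on_circle assms)

lemma circle_mean_mono:
  assumes "continuous_on (sphere 0 s) f" "continuous_on (sphere 0 s) g" "0 \<le> s"
    and "\<And>\<zeta>. \<zeta> \<in> sphere 0 s \<Longrightarrow> f \<zeta> \<le> g \<zeta>"
  shows "circle_mean f s \<le> circle_mean g s"
  unfolding circle_mean_def
  by (intro divide_right_mono integral_le circle_integrable assms circle_in_sphere) auto

lemma circle_mean_add:
  assumes "continuous_on (sphere 0 s) f" "continuous_on (sphere 0 s) g" "0 \<le> s"
  shows "circle_mean (\<lambda>\<zeta>. f \<zeta> + g \<zeta>) s = circle_mean f s + circle_mean g s"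
  unfolding circle_mean_def
  using integral_add[OF circle_integrable[OF assms(1,3)] circle_integrable[OF assms(2,3)]]
  by (simp add: add_divide_distrib)

lemma circle_mean_cmult: "circle_mean (\<lambda>\<zeta>. c * f \<zeta>) s = c * circle_mean f s"
  by (simp add: circle_mean_def)

lemma circle_mean_const [simp]: "circle_mean (\<lambda>\<zeta>. c) s = c"
  by (simp add: circle_mean_def)

lemma circle_mean_Re:
  assumes "h holomorphic_on cball 0 s" "0 < s"
  shows "circle_mean (\<lambda>\<zeta>. Re (h \<zeta>)) s = Re (h 0)"
proof -
  have "((\<lambda>u. h u / (u - 0)) has_contour_integral (2 * of_real pi * \<i> * h 0)) (circlepath 0 s)"
    using assms by (intro Cauchy_integral_circlepath holomorphic_on_imp_continuous_on)
      (auto intro: holomorphic_on_subset)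
  then have "((\<lambda>t. h (of_real s * cis t) * \<i>) has_integral (2 * of_real pi * \<i> * h 0)) {0..2*pi}"
    unfolding circlepath_def using assms(2)
    by (subst (asm) has_contour_integral_part_circlepath_iff) (auto simp: divide_simps ac_simps)
  then have "((\<lambda>t. Im (h (of_real s * cis t) * \<i>)) has_integral Im (2 * of_real pi * \<i> * h 0)) {0..2*pi}"
    by (rule has_integral_Im)
  then have "((\<lambda>t. Re (h (of_real s * cis t))) has_integral (2 * pi * Re (h 0))) {0..2*pi}"
    by (simp add: mult.assoc)
  then show ?thesis by (simp add: circle_mean_def integral_unique)
qed

lemma circle_mean_le:
  assumes "continuous_on (sphere 0 s) f" "0 < s" "P holomorphic_on cball 0 s"
    and "\<And>\<zeta>. \<zeta> \<in> sphere 0 s \<Longrightarrow> f \<zeta> \<le> Re (P \<zeta>) + c"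
  shows "circle_mean f s \<le> Re (P 0) + c"
proof -
  have c: "continuous_on (sphere 0 s) (\<lambda>\<zeta>. Re (P \<zeta>))"
    by (intro continuous_intros holomorphic_on_imp_continuous_on holomorphic_on_subset[OF assms(3)]) auto
  have "circle_mean f s \<le> circle_mean (\<lambda>\<zeta>. Re (P \<zeta>) + c) s"
    using assms c by (intro circle_mean_mono) (auto intro: continuous_on_add)
  also have "\<dots> = Re (P 0) + c"
    using assms c by (subst circle_mean_add) (auto simp: circle_mean_Re)
  finally show ?thesis .
qed

section \<open>Real parts of polynomials on a circle\<close>

definition poly_traces :: "complex set \<Rightarrow> (complex \<Rightarrow> real) set" where
  "poly_traces S = {f. \<exists>p. \<forall>\<zeta>\<in>S. f \<zeta> = Re (poly p \<zeta>)}"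

lemma poly_traces_add:
  "f \<in> poly_traces S \<Longrightarrow> g \<in> poly_traces S \<Longrightarrow> (\<lambda>\<zeta>. f \<zeta> + g \<zeta>) \<in> poly_traces S"
  unfolding poly_traces_def by clarsimp (metis poly_add plus_complex.sel(1))

lemma poly_traces_sum:
  "finite I \<Longrightarrow> (\<And>i. i \<in> I \<Longrightarrow> f i \<in> poly_traces S) \<Longrightarrow> (\<lambda>\<zeta>. \<Sum>i\<in>I. f i \<zeta>) \<in> poly_traces S"
proof (induction I rule: finite_induct)
  case empty
  show ?case by (auto simp: poly_traces_def intro!: exI[of _ 0])
qed (auto intro!: poly_traces_add)

text \<open>On the circle of radius \<open>s\<close> the product
  \<open>cnj (\<zeta> ^ i) * \<zeta> ^ j\<close> is again a monomial when \<open>i \<le> j\<close>.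
  This makes the traces an algebra, although real parts of polynomials are not closed under products
  on the plane.\<close>

lemma poly_traces_monom_mult:
  fixes a b :: complex
  assumes "i \<le> j"
  shows "(\<lambda>\<zeta>. Re (a * \<zeta> ^ i) * Re (b * \<zeta> ^ j)) \<in> poly_traces (sphere 0 s)"
proof -
  have "Re (a * \<zeta> ^ i) * Re (b * \<zeta> ^ j)
      = Re (poly (monom (a * b / 2) (i + j) + monom (cnj a * b * of_real s ^ (2 * i) / 2) (j - i)) \<zeta>)"
    if "\<zeta> \<in> sphere 0 s" for \<zeta>
  proof -
    have "cnj (\<zeta> ^ i) * \<zeta> ^ i = of_real s ^ (2 * i)"
    proof -
      have "cnj (\<zeta> ^ i) * \<zeta> ^ i = (\<zeta> * cnj \<zeta>) ^ i"
        by (simp add: power_mult_distrib)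
      also have "\<zeta> * cnj \<zeta> = of_real s ^ 2"
        using that complex_norm_square[of "\<zeta>"] by simp
      finally show ?thesis by (simp add: power_mult)
    qed
    moreover have "\<zeta> ^ j = \<zeta> ^ i * \<zeta> ^ (j - i)"
      using assms by (simp flip: power_add)
    ultimately have 1: "cnj (\<zeta> ^ i) * \<zeta> ^ j = of_real s ^ (2 * i) * \<zeta> ^ (j - i)"
      by (simp flip: mult.assoc)
    have "Re x * Re y = Re (x * y / 2 + cnj x * y / 2)" for x y :: complex
      by (simp add: field_simps)
    then have "Re (a * \<zeta> ^ i) * Re (b * \<zeta> ^ j)
        = Re ((a * \<zeta>^i) * (b * \<zeta>^j) / 2 + cnj (a * \<zeta>^i) * (b * \<zeta>^j) / 2)" .
    also have "(a * \<zeta>^i) * (b * \<zeta>^j) / 2 = a * b / 2 * \<zeta> ^ (i + j)"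
      by (simp add: power_add)
    also have "cnj (a * \<zeta>^i) * (b * \<zeta>^j) / 2 = cnj a * b * (cnj (\<zeta> ^ i) * \<zeta> ^ j) / 2"
      by simp
    also have "\<dots> = cnj a * b * of_real s ^ (2 * i) / 2 * \<zeta> ^ (j - i)"
      unfolding 1 by simp
    finally show ?thesis by (simp add: poly_monom)
  qed
  then show ?thesis unfolding poly_traces_def by blast
qed

lemma poly_traces_mult:
  assumes "f \<in> poly_traces (sphere 0 s)" "g \<in> poly_traces (sphere 0 s)"
  shows "(\<lambda>\<zeta>. f \<zeta> * g \<zeta>) \<in> poly_traces (sphere 0 s)"
proof -
  obtain p q where p: "\<And>\<zeta>. \<zeta> \<in> sphere 0 s \<Longrightarrow> f \<zeta> = Re (poly p \<zeta>)"
    and q: "\<And>\<zeta>. \<zeta> \<in> sphere 0 s \<Longrightarrow> g \<zeta> = Re (poly q \<zeta>)"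
    using assms unfolding poly_traces_def by blast
  have "(\<lambda>\<zeta>. \<Sum>i\<le>degree p. \<Sum>j\<le>degree q. Re (coeff p i * \<zeta> ^ i) * Re (coeff q j * \<zeta> ^ j))
      \<in> poly_traces (sphere 0 s)"
  proof (intro poly_traces_sum finite_atMost)
    fix i j
    have "(\<lambda>\<zeta>. Re (coeff q j * \<zeta> ^ j) * Re (coeff p i * \<zeta> ^ i))
        = (\<lambda>\<zeta>. Re (coeff p i * \<zeta> ^ i) * Re (coeff q j * \<zeta> ^ j))"
      by (rule ext) (rule mult.commute)
    then show "(\<lambda>\<zeta>. Re (coeff p i * \<zeta> ^ i) * Re (coeff q j * \<zeta> ^ j)) \<in> poly_traces (sphere 0 s)"
      using poly_traces_monom_mult[of i j "coeff p i" "coeff q j" s]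
        poly_traces_monom_mult[of j i "coeff q j" "coeff p i" s]
      by (metis linear)
  qed
  moreover have "(\<Sum>i\<le>degree p. \<Sum>j\<le>degree q. Re (coeff p i * \<zeta> ^ i) * Re (coeff q j * \<zeta> ^ j))
      = Re (poly p \<zeta>) * Re (poly q \<zeta>)" for \<zeta>
    by (simp only: poly_altdef Re_sum sum_product)
  ultimately show ?thesis using p q unfolding poly_traces_def by auto
qed

text \<open>Stone-Weierstrass takes the place of the Dirichlet problem: each approximant comes with
  its harmonic extension \<open>Re p\<close> to the disc. Approximating \<open>u + e / 2\<close> up
  to \<open>e / 2\<close> puts it above \<open>u\<close>.\<close>

lemma circle_poly_approx:
  fixes u :: "complex \<Rightarrow> real"
  assumes "continuous_on (sphere 0 s) u" "0 < e"
  obtains p where "\<And>\<zeta>. \<zeta> \<in> sphere 0 s \<Longrightarrow> u \<zeta> \<le> Re (poly p \<zeta>)"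
    "\<And>\<zeta>. \<zeta> \<in> sphere 0 s \<Longrightarrow> Re (poly p \<zeta>) \<le> u \<zeta> + e"
proof -
  interpret function_ring_on "poly_traces (sphere 0 s)" "sphere (0::complex) s"
  proof
    show "continuous_on (sphere 0 s) f" if f: "f \<in> poly_traces (sphere 0 s)" for f
    proof -
      obtain p where p: "\<And>\<zeta>. \<zeta> \<in> sphere 0 s \<Longrightarrow> f \<zeta> = Re (poly p \<zeta>)"
        using f unfolding poly_traces_def by blast
      have "continuous_on (sphere 0 s) (\<lambda>\<zeta>. Re (poly p \<zeta>))" by (intro continuous_intros)
      then show ?thesis by (rule continuous_on_eq) (use p in auto)
    qed
    show "\<exists>f\<in>poly_traces (sphere 0 s). f x \<noteq> f y" if "x \<noteq> y" for x y :: complex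
    proof -
      have 1: "(\<lambda>\<zeta>. Re \<zeta>) \<in> poly_traces (sphere 0 s)"
        unfolding poly_traces_def by (auto intro!: exI[of _ "[:0,1:]"])
      have 2: "(\<lambda>\<zeta>. Im \<zeta>) \<in> poly_traces (sphere 0 s)"
        unfolding poly_traces_def by (auto intro!: exI[of _ "[:0,-\<i>:]"])
      show ?thesis using that 1 2 by (metis complex_eqI)
    qed
    show "(\<lambda>_. c) \<in> poly_traces (sphere 0 s)" for c
      unfolding poly_traces_def by (auto intro!: exI[of _ "[:of_real c:]"])
  qed (auto intro: poly_traces_add poly_traces_mult)
  have "continuous_on (sphere 0 s) (\<lambda>\<zeta>. u \<zeta> + e / 2)" using assms by (intro continuous_intros)
  then obtain f where f: "f \<in> poly_traces (sphere 0 s)"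
    "\<And>\<zeta>. \<zeta> \<in> sphere 0 s \<Longrightarrow> \<bar>u \<zeta> + e / 2 - f \<zeta>\<bar> < e / 2"
    using Stone_Weierstrass_basic[of "\<lambda>\<zeta>. u \<zeta> + e / 2" "e / 2"] assms(2) by auto
  then obtain p where p: "\<And>\<zeta>. \<zeta> \<in> sphere 0 s \<Longrightarrow> f \<zeta> = Re (poly p \<zeta>)"
    unfolding poly_traces_def by blast
  show ?thesis
  proof (rule that[of p])
    fix \<zeta> :: complex assume "\<zeta> \<in> sphere 0 s"
    then show "u \<zeta> \<le> Re (poly p \<zeta>)" "Re (poly p \<zeta>) \<le> u \<zeta> + e"
      using f(2)[of \<zeta>] p[of \<zeta>] by (auto simp: abs_if split: if_splits)
  qed
qed

section \<open>From small circles to all circles\<close>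

lemma norm_add_sq_complex: "(cmod (x + y))\<^sup>2 = (cmod x)\<^sup>2 + (cmod y)\<^sup>2 + 2 * Re (cnj x * y)"
  unfolding cmod_power2 by (simp add: power2_eq_square algebra_simps)

text \<open>Adding \<open>\<eta> * (cmod x)\<^sup>2\<close> makes the submean inequality strict. A
  strict inequality on a single small circle already excludes an interior maximum, so nothing has to
  be propagated from one circle to the next.\<close>

lemma local_submean_max_principle:
  fixes u :: "complex \<Rightarrow> real"
  assumes c: "continuous_on (cball 0 r) u" and r: "0 < r"
    and sub: "\<And>a. a \<in> ball 0 r \<Longrightarrow> \<exists>\<rho>>0. \<forall>s. 0 < s \<longrightarrow> s < \<rho> \<longrightarrow> u a \<le> circle_mean (\<lambda>\<zeta>. u (a + \<zeta>)) s"
    and bd: "\<And>\<zeta>. \<zeta> \<in> sphere 0 r \<Longrightarrow> u \<zeta> \<le> 0"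
    and z: "\<zeta> \<in> cball 0 r"
  shows "u \<zeta> \<le> 0"
proof (rule ccontr)
  assume "\<not> u \<zeta> \<le> 0"
  then have pos: "u \<zeta> > 0" by simp
  \<comment> \<open>Since \<open>\<eta> * r\<^sup>2\<close> is half of \<open>u \<zeta>\<close>, the
    perturbation cannot lift the boundary values up to \<open>u \<zeta>\<close>.\<close>
  define \<eta> where "\<eta> = u \<zeta> / (2 * r\<^sup>2)"
  have \<eta>: "\<eta> > 0" "\<eta> * r\<^sup>2 < u \<zeta>" using pos r by (auto simp: \<eta>_def)
  define v where "v = (\<lambda>x. u x + \<eta> * (cmod x)\<^sup>2)"
  have "continuous_on (cball 0 r) v" unfolding v_def by (intro continuous_intros c)
  then obtain a where a: "a \<in> cball 0 r" "\<And>x. x \<in> cball 0 r \<Longrightarrow> v x \<le> v a"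
    using continuous_attains_sup[of "cball 0 r" v] z by (metis compact_cball empty_iff)
  have "v a \<ge> u \<zeta>" using a(2)[OF z] \<eta> unfolding v_def
    by (smt (verit) mult_nonneg_nonneg zero_le_power2)
  then have "a \<notin> sphere 0 r" using bd[of a] \<eta> unfolding v_def by fastforce
  then have ai: "a \<in> ball 0 r" using a(1) by auto
  obtain \<rho> where \<rho>: "\<rho> > 0" "\<And>s. 0 < s \<Longrightarrow> s < \<rho> \<Longrightarrow> u a \<le> circle_mean (\<lambda>\<zeta>. u (a + \<zeta>)) s"
    using sub[OF ai] by blast
  define s where "s = min (\<rho> / 2) (r - cmod a)"
  have s: "0 < s" "s < \<rho>" "s \<le> r - cmod a" using \<rho>(1) ai by (auto simp: s_def min_def)
  have in_ball: "a + x \<in> cball 0 r" if "x \<in> sphere 0 s" for x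
    using that s(3) norm_triangle_ineq[of a x] by auto
  \<comment> \<open>The cross term of the square of \<open>cmod (a + x)\<close> is the real part of
    a linear function of \<open>x\<close>; as \<open>P\<close> it contributes nothing to the mean,
    and only \<open>- \<eta> * s\<^sup>2\<close> remains.\<close>
  have "circle_mean (\<lambda>\<zeta>. u (a + \<zeta>)) s \<le> Re (0 - 2 * of_real \<eta> * cnj a * 0) + (u a - \<eta> * s\<^sup>2)"
  proof (rule circle_mean_le[where P = "\<lambda>x. 0 - 2 * of_real \<eta> * cnj a * x"])
    show "continuous_on (sphere 0 s) (\<lambda>x. u (a + x))"
      by (rule continuous_on_compose2[OF c]) (use in_ball in \<open>auto intro!: continuous_intros\<close>)
    show "u (a + x) \<le> Re (0 - 2 * of_real \<eta> * cnj a * x) + (u a - \<eta> * s\<^sup>2)" if "x \<in> sphere 0 s" for x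
    proof -
      have "v (a + x) \<le> v a" using a(2) in_ball that by blast
      then have "u (a + x) + \<eta> * ((cmod a)\<^sup>2 + s\<^sup>2 + 2 * Re (cnj a * x)) \<le> u a + \<eta> * (cmod a)\<^sup>2"
        using that unfolding v_def norm_add_sq_complex by simp
      then show ?thesis by (simp add: algebra_simps)
    qed
  qed (use s in \<open>auto intro!: holomorphic_intros\<close>)
  moreover have "\<eta> * s\<^sup>2 > 0" using \<eta> s by simp
  ultimately show False using \<rho>(2)[OF s(1,2)] by simp
qed

text \<open>Subtract a harmonic polynomial lying just above \<open>u\<close> on the big circle. The
  difference inherits the local inequality, so it is at most 0 at the centre, where the polynomial
  equals its own mean.\<close>

lemma local_submean_imp_submean:
  fixes u :: "complex \<Rightarrow> real"
  assumes c: "continuous_on (cball 0 r) u" and r: "0 < r"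
    and sub: "\<And>a. a \<in> ball 0 r \<Longrightarrow> \<exists>\<rho>>0. \<forall>s. 0 < s \<longrightarrow> s < \<rho> \<longrightarrow> u a \<le> circle_mean (\<lambda>\<zeta>. u (a + \<zeta>)) s"
  shows "u 0 \<le> circle_mean u r"
proof (rule field_le_epsilon)
  fix e :: real assume "e > 0"
  have cs: "continuous_on (sphere 0 r) u" by (rule continuous_on_subset[OF c]) auto
  obtain p where p: "\<And>\<zeta>. \<zeta> \<in> sphere 0 r \<Longrightarrow> u \<zeta> \<le> Re (poly p \<zeta>)"
    "\<And>\<zeta>. \<zeta> \<in> sphere 0 r \<Longrightarrow> Re (poly p \<zeta>) \<le> u \<zeta> + e"
    using circle_poly_approx[OF cs \<open>e > 0\<close>] by blast
  have "u 0 - Re (poly p 0) \<le> 0"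
  proof (rule local_submean_max_principle[where r = r and u = "\<lambda>\<zeta>. u \<zeta> - Re (poly p \<zeta>)"])
    show "continuous_on (cball 0 r) (\<lambda>\<zeta>. u \<zeta> - Re (poly p \<zeta>))" by (intro continuous_intros c)
    fix a :: complex assume a: "a \<in> ball 0 r"
    obtain \<rho> where \<rho>: "\<rho> > 0" "\<And>s. 0 < s \<Longrightarrow> s < \<rho> \<Longrightarrow> u a \<le> circle_mean (\<lambda>\<zeta>. u (a + \<zeta>)) s"
      using sub[OF a] by blast
    show "\<exists>\<rho>>0. \<forall>s. 0 < s \<longrightarrow> s < \<rho> \<longrightarrow>
      u a - Re (poly p a) \<le> circle_mean (\<lambda>\<zeta>. u (a + \<zeta>) - Re (poly p (a + \<zeta>))) s"
    proof (intro exI conjI allI impI)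
      show "min \<rho> (r - cmod a) > 0" using \<rho>(1) a by simp
      fix s assume s: "0 < s" "s < min \<rho> (r - cmod a)"
      have in_ball: "a + x \<in> cball 0 r" if "x \<in> sphere 0 s" for x
        using that s(2) norm_triangle_ineq[of a x] by auto
      have "continuous_on (sphere 0 s) (\<lambda>x. u (a + x))"
        by (rule continuous_on_compose2[OF c]) (use in_ball in \<open>auto intro!: continuous_intros\<close>)
      then have "circle_mean (\<lambda>\<zeta>. u (a + \<zeta>) + Re (- poly p (a + \<zeta>))) s
          = circle_mean (\<lambda>\<zeta>. u (a + \<zeta>)) s + circle_mean (\<lambda>\<zeta>. Re (- poly p (a + \<zeta>))) s"
        using s by (intro circle_mean_add) (auto intro!: continuous_intros)
      also have "circle_mean (\<lambda>\<zeta>. Re (- poly p (a + \<zeta>))) s = Re (- poly p (a + 0))"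
        using s by (intro circle_mean_Re) (auto intro!: holomorphic_intros)
      finally show "u a - Re (poly p a) \<le> circle_mean (\<lambda>\<zeta>. u (a + \<zeta>) - Re (poly p (a + \<zeta>))) s"
        using \<rho>(2)[of s] s by simp
    qed
  qed (use r p in auto)
  moreover have "Re (poly p 0) \<le> circle_mean u r + e"
  proof -
    have "Re (poly p 0) = circle_mean (\<lambda>\<zeta>. Re (poly p \<zeta>)) r"
      using r by (intro circle_mean_Re[symmetric]) (auto intro!: holomorphic_intros)
    also have "\<dots> \<le> circle_mean (\<lambda>\<zeta>. u \<zeta> + e) r"
      using p r cs by (intro circle_mean_mono) (auto intro!: continuous_intros)
    also have "\<dots> = circle_mean u r + e" using r cs by (subst circle_mean_add) auto
    finally show ?thesis .
  qed
  ultimately show "u 0 \<le> circle_mean u r + e" by simp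
qed

section \<open>Locally plurisubharmonic functions\<close>

text \<open>Only small circles are tested, with a radius depending on point and direction. The
  notion is then visibly local, as the pastings require;
  \<open>locally_psh_imp_continuous_psh\<close> recovers all closed discs.\<close>

definition locally_psh_on :: "(complex ^ 'n) set \<Rightarrow> (complex ^ 'n \<Rightarrow> real) \<Rightarrow> bool" where
  "locally_psh_on S u \<longleftrightarrow> open S \<and> continuous_on S u \<and>
     (\<forall>a\<in>S. \<forall>b. \<exists>\<rho>>0. \<forall>s. 0 < s \<longrightarrow> s < \<rho> \<longrightarrow>
        u a \<le> circle_mean (\<lambda>\<tau>. u (a + \<tau> *s b)) s)"

lemma norm_vector_scalar_mult [simp]:
  fixes v :: "complex ^ 'n"
  shows "norm (c *s v) = cmod c * norm v"
  by (simp add: norm_vec_def norm_mult L2_set_right_distrib)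

lemma continuous_on_vector_scalar_mult [continuous_intros]:
  fixes v :: "'a::topological_space \<Rightarrow> complex ^ 'n"
  assumes "continuous_on S c" "continuous_on S v"
  shows "continuous_on S (\<lambda>x. c x *s v x)"
  unfolding vector_scalar_mult_def using assms by (intro continuous_intros)

lemma disc_in_open:
  fixes b :: "complex ^ 'n"
  assumes "open S" "a \<in> S"
  shows "\<exists>\<rho>>0. \<forall>\<tau>. cmod \<tau> < \<rho> \<longrightarrow> a + \<tau> *s b \<in> S"
proof -
  have "open ((\<lambda>\<tau>. a + \<tau> *s b) -` S)"
    by (rule open_vimage[OF assms(1)]) (intro continuous_intros)
  moreover have "0 \<in> (\<lambda>\<tau>. a + \<tau> *s b) -` S" using assms(2) by simp
  ultimately obtain \<rho> where "\<rho> > 0" "ball 0 \<rho> \<subseteq> (\<lambda>\<tau>. a + \<tau> *s b) -` S"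
    by (meson openE)
  then show ?thesis by (intro exI[of _ \<rho>]) auto
qed

lemma continuous_on_slice:
  fixes b :: "complex ^ 'n"
  assumes "continuous_on S u" "\<And>\<tau>. \<tau> \<in> A \<Longrightarrow> a + \<tau> *s b \<in> S"
  shows "continuous_on A (\<lambda>\<tau>. u (a + \<tau> *s b))"
  by (rule continuous_on_compose2[OF assms(1)]) (use assms(2) in \<open>auto intro!: continuous_intros\<close>)

text \<open>As \<open>S\<close> is open, the discs may be assumed to lie in \<open>S\<close>; this
  spares the later proofs the shrinking of \<open>\<rho>\<close>.\<close>

lemma locally_psh_onI:
  assumes S: "open S" and c: "continuous_on S u"
    and sub: "\<And>a b. a \<in> S \<Longrightarrow> \<exists>\<rho>>0. \<forall>s. 0 < s \<longrightarrow> s < \<rho> \<longrightarrow>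
        (\<forall>\<tau>\<in>cball 0 s. a + \<tau> *s b \<in> S) \<longrightarrow> u a \<le> circle_mean (\<lambda>\<tau>. u (a + \<tau> *s b)) s"
  shows "locally_psh_on S u"
  unfolding locally_psh_on_def
proof (intro conjI ballI allI S c)
  fix a b assume a: "a \<in> S"
  obtain r where r: "r > 0" "\<And>\<tau>. cmod \<tau> < r \<Longrightarrow> a + \<tau> *s b \<in> S"
    using disc_in_open[OF S a] by blast
  obtain \<rho> where \<rho>: "\<rho> > 0" "\<And>s. 0 < s \<Longrightarrow> s < \<rho> \<Longrightarrow>
        (\<forall>\<tau>\<in>cball 0 s. a + \<tau> *s b \<in> S) \<Longrightarrow> u a \<le> circle_mean (\<lambda>\<tau>. u (a + \<tau> *s b)) s"
    using sub[OF a] by blast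
  show "\<exists>\<rho>>0. \<forall>s. 0 < s \<longrightarrow> s < \<rho> \<longrightarrow>
      u a \<le> circle_mean (\<lambda>\<tau>. u (a + \<tau> *s b)) s"
    using r \<rho> by (intro exI[of _ "min r \<rho>"]) auto
qed

lemma locally_psh_on_open: "locally_psh_on S u \<Longrightarrow> open S"
  and locally_psh_on_continuous: "locally_psh_on S u \<Longrightarrow> continuous_on S u"
  by (auto simp: locally_psh_on_def)

lemma locally_psh_onD:
  assumes "locally_psh_on S u" "a \<in> S"
  shows "\<exists>\<rho>>0. \<forall>s. 0 < s \<longrightarrow> s < \<rho> \<longrightarrow> u a \<le> circle_mean (\<lambda>\<tau>. u (a + \<tau> *s b)) s"
  using assms unfolding locally_psh_on_def by blast

lemma circle_mean_cong:
  assumes "0 \<le> s" "\<And>\<zeta>. \<zeta> \<in> sphere 0 s \<Longrightarrow> f \<zeta> = g \<zeta>"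
  shows "circle_mean f s = circle_mean g s"
  unfolding circle_mean_def using assms circle_in_sphere[of s] by simp

lemma locally_psh_on_local:
  assumes "\<And>x. x \<in> S \<Longrightarrow> \<exists>N v. x \<in> N \<and> N \<subseteq> S \<and> locally_psh_on N v \<and> (\<forall>y\<in>N. u y = v y)"
  shows "locally_psh_on S u"
proof -
  have N: "\<exists>N. x \<in> N \<and> N \<subseteq> S \<and> locally_psh_on N u" if x: "x \<in> S" for x
  proof -
    obtain N v where Nv: "x \<in> N" "N \<subseteq> S" "locally_psh_on N v" "\<And>y. y \<in> N \<Longrightarrow> u y = v y"
      using assms[OF x] by blast
    have "locally_psh_on N u"
    proof (rule locally_psh_onI)
      show "open N" using Nv(3) by (rule locally_psh_on_open)
      show "continuous_on N u"
        by (rule continuous_on_eq[OF locally_psh_on_continuous[OF Nv(3)]]) (use Nv(4) in auto)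
      fix a b assume a: "a \<in> N"
      obtain \<rho> where \<rho>: "\<rho> > 0" "\<And>s. 0 < s \<Longrightarrow> s < \<rho> \<Longrightarrow> v a \<le> circle_mean (\<lambda>\<tau>. v (a + \<tau> *s b)) s"
        using locally_psh_onD[OF Nv(3) a, of b] by blast
      show "\<exists>\<rho>>0. \<forall>s. 0 < s \<longrightarrow> s < \<rho> \<longrightarrow>
        (\<forall>\<tau>\<in>cball 0 s. a + \<tau> *s b \<in> N) \<longrightarrow> u a \<le> circle_mean (\<lambda>\<tau>. u (a + \<tau> *s b)) s"
      proof (intro exI[of _ \<rho>] conjI allI impI)
        fix s assume s: "0 < s" "s < \<rho>" "\<forall>\<tau>\<in>cball 0 s. a + \<tau> *s b \<in> N"
        have "circle_mean (\<lambda>\<tau>. u (a + \<tau> *s b)) s = circle_mean (\<lambda>\<tau>. v (a + \<tau> *s b)) s"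
          using s Nv(4) by (intro circle_mean_cong) auto
        then show "u a \<le> circle_mean (\<lambda>\<tau>. u (a + \<tau> *s b)) s" using \<rho>(2)[OF s(1,2)] Nv(4)[OF a] by simp
      qed (use \<rho> in auto)
    qed
    then show ?thesis using Nv by blast
  qed
  show ?thesis
  proof (rule locally_psh_onI)
    show "open S"
      unfolding open_subopen[of S] using N locally_psh_on_open by meson
    show "continuous_on S u"
    proof (rule continuous_at_imp_continuous_on, rule ballI)
      fix x assume "x \<in> S"
      from N[OF this] obtain M where M: "x \<in> M" "locally_psh_on M u" by blast
      show "isCont u x"
        using continuous_on_eq_continuous_at[OF locally_psh_on_open[OF M(2)], of u]
          locally_psh_on_continuous[OF M(2)] M(1) by blast
    qed
    fix a b assume "a \<in> S"
    from N[OF this] obtain M where M: "a \<in> M" "locally_psh_on M u" by blast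
    show "\<exists>\<rho>>0. \<forall>s. 0 < s \<longrightarrow> s < \<rho> \<longrightarrow>
        (\<forall>\<tau>\<in>cball 0 s. a + \<tau> *s b \<in> S) \<longrightarrow> u a \<le> circle_mean (\<lambda>\<tau>. u (a + \<tau> *s b)) s"
      using locally_psh_onD[OF M(2,1), of b] by blast
  qed
qed

lemma locally_psh_on_subset:
  assumes "locally_psh_on S u" "open T" "T \<subseteq> S"
  shows "locally_psh_on T u"
proof (rule locally_psh_onI)
  show "continuous_on T u" using assms locally_psh_on_continuous continuous_on_subset by blast
  fix a b assume "a \<in> T"
  then have "a \<in> S" using assms by blast
  show "\<exists>\<rho>>0. \<forall>s. 0 < s \<longrightarrow> s < \<rho> \<longrightarrow>
        (\<forall>\<tau>\<in>cball 0 s. a + \<tau> *s b \<in> T) \<longrightarrow> u a \<le> circle_mean (\<lambda>\<tau>. u (a + \<tau> *s b)) s"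
    using locally_psh_onD[OF assms(1) \<open>a \<in> S\<close>, of b] by blast
qed (use assms in auto)

section \<open>Operations preserving plurisubharmonicity\<close>

lemma locally_psh_on_add:
  assumes u: "locally_psh_on S u" and v: "locally_psh_on S v"
  shows "locally_psh_on S (\<lambda>z. u z + v z)"
proof (rule locally_psh_onI)
  show "open S" using u by (rule locally_psh_on_open)
  show "continuous_on S (\<lambda>z. u z + v z)"
    by (intro continuous_on_add locally_psh_on_continuous u v)
  fix a b assume a: "a \<in> S"
  obtain \<rho>1 where \<rho>1: "\<rho>1 > 0" "\<And>s. 0 < s \<Longrightarrow> s < \<rho>1 \<Longrightarrow> u a \<le> circle_mean (\<lambda>\<tau>. u (a + \<tau> *s b)) s"
    using locally_psh_onD[OF u a, of b] by blast
  obtain \<rho>2 where \<rho>2: "\<rho>2 > 0" "\<And>s. 0 < s \<Longrightarrow> s < \<rho>2 \<Longrightarrow> v a \<le> circle_mean (\<lambda>\<tau>. v (a + \<tau> *s b)) s"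
    using locally_psh_onD[OF v a, of b] by blast
  show "\<exists>\<rho>>0. \<forall>s. 0 < s \<longrightarrow> s < \<rho> \<longrightarrow> (\<forall>\<tau>\<in>cball 0 s. a + \<tau> *s b \<in> S) \<longrightarrow>
      u a + v a \<le> circle_mean (\<lambda>\<tau>. u (a + \<tau> *s b) + v (a + \<tau> *s b)) s"
  proof (intro exI[of _ "min \<rho>1 \<rho>2"] conjI allI impI)
    fix s assume s: "0 < s" "s < min \<rho>1 \<rho>2" "\<forall>\<tau>\<in>cball 0 s. a + \<tau> *s b \<in> S"
    have "circle_mean (\<lambda>\<tau>. u (a + \<tau> *s b) + v (a + \<tau> *s b)) s
        = circle_mean (\<lambda>\<tau>. u (a + \<tau> *s b)) s + circle_mean (\<lambda>\<tau>. v (a + \<tau> *s b)) s"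
      using s by (intro circle_mean_add continuous_on_slice[OF locally_psh_on_continuous[OF u]]
        continuous_on_slice[OF locally_psh_on_continuous[OF v]]) auto
    then show "u a + v a \<le> circle_mean (\<lambda>\<tau>. u (a + \<tau> *s b) + v (a + \<tau> *s b)) s"
      using \<rho>1(2)[of s] \<rho>2(2)[of s] s by simp
  qed (use \<rho>1 \<rho>2 in auto)
qed

lemma locally_psh_on_cmult:
  assumes u: "locally_psh_on S u" and c: "0 \<le> (c::real)"
  shows "locally_psh_on S (\<lambda>z. c * u z)"
proof (rule locally_psh_onI)
  show "open S" using u by (rule locally_psh_on_open)
  show "continuous_on S (\<lambda>z. c * u z)"
    by (intro continuous_on_mult_left locally_psh_on_continuous u)
  fix a b assume a: "a \<in> S"
  obtain \<rho> where \<rho>: "\<rho> > 0" "\<And>s. 0 < s \<Longrightarrow> s < \<rho> \<Longrightarrow> u a \<le> circle_mean (\<lambda>\<tau>. u (a + \<tau> *s b)) s"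
    using locally_psh_onD[OF u a, of b] by blast
  then show "\<exists>\<rho>>0. \<forall>s. 0 < s \<longrightarrow> s < \<rho> \<longrightarrow> (\<forall>\<tau>\<in>cball 0 s. a + \<tau> *s b \<in> S) \<longrightarrow>
      c * u a \<le> circle_mean (\<lambda>\<tau>. c * u (a + \<tau> *s b)) s"
    using c by (intro exI[of _ \<rho>]) (auto simp: circle_mean_cmult intro!: mult_left_mono)
qed

lemma locally_psh_on_const: "open S \<Longrightarrow> locally_psh_on S (\<lambda>z. c)"
  by (rule locally_psh_onI) (auto intro!: exI[of _ 1])

lemma locally_psh_on_affine:
  assumes u: "locally_psh_on S u" and c: "0 \<le> (c::real)"
  shows "locally_psh_on S (\<lambda>z. c * u z + d)"
  by (intro locally_psh_on_add locally_psh_on_cmult locally_psh_on_const u c locally_psh_on_open[OF u])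

lemma inner_vector_scalar_mult:
  fixes b p :: "complex ^ 'n"
  shows "inner (\<tau> *s b) p = Re (\<tau> * (\<Sum>i\<in>UNIV. b $ i * cnj (p $ i)))"
  by (simp add: inner_vec_def inner_complex_def sum_distrib_left algebra_simps sum.distrib sum_subtractf)

lemma locally_psh_on_inner:
  assumes "open S"
  shows "locally_psh_on S (\<lambda>z. inner z p)"
proof (rule locally_psh_onI)
  show "continuous_on S (\<lambda>z. inner z p)" by (intro continuous_intros)
  fix a b
  show "\<exists>\<rho>>0. \<forall>s. 0 < s \<longrightarrow> s < \<rho> \<longrightarrow> (\<forall>\<tau>\<in>cball 0 s. a + \<tau> *s b \<in> S) \<longrightarrow>
      inner a p \<le> circle_mean (\<lambda>\<tau>. inner (a + \<tau> *s b) p) s"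
  proof (intro exI[of _ 1] conjI allI impI)
    fix s :: real assume s: "0 < s"
    define h where "h = (\<lambda>\<tau>. \<tau> * (\<Sum>i\<in>UNIV. b $ i * cnj (p $ i)))"
    have "circle_mean (\<lambda>\<tau>. inner a p + Re (h \<tau>)) s = inner a p + circle_mean (\<lambda>\<tau>. Re (h \<tau>)) s"
      using s by (subst circle_mean_add) (auto simp: h_def intro!: continuous_intros)
    also have "circle_mean (\<lambda>\<tau>. Re (h \<tau>)) s = Re (h 0)"
      using s by (intro circle_mean_Re) (auto simp: h_def intro!: holomorphic_intros)
    finally show "inner a p \<le> circle_mean (\<lambda>\<tau>. inner (a + \<tau> *s b) p) s"
      by (simp add: inner_add_left inner_vector_scalar_mult h_def)
  qed auto
qed (use assms in auto)

lemma locally_psh_on_max: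
  assumes u: "locally_psh_on S u" and v: "locally_psh_on S v"
  shows "locally_psh_on S (\<lambda>z. max (u z) (v z))"
proof (rule locally_psh_onI)
  show "open S" using u by (rule locally_psh_on_open)
  show cm: "continuous_on S (\<lambda>z. max (u z) (v z))"
    by (intro continuous_intros locally_psh_on_continuous u v)
  fix a b assume a: "a \<in> S"
  obtain \<rho>1 where \<rho>1: "\<rho>1 > 0" "\<And>s. 0 < s \<Longrightarrow> s < \<rho>1 \<Longrightarrow> u a \<le> circle_mean (\<lambda>\<tau>. u (a + \<tau> *s b)) s"
    using locally_psh_onD[OF u a, of b] by blast
  obtain \<rho>2 where \<rho>2: "\<rho>2 > 0" "\<And>s. 0 < s \<Longrightarrow> s < \<rho>2 \<Longrightarrow> v a \<le> circle_mean (\<lambda>\<tau>. v (a + \<tau> *s b)) s"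
    using locally_psh_onD[OF v a, of b] by blast
  show "\<exists>\<rho>>0. \<forall>s. 0 < s \<longrightarrow> s < \<rho> \<longrightarrow> (\<forall>\<tau>\<in>cball 0 s. a + \<tau> *s b \<in> S) \<longrightarrow>
      max (u a) (v a) \<le> circle_mean (\<lambda>\<tau>. max (u (a + \<tau> *s b)) (v (a + \<tau> *s b))) s"
  proof (intro exI[of _ "min \<rho>1 \<rho>2"] conjI allI impI)
    fix s assume s: "0 < s" "s < min \<rho>1 \<rho>2" "\<forall>\<tau>\<in>cball 0 s. a + \<tau> *s b \<in> S"
    have "circle_mean (\<lambda>\<tau>. u (a + \<tau> *s b)) s \<le> circle_mean (\<lambda>\<tau>. max (u (a + \<tau> *s b)) (v (a + \<tau> *s b))) s"
      using s by (intro circle_mean_mono continuous_on_slice[OF locally_psh_on_continuous[OF u]]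
        continuous_on_slice[OF cm]) auto
    moreover have "circle_mean (\<lambda>\<tau>. v (a + \<tau> *s b)) s \<le> circle_mean (\<lambda>\<tau>. max (u (a + \<tau> *s b)) (v (a + \<tau> *s b))) s"
      using s by (intro circle_mean_mono continuous_on_slice[OF locally_psh_on_continuous[OF v]]
        continuous_on_slice[OF cm]) auto
    ultimately show "max (u a) (v a) \<le> circle_mean (\<lambda>\<tau>. max (u (a + \<tau> *s b)) (v (a + \<tau> *s b))) s"
      using \<rho>1(2)[of s] \<rho>2(2)[of s] s by simp
  qed (use \<rho>1 \<rho>2 in auto)
qed

lemma locally_psh_on_Max:
  assumes "finite I" "I \<noteq> {}" "\<And>i. i \<in> I \<Longrightarrow> locally_psh_on S (u i)"
  shows "locally_psh_on S (\<lambda>z. Max ((\<lambda>i. u i z) ` I))"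
  using assms
proof (induction I rule: finite_ne_induct)
  case (insert i I)
  then have "locally_psh_on S (\<lambda>z. max (u i z) (Max ((\<lambda>i. u i z) ` I)))"
    by (intro locally_psh_on_max) auto
  then show ?case using insert by simp
qed simp

text \<open>The function \<open>- ln (- t)\<close> is increasing and convex for negative
  \<open>t\<close>. Jensen's inequality is applied through its tangent at \<open>t = u a\<close>, of
  slope \<open>- 1 / u a\<close>.\<close>

lemma locally_psh_on_neg_ln:
  assumes u: "locally_psh_on S u" and neg: "\<And>z. z \<in> S \<Longrightarrow> u z < 0"
  shows "locally_psh_on S (\<lambda>z. - ln (- u z))"
proof (rule locally_psh_onI)
  show "open S" using u by (rule locally_psh_on_open)
  show cm: "continuous_on S (\<lambda>z. - ln (- u z))"
    using neg by (intro continuous_intros locally_psh_on_continuous u) force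
  fix a b assume a: "a \<in> S"
  obtain \<rho> where \<rho>: "\<rho> > 0" "\<And>s. 0 < s \<Longrightarrow> s < \<rho> \<Longrightarrow> u a \<le> circle_mean (\<lambda>\<tau>. u (a + \<tau> *s b)) s"
    using locally_psh_onD[OF u a, of b] by blast
  show "\<exists>\<rho>>0. \<forall>s. 0 < s \<longrightarrow> s < \<rho> \<longrightarrow> (\<forall>\<tau>\<in>cball 0 s. a + \<tau> *s b \<in> S) \<longrightarrow>
      - ln (- u a) \<le> circle_mean (\<lambda>\<tau>. - ln (- u (a + \<tau> *s b))) s"
  proof (intro exI[of _ \<rho>] conjI allI impI)
    fix s assume s: "0 < s" "s < \<rho>" "\<forall>\<tau>\<in>cball 0 s. a + \<tau> *s b \<in> S"
    have cu: "continuous_on (sphere 0 s) (\<lambda>\<tau>. u (a + \<tau> *s b))"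
      using s by (intro continuous_on_slice[OF locally_psh_on_continuous[OF u]]) auto
    have ua: "u a < 0" using neg a by blast
    have tangent: "(1 - ln (- u a)) + (- 1 / u a) * u (a + \<tau> *s b) \<le> - ln (- u (a + \<tau> *s b))"
      if "\<tau> \<in> sphere 0 s" for \<tau>
    proof -
      have n: "u (a + \<tau> *s b) < 0" using s(3) that by (intro neg) auto
      have "ln (- u (a + \<tau> *s b)) - ln (- u a) = ln ((- u (a + \<tau> *s b)) / (- u a))"
        using n ua by (subst ln_divide_pos) auto
      also have "\<dots> \<le> (- u (a + \<tau> *s b)) / (- u a) - 1"
        using n ua by (intro ln_le_minus_one divide_pos_pos) auto
      finally show ?thesis by (simp add: algebra_simps)
    qed
    have "(- 1 / u a) * u a \<le> (- 1 / u a) * circle_mean (\<lambda>\<tau>. u (a + \<tau> *s b)) s"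
      using \<rho>(2)[OF s(1,2)] ua by (intro mult_left_mono) (auto simp: divide_simps)
    then have "- ln (- u a) \<le> (1 - ln (- u a)) + (- 1 / u a) * circle_mean (\<lambda>\<tau>. u (a + \<tau> *s b)) s"
      using ua by simp
    also have "\<dots> = circle_mean (\<lambda>\<tau>. (1 - ln (- u a)) + (- 1 / u a) * u (a + \<tau> *s b)) s"
      using cu s by (subst circle_mean_add) (auto simp only: circle_mean_const circle_mean_cmult
        intro!: continuous_intros)
    also have "\<dots> \<le> circle_mean (\<lambda>\<tau>. - ln (- u (a + \<tau> *s b))) s"
      using cu s tangent by (intro circle_mean_mono continuous_on_slice[OF cm] continuous_intros) auto
    finally show "- ln (- u a) \<le> circle_mean (\<lambda>\<tau>. - ln (- u (a + \<tau> *s b))) s" .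
  qed (use \<rho> in auto)
qed

text \<open>Points of \<open>T\<close> are interior to \<open>T\<close>, where a maximum of two
  plurisubharmonic functions is taken. At every other point, boundary points of \<open>T\<close>
  included, \<open>le\<close> makes the maximum collapse to \<open>u\<close> in a whole
  neighbourhood.\<close>

lemma locally_psh_on_glue:
  assumes u: "locally_psh_on S u" and v: "locally_psh_on T v" and T: "T \<subseteq> S"
    and le: "\<And>x. x \<in> S - T \<Longrightarrow> \<exists>N. open N \<and> x \<in> N \<and> (\<forall>y\<in>N \<inter> T. v y \<le> u y)"
  shows "locally_psh_on S (\<lambda>z. if z \<in> T then max (u z) (v z) else u z)"
proof (rule locally_psh_on_local)
  fix x assume x: "x \<in> S"
  show "\<exists>N w. x \<in> N \<and> N \<subseteq> S \<and> locally_psh_on N w \<and> (\<forall>y\<in>N. (if y \<in> T then max (u y) (v y) else u y) = w y)"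
  proof (cases "x \<in> T")
    case True
    have "locally_psh_on T (\<lambda>z. max (u z) (v z))"
      by (intro locally_psh_on_max v locally_psh_on_subset[OF u locally_psh_on_open[OF v] T])
    then show ?thesis using T True
      by (intro exI[of _ T] exI[of _ "\<lambda>z. max (u z) (v z)"]) simp
  next
    case False
    then have "x \<in> S - T" using x by simp
    from le[OF this] obtain N where N: "open N" "x \<in> N" "\<And>y. y \<in> N \<inter> T \<Longrightarrow> v y \<le> u y" by auto
    have "locally_psh_on (N \<inter> S) u"
      by (rule locally_psh_on_subset[OF u]) (use N(1) locally_psh_on_open[OF u] in auto)
    moreover have "\<forall>y\<in>N \<inter> S. (if y \<in> T then max (u y) (v y) else u y) = u y"
      using N(3) by (simp add: max_absorb1)
    ultimately show ?thesis using x N(2)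
      by (intro exI[of _ "N \<inter> S"] exI[of _ u]) simp
  qed
qed

section \<open>Agreement with the definition by closed discs\<close>

lemma continuous_psh_imp_locally_psh:
  assumes "continuous_plurisubharmonic_on S u" "open S"
  shows "locally_psh_on S u"
proof (rule locally_psh_onI)
  show "continuous_on S u" using assms by (simp add: continuous_plurisubharmonic_on_def)
  fix a b
  show "\<exists>\<rho>>0. \<forall>s. 0 < s \<longrightarrow> s < \<rho> \<longrightarrow>
        (\<forall>\<tau>\<in>cball 0 s. a + \<tau> *s b \<in> S) \<longrightarrow> u a \<le> circle_mean (\<lambda>\<tau>. u (a + \<tau> *s b)) s"
  proof (intro exI[of _ 1] conjI allI impI)
    fix s :: real assume s: "0 < s" "\<forall>\<tau>\<in>cball 0 s. a + \<tau> *s b \<in> S"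
    have "continuous_subharmonic_on {\<zeta>. a + \<zeta> *s b \<in> S} (\<lambda>\<zeta>. u (a + \<zeta> *s b))"
      using assms(1) unfolding continuous_plurisubharmonic_on_def by blast
    moreover have "cball 0 s \<subseteq> {\<zeta>. a + \<zeta> *s b \<in> S}" using s(2) by auto
    ultimately have "u (a + 0 *s b) \<le> integral {0..2 * pi} (\<lambda>t. u (a + (0 + of_real s * cis t) *s b)) / (2 * pi)"
      using s(1) unfolding continuous_subharmonic_on_def by blast
    then show "u a \<le> circle_mean (\<lambda>\<tau>. u (a + \<tau> *s b)) s" by (simp add: circle_mean_def)
  qed auto
qed (use assms in auto)

lemma locally_psh_imp_continuous_psh:
  assumes u: "locally_psh_on S u"
  shows "continuous_plurisubharmonic_on S u"
  unfolding continuous_plurisubharmonic_on_def continuous_subharmonic_on_def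
proof (intro conjI allI impI)
  show c: "continuous_on S u" using u by (rule locally_psh_on_continuous)
  fix a b :: "complex ^ 'a"
  show "continuous_on {\<zeta>. a + \<zeta> *s b \<in> S} (\<lambda>\<zeta>. u (a + \<zeta> *s b))" by (rule continuous_on_slice[OF c]) auto
  fix c :: complex and r :: real
  assume r: "0 < r" and sub: "cball c r \<subseteq> {\<zeta>. a + \<zeta> *s b \<in> S}"
  have in_S: "a + (c + \<zeta>) *s b \<in> S" if "\<zeta> \<in> cball 0 r" for \<zeta>
  proof -
    have "c + \<zeta> \<in> cball c r" using that by (simp add: dist_norm)
    then show ?thesis using sub by auto
  qed
  have shift: "a + (c + \<zeta>) *s b = a + c *s b + \<zeta> *s b" for \<zeta>
    by (simp add: vector_sadd_rdistrib add.assoc)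
  have "u (a + (c + 0) *s b) \<le> circle_mean (\<lambda>\<zeta>. u (a + (c + \<zeta>) *s b)) r"
  proof (rule local_submean_imp_submean[OF _ r])
    show "continuous_on (cball 0 r) (\<lambda>\<zeta>. u (a + (c + \<zeta>) *s b))"
      by (rule continuous_on_compose2[OF \<open>continuous_on S u\<close>]) (use in_S in \<open>auto intro!: continuous_intros\<close>)
    fix x :: complex assume "x \<in> ball 0 r"
    then have x: "a + (c + x) *s b \<in> S" using in_S by auto
    have "(a + (c + x) *s b) + \<zeta> *s b = a + (c + (x + \<zeta>)) *s b" for \<zeta>
      by (simp add: vector_sadd_rdistrib add.assoc)
    then show "\<exists>\<rho>>0. \<forall>s. 0 < s \<longrightarrow> s < \<rho> \<longrightarrow>
        u (a + (c + x) *s b) \<le> circle_mean (\<lambda>\<zeta>. u (a + (c + (x + \<zeta>)) *s b)) s"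
      using locally_psh_onD[OF u x, of b] by (simp add: add.assoc)
  qed
  then show "u (a + c *s b) \<le> integral {0..2 * pi} (\<lambda>t. u (a + (c + complex_of_real r * cis t) *s b)) / (2 * pi)"
    by (simp add: circle_mean_def)
qed

section \<open>The maximum principle along holomorphic discs\<close>

definition holomorphic_curve_on :: "complex set \<Rightarrow> (complex \<Rightarrow> complex ^ 'n) \<Rightarrow> bool" where
  "holomorphic_curve_on S \<gamma> \<longleftrightarrow> (\<forall>i. (\<lambda>\<zeta>. \<gamma> \<zeta> $ i) holomorphic_on S)"

lemma holomorphic_curve_continuous:
  assumes "holomorphic_curve_on S \<gamma>"
  shows "continuous_on S \<gamma>"
proof -
  have "continuous_on S (\<lambda>\<zeta>. \<chi> i. \<gamma> \<zeta> $ i)"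
    using assms unfolding holomorphic_curve_on_def
    by (intro continuous_on_vec_lambda holomorphic_on_imp_continuous_on) auto
  then show ?thesis by simp
qed

lemma holomorphic_first_order:
  fixes f :: "complex \<Rightarrow> complex"
  assumes f: "f holomorphic_on S" and S: "open S" "cball x r \<subseteq> S"
  shows "\<exists>C\<ge>0. \<forall>\<tau>\<in>cball 0 r. cmod (f (x + \<tau>) - f x - \<tau> * deriv f x) \<le> C * (cmod \<tau>)\<^sup>2"
proof (cases "r \<ge> 0")
  case True
  have hol: "(deriv ^^ i) f holomorphic_on S" for i
    by (rule holomorphic_higher_deriv[OF f S(1)])
  have "continuous_on (cball x r) ((deriv ^^ 2) f)"
    using hol S(2) by (meson continuous_on_subset holomorphic_on_imp_continuous_on)
  then have "bounded ((deriv ^^ 2) f ` cball x r)"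
    by (intro compact_imp_bounded compact_continuous_image compact_cball)
  then obtain B where B: "B > 0" "\<And>y. y \<in> cball x r \<Longrightarrow> cmod ((deriv ^^ 2) f y) \<le> B"
    unfolding bounded_pos by auto
  have "cmod (f (x + \<tau>) - f x - \<tau> * deriv f x) \<le> B * (cmod \<tau>)\<^sup>2" if "\<tau> \<in> cball 0 r" for \<tau>
  proof -
    have "cmod ((deriv ^^ 0) f (x + \<tau>) - (\<Sum>i\<le>1. (deriv ^^ i) f x * (x + \<tau> - x) ^ i / fact i))
        \<le> B * cmod (x + \<tau> - x) ^ Suc 1 / fact 1"
    proof (rule complex_Taylor[where S = "cball x r"])
      fix i y assume "y \<in> cball x r" "i \<le> (1::nat)"
      then have "y \<in> S" using S by auto
      then show "((deriv ^^ i) f has_field_derivative (deriv ^^ Suc i) f y) (at y within cball x r)"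
        using holomorphic_derivI[OF hol S(1)] by (simp add: has_field_derivative_at_within)
    next
      fix y assume "y \<in> cball x r"
      then show "cmod ((deriv ^^ Suc 1) f y) \<le> B" using B(2)[of y] by (simp add: numeral_2_eq_2)
    qed (use True that in \<open>auto simp: dist_norm\<close>)
    then show ?thesis by (simp add: algebra_simps power2_eq_square)
  qed
  then show ?thesis using B(1) by (intro exI[of _ B]) auto
qed (auto intro!: exI[of _ 0])

lemma holomorphic_curve_first_order:
  fixes \<gamma> :: "complex \<Rightarrow> complex ^ 'n"
  assumes \<gamma>: "holomorphic_curve_on S \<gamma>" and S: "open S" "cball x r \<subseteq> S"
  shows "\<exists>b C. 0 \<le> C \<and> (\<forall>\<tau>\<in>cball 0 r. norm (\<gamma> (x + \<tau>) - \<gamma> x - \<tau> *s b) \<le> C * (cmod \<tau>)\<^sup>2)"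
proof -
  define b where "b = (\<chi> i. deriv (\<lambda>\<zeta>. \<gamma> \<zeta> $ i) x)"
  have "\<forall>i. \<exists>C\<ge>0. \<forall>\<tau>\<in>cball 0 r. cmod (\<gamma> (x + \<tau>) $ i - \<gamma> x $ i - \<tau> * b $ i) \<le> C * (cmod \<tau>)\<^sup>2"
    using \<gamma> S unfolding holomorphic_curve_on_def b_def by (auto intro!: holomorphic_first_order)
  then obtain C where C: "\<And>i. C i \<ge> 0"
    "\<And>i \<tau>. \<tau> \<in> cball 0 r \<Longrightarrow> cmod (\<gamma> (x + \<tau>) $ i - \<gamma> x $ i - \<tau> * b $ i) \<le> C i * (cmod \<tau>)\<^sup>2"
    by metis
  have "norm (\<gamma> (x + \<tau>) - \<gamma> x - \<tau> *s b) \<le> (\<Sum>i\<in>UNIV. C i) * (cmod \<tau>)\<^sup>2" if "\<tau> \<in> cball 0 r" for \<tau>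
  proof -
    have "norm (\<gamma> (x + \<tau>) - \<gamma> x - \<tau> *s b) \<le> (\<Sum>i\<in>UNIV. norm ((\<gamma> (x + \<tau>) - \<gamma> x - \<tau> *s b) $ i))"
      unfolding norm_vec_def by (rule L2_set_le_sum) simp
    also have "\<dots> \<le> (\<Sum>i\<in>UNIV. C i * (cmod \<tau>)\<^sup>2)"
      using C(2)[OF that] by (intro sum_mono) simp
    finally show ?thesis by (simp add: sum_distrib_right)
  qed
  then show ?thesis using C(1) by (intro exI[of _ b] exI[of _ "\<Sum>i\<in>UNIV. C i"]) (simp add: sum_nonneg)
qed

lemma uniform_near_curve:
  fixes \<gamma> :: "complex \<Rightarrow> complex ^ 'n" and \<phi> :: "complex ^ 'n \<Rightarrow> real"
  assumes "continuous_on \<Omega> \<phi>" "open \<Omega>" "continuous_on (cball 0 \<rho>) \<gamma>"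
    "\<And>\<zeta>. \<zeta> \<in> cball 0 \<rho> \<Longrightarrow> \<gamma> \<zeta> \<in> \<Omega>" "0 < e"
  obtains \<sigma> where "0 < \<sigma>" "\<And>\<zeta> y. \<zeta> \<in> cball 0 \<rho> \<Longrightarrow> norm y \<le> \<sigma> \<Longrightarrow> \<gamma> \<zeta> + y \<in> \<Omega>"
    "\<And>\<zeta> y. \<zeta> \<in> cball 0 \<rho> \<Longrightarrow> norm y \<le> \<sigma> \<Longrightarrow> \<bar>\<phi> (\<gamma> \<zeta> + y) - \<phi> (\<gamma> \<zeta>)\<bar> < e"
proof -
  have "compact (\<gamma> ` cball 0 \<rho>)" by (intro compact_continuous_image assms compact_cball)
  moreover have "\<gamma> ` cball 0 \<rho> \<subseteq> \<Omega>" using assms(4) by blast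
  ultimately obtain \<sigma>0 where \<sigma>0: "\<sigma>0 > 0" "(\<Union>x\<in>\<gamma> ` cball 0 \<rho>. cball x \<sigma>0) \<subseteq> \<Omega>"
    by (rule compact_subset_open_imp_cball_epsilon_subset[OF _ assms(2)])
  have in_\<Omega>: "\<gamma> \<zeta> + y \<in> \<Omega>" if "\<zeta> \<in> cball 0 \<rho>" "norm y \<le> \<sigma>0" for \<zeta> y
  proof -
    have "\<gamma> \<zeta> + y \<in> cball (\<gamma> \<zeta>) \<sigma>0" using that by (simp add: dist_norm)
    then show ?thesis using \<sigma>0(2) that(1) by blast
  qed
  define K where "K = cball (0::complex^'n) \<sigma>0 \<times> cball (0::complex) \<rho>"
  have "continuous_on K (\<lambda>p. \<phi> (\<gamma> (snd p) + fst p))"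
  proof (rule continuous_on_compose2[OF assms(1)])
    show "continuous_on K (\<lambda>p. \<gamma> (snd p) + fst p)"
      unfolding K_def by (intro continuous_intros continuous_on_compose2[OF assms(3)]) auto
  qed (use in_\<Omega> in \<open>auto simp: K_def\<close>)
  then have "uniformly_continuous_on K (\<lambda>p. \<phi> (\<gamma> (snd p) + fst p))"
    unfolding K_def by (intro compact_uniformly_continuous compact_Times compact_cball)
  then obtain d where d: "d > 0" "\<And>p q. p \<in> K \<Longrightarrow> q \<in> K \<Longrightarrow> dist q p < d \<Longrightarrow>
      dist (\<phi> (\<gamma> (snd q) + fst q)) (\<phi> (\<gamma> (snd p) + fst p)) < e"
    unfolding uniformly_continuous_on_def using assms(5) by meson
  show ?thesis
  proof (rule that[of "min \<sigma>0 (d/2)"])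
    fix \<zeta> :: complex and y :: "complex ^ 'n" assume z: "\<zeta> \<in> cball 0 \<rho>" "norm y \<le> min \<sigma>0 (d/2)"
    then show "\<gamma> \<zeta> + y \<in> \<Omega>" using in_\<Omega> by simp
    have "dist (y, \<zeta>) (0, \<zeta>) < d" using z(2) d(1) by (simp add: dist_Pair_Pair)
    then have "dist (\<phi> (\<gamma> \<zeta> + y)) (\<phi> (\<gamma> \<zeta> + 0)) < e"
      using d(2)[of "(0, \<zeta>)" "(y, \<zeta>)"] z \<sigma>0(1) by (simp add: K_def)
    then show "\<bar>\<phi> (\<gamma> \<zeta> + y) - \<phi> (\<gamma> \<zeta>)\<bar> < e" by (simp add: dist_real_def)
  qed (use \<sigma>0 d in auto)
qed

lemma norm_diff_sq:
  fixes c r :: "complex ^ 'n"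
  shows "(norm (c - r))\<^sup>2 = (norm c)\<^sup>2 - 2 * Re (\<Sum>i\<in>UNIV. r $ i * cnj (c $ i)) + (norm r)\<^sup>2"
proof -
  have "inner r c = Re (\<Sum>i\<in>UNIV. r $ i * cnj (c $ i))"
    using inner_vector_scalar_mult[of 1 r c] by simp
  then show ?thesis unfolding power2_norm_eq_inner by (simp add: inner_diff_left inner_diff_right inner_commute)
qed

text \<open>
  Doubling of variables: along the complex line \<open>\<tau> \<mapsto> (\<xi> + \<tau>, \<gamma> \<xi> + c + \<tau> b)\<close> with \<open>b = \<gamma>' \<xi>\<close> the penalty
  \<open>N |y|\<^sup>2\<close> changes by a harmonic term and \<open>O(|\<tau>|\<^sup>4)\<close>, which the gain \<open>\<eta> |\<tau>|\<^sup>2\<close> outweighs. This is how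
  the submean inequality on affine discs, without any smoothness, controls curved discs.
\<close>

lemma psh_along_curve_no_strict_max:
  fixes \<gamma> :: "complex \<Rightarrow> complex ^ 'n"
  assumes \<phi>: "locally_psh_on \<Omega> \<phi>" and S: "open S" "\<xi> \<in> S" and \<gamma>: "holomorphic_curve_on S \<gamma>"
    and c: "\<gamma> \<xi> + c \<in> \<Omega>" and pos: "0 < \<eta>" "0 \<le> N" "0 < \<delta>"
    and max: "\<And>\<tau> y. cmod \<tau> \<le> \<delta> \<Longrightarrow> norm (y - c) \<le> \<delta> \<Longrightarrow> \<gamma> (\<xi> + \<tau>) + y \<in> \<Omega> \<and>
      \<phi> (\<gamma> (\<xi> + \<tau>) + y) + \<eta> * (cmod (\<xi> + \<tau>))\<^sup>2 - N * (norm y)\<^sup>2 \<le> \<phi> (\<gamma> \<xi> + c) + \<eta> * (cmod \<xi>)\<^sup>2 - N * (norm c)\<^sup>2"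
  shows False
proof -
  obtain r where r: "r > 0" "cball \<xi> r \<subseteq> S" using S open_contains_cball by blast
  obtain b C where C: "0 \<le> C" "\<And>\<tau>. \<tau> \<in> cball 0 r \<Longrightarrow> norm (\<gamma> (\<xi> + \<tau>) - \<gamma> \<xi> - \<tau> *s b) \<le> C * (cmod \<tau>)\<^sup>2"
    using holomorphic_curve_first_order[OF \<gamma> S(1) r(2)] by blast
  define R where "R = (\<lambda>\<tau>. \<gamma> (\<xi> + \<tau>) - \<gamma> \<xi> - \<tau> *s b)"
  define z where "z = \<gamma> \<xi> + c"
  obtain \<rho> where \<rho>: "\<rho> > 0" "\<And>s. 0 < s \<Longrightarrow> s < \<rho> \<Longrightarrow> \<phi> z \<le> circle_mean (\<lambda>\<tau>. \<phi> (z + \<tau> *s b)) s"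
    using locally_psh_onD[OF \<phi> c, of b] unfolding z_def by blast
  \<comment> \<open>\<open>s \<le> 1\<close> and \<open>C * s \<le> \<delta>\<close> keep the
    remainder \<open>R\<close> within \<open>\<delta>\<close>;
    \<open>N * C\<^sup>2 * s < \<eta>\<close> makes the quartic error smaller than the gain
    \<open>\<eta> * s\<^sup>2\<close>.\<close>
  define s where "s = Min {r, \<delta>, \<rho> / 2, 1, \<delta> / (C + 1), \<eta> / (2 * (N * C\<^sup>2 + 1))}"
  have "s > 0" unfolding s_def using r \<rho> pos C by (subst Min_gr_iff) (auto intro!: divide_pos_pos add_nonneg_pos)
  moreover have "s \<le> r" "s \<le> \<delta>" "s \<le> \<rho> / 2" "s \<le> 1" "s \<le> \<delta> / (C + 1)" "s \<le> \<eta> / (2 * (N * C\<^sup>2 + 1))"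
    unfolding s_def by (simp_all only: Min_le finite_insert finite.emptyI insert_iff simp_thms)
  ultimately have s: "s > 0" "s \<le> r" "s \<le> \<delta>" "s < \<rho>" "s \<le> 1" "C * s \<le> \<delta>" "N * C\<^sup>2 * s < \<eta>"
  proof -
    assume *: "s > 0" "s \<le> r" "s \<le> \<delta>" "s \<le> \<rho> / 2" "s \<le> 1" "s \<le> \<delta> / (C + 1)" "s \<le> \<eta> / (2 * (N * C\<^sup>2 + 1))"
    show "s > 0" "s \<le> r" "s \<le> \<delta>" "s < \<rho>" "s \<le> 1" using * \<rho>(1) by auto
    have "s * (C + 1) \<le> \<delta>" using *(6) C(1) by (simp add: pos_le_divide_eq)
    then show "C * s \<le> \<delta>" using *(1) by (simp add: algebra_simps)
    have "0 \<le> N * C\<^sup>2" using pos by simp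
    then have "s * (2 * (N * C\<^sup>2 + 1)) \<le> \<eta>" using *(7) by (simp add: pos_le_divide_eq)
    moreover have "0 \<le> s * (N * C\<^sup>2)" using *(1) \<open>0 \<le> N * C\<^sup>2\<close> by simp
    ultimately show "N * C\<^sup>2 * s < \<eta>" using *(1) by (simp add: algebra_simps)
  qed
  define P where "P = (\<lambda>\<tau>. - 2 * of_real \<eta> * (cnj \<xi> * \<tau>) - 2 * of_real N * (\<Sum>i\<in>UNIV. R \<tau> $ i * cnj (c $ i)))"
  have key: "z + \<tau> *s b \<in> \<Omega> \<and> \<phi> (z + \<tau> *s b) \<le> Re (P \<tau>) + (\<phi> z - \<eta> * s\<^sup>2 + N * (C * s\<^sup>2)\<^sup>2)"
    if "\<tau> \<in> sphere 0 s" for \<tau>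
  proof -
    have \<tau>: "cmod \<tau> = s" using that by simp
    have R: "norm (R \<tau>) \<le> C * s\<^sup>2" using C(2)[of \<tau>] \<tau> s unfolding R_def by simp
    have "C * s\<^sup>2 \<le> \<delta>"
      using s C mult_left_mono[of "s * s" s C] mult_left_le[of s s] by (simp add: power2_eq_square)
    then have le: "norm ((c - R \<tau>) - c) \<le> \<delta>" using R by simp
    \<comment> \<open>The choice \<open>y = c - R \<tau>\<close> cancels the deviation of
      \<open>\<gamma>\<close> from its tangent, so the maximality of \<open>(c, \<xi>)\<close> is
      tested on an affine disc.\<close>
    have eq: "\<gamma> (\<xi> + \<tau>) + (c - R \<tau>) = z + \<tau> *s b" by (simp add: R_def z_def)
    have "z + \<tau> *s b \<in> \<Omega>"
      and m: "\<phi> (z + \<tau> *s b) + \<eta> * (cmod (\<xi> + \<tau>))\<^sup>2 - N * (norm (c - R \<tau>))\<^sup>2 \<le> \<phi> z + \<eta> * (cmod \<xi>)\<^sup>2 - N * (norm c)\<^sup>2"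
      using max[OF _ le, of \<tau>] \<tau> s unfolding eq z_def[symmetric] by auto
    have "(norm (R \<tau>))\<^sup>2 \<le> (C * s\<^sup>2)\<^sup>2" using R by (intro power_mono) auto
    then have "N * (norm (R \<tau>))\<^sup>2 \<le> N * (C * s\<^sup>2)\<^sup>2" using pos by (intro mult_left_mono) auto
    then show ?thesis using m \<open>z + \<tau> *s b \<in> \<Omega>\<close> \<tau>
      unfolding norm_add_sq_complex norm_diff_sq P_def by (simp add: algebra_simps)
  qed
  have "circle_mean (\<lambda>\<tau>. \<phi> (z + \<tau> *s b)) s \<le> Re (P 0) + (\<phi> z - \<eta> * s\<^sup>2 + N * (C * s\<^sup>2)\<^sup>2)"
  proof (rule circle_mean_le)
    show "continuous_on (sphere 0 s) (\<lambda>\<tau>. \<phi> (z + \<tau> *s b))"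
      using key by (intro continuous_on_slice[OF locally_psh_on_continuous[OF \<phi>]]) blast
    have hol: "(\<lambda>\<tau>. \<gamma> (\<xi> + \<tau>) $ i) holomorphic_on cball 0 s" for i
    proof -
      have "(\<lambda>\<zeta>. \<gamma> \<zeta> $ i) \<circ> (\<lambda>\<tau>. \<xi> + \<tau>) holomorphic_on cball 0 s"
      proof (rule holomorphic_on_compose_gen)
        show "(\<lambda>\<zeta>. \<gamma> \<zeta> $ i) holomorphic_on S" using \<gamma> by (simp add: holomorphic_curve_on_def)
        have "\<xi> + \<tau> \<in> cball \<xi> r" if "\<tau> \<in> cball 0 s" for \<tau> using that s(2) by (simp add: dist_norm)
        then show "(+) \<xi> ` cball 0 s \<subseteq> S" using r(2) by blast
      qed (auto intro!: holomorphic_intros)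
      then show ?thesis by (simp add: o_def)
    qed
    show "P holomorphic_on cball 0 s"
      unfolding P_def R_def by (auto intro!: holomorphic_intros hol)
  qed (use key s in auto)
  also have "P 0 = 0" by (simp add: P_def R_def)
  finally have "\<phi> z \<le> \<phi> z - \<eta> * s\<^sup>2 + N * (C * s\<^sup>2)\<^sup>2" using \<rho>(2)[OF s(1,4)] by simp
  then have "\<eta> * s\<^sup>2 \<le> (N * C\<^sup>2 * s\<^sup>2) * s\<^sup>2" by (simp add: power2_eq_square algebra_simps)
  then have "\<eta> \<le> N * C\<^sup>2 * s\<^sup>2" using s(1) by simp
  also have "\<dots> \<le> N * C\<^sup>2 * s" using s pos by (intro mult_left_mono) (auto simp: power2_eq_square)
  finally show False using s(7) by simp
qed

text \<open>If the bound failed, the doubled function \<open>\<Phi>\<close> would attain its maximum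
  over \<open>K\<close> at an interior point, which \<open>psh_along_curve_no_strict_max\<close>
  excludes.\<close>

lemma psh_max_principle_along_curve:
  fixes \<gamma> :: "complex \<Rightarrow> complex ^ 'n"
  assumes \<phi>: "locally_psh_on \<Omega> \<phi>" and S: "open S" "cball 0 \<rho> \<subseteq> S" and \<rho>: "0 < \<rho>"
    and \<gamma>: "holomorphic_curve_on S \<gamma>" and in_\<Omega>: "\<And>\<zeta>. \<zeta> \<in> cball 0 \<rho> \<Longrightarrow> \<gamma> \<zeta> \<in> \<Omega>"
    and bd: "\<And>\<zeta>. \<zeta> \<in> sphere 0 \<rho> \<Longrightarrow> \<phi> (\<gamma> \<zeta>) \<le> M" and \<zeta>: "\<zeta> \<in> cball 0 \<rho>"
  shows "\<phi> (\<gamma> \<zeta>) \<le> M"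
proof (rule ccontr)
  assume "\<not> \<phi> (\<gamma> \<zeta>) \<le> M"
  define m where "m = \<phi> (\<gamma> \<zeta>) - M"
  have m: "m > 0" using \<open>\<not> \<phi> (\<gamma> \<zeta>) \<le> M\<close> by (simp add: m_def)
  have c\<gamma>: "continuous_on (cball 0 \<rho>) \<gamma>"
    using holomorphic_curve_continuous[OF \<gamma>] S(2) by (rule continuous_on_subset)
  have c\<phi>: "continuous_on \<Omega> \<phi>" by (rule locally_psh_on_continuous[OF \<phi>])
  obtain \<sigma> where \<sigma>: "0 < \<sigma>" "\<And>\<zeta> y. \<zeta> \<in> cball 0 \<rho> \<Longrightarrow> norm y \<le> \<sigma> \<Longrightarrow> \<gamma> \<zeta> + y \<in> \<Omega>"
    "\<And>\<zeta> y. \<zeta> \<in> cball 0 \<rho> \<Longrightarrow> norm y \<le> \<sigma> \<Longrightarrow> \<bar>\<phi> (\<gamma> \<zeta> + y) - \<phi> (\<gamma> \<zeta>)\<bar> < m / 4"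
    using uniform_near_curve[OF c\<phi> locally_psh_on_open[OF \<phi>] c\<gamma> in_\<Omega>, of "m / 4"] m by (metis zero_less_divide_iff zero_less_numeral)
  have "continuous_on (cball 0 \<rho>) (\<lambda>\<zeta>. \<phi> (\<gamma> \<zeta>))"
    by (rule continuous_on_compose2[OF c\<phi> c\<gamma>]) (use in_\<Omega> in auto)
  then have "bounded ((\<lambda>\<zeta>. \<phi> (\<gamma> \<zeta>)) ` cball 0 \<rho>)"
    by (intro compact_imp_bounded compact_continuous_image compact_cball)
  then obtain B where B: "B > 0" "\<And>\<zeta>. \<zeta> \<in> cball 0 \<rho> \<Longrightarrow> \<bar>\<phi> (\<gamma> \<zeta>)\<bar> \<le> B"
    unfolding bounded_pos by auto
  \<comment> \<open>\<open>\<eta> * \<rho>\<^sup>2\<close> is a quarter of the excess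
    \<open>m\<close>, too little to produce a maximum with \<open>\<xi>\<close> on the boundary
    circle. \<open>N * \<sigma>\<^sup>2\<close> exceeds the bound \<open>2 * B\<close> on the
    oscillation of \<open>\<phi>\<close> along the disc, which keeps \<open>c\<close> off the sphere
    of radius \<open>\<sigma>\<close>.\<close>
  define \<eta> where "\<eta> = m / (4 * \<rho>\<^sup>2)"
  define N where "N = (2 * B + m) / \<sigma>\<^sup>2"
  have \<eta>: "\<eta> > 0" "\<eta> * \<rho>\<^sup>2 = m / 4" using m \<rho> by (simp_all add: \<eta>_def)
  have N: "N \<ge> 0" "N * \<sigma>\<^sup>2 = 2 * B + m" using m B \<sigma> by (simp_all add: N_def)
  define \<Phi> where "\<Phi> = (\<lambda>(y, \<zeta>). \<phi> (\<gamma> \<zeta> + y) + \<eta> * (cmod \<zeta>)\<^sup>2 - N * (norm y)\<^sup>2)"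
  define K where "K = cball (0::complex^'n) \<sigma> \<times> cball (0::complex) \<rho>"
  have "continuous_on K (\<lambda>p. \<phi> (\<gamma> (snd p) + fst p))"
  proof (rule continuous_on_compose2[OF c\<phi>])
    show "continuous_on K (\<lambda>p. \<gamma> (snd p) + fst p)"
      unfolding K_def by (intro continuous_intros continuous_on_compose2[OF c\<gamma>]) auto
  qed (use \<sigma>(2) in \<open>auto simp: K_def\<close>)
  then have "continuous_on K \<Phi>" unfolding \<Phi>_def case_prod_unfold by (intro continuous_intros)
  moreover have "compact K" unfolding K_def by (intro compact_Times compact_cball)
  moreover have z0: "(0, \<zeta>) \<in> K" using \<zeta> \<sigma>(1) by (simp add: K_def)
  ultimately obtain p where p: "p \<in> K" "\<And>q. q \<in> K \<Longrightarrow> \<Phi> q \<le> \<Phi> p"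
    using continuous_attains_sup[of K \<Phi>] by blast
  obtain c \<xi> where p_eq: "p = (c, \<xi>)" by (cases p)
  have c: "norm c \<le> \<sigma>" and \<xi>: "\<xi> \<in> cball 0 \<rho>" using p(1) by (auto simp: K_def p_eq)
  have "\<phi> (\<gamma> \<zeta>) \<le> \<Phi> (0, \<zeta>)" using \<eta> by (simp add: \<Phi>_def)
  then have big: "\<phi> (\<gamma> \<zeta>) \<le> \<Phi> (c, \<xi>)" using p(2)[OF z0] p_eq by simp
  have \<xi>_sq: "\<eta> * (cmod \<xi>)\<^sup>2 \<le> m / 4"
    using \<eta> \<xi> by (metis dist_0_norm less_imp_le mem_cball mult_left_mono norm_ge_zero power_mono)
  have near: "\<phi> (\<gamma> \<xi> + c) < \<phi> (\<gamma> \<xi>) + m / 4" using \<sigma>(3)[OF \<xi> c] by linarith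
  have "norm c < \<sigma>"
  proof (rule ccontr)
    assume "\<not> norm c < \<sigma>"
    then have "N * (norm c)\<^sup>2 = 2 * B + m" using c N(2) by (metis antisym_conv2)
    then have "\<Phi> (c, \<xi>) < B - 2 * B"
      using near \<xi>_sq B(2)[OF \<xi>] m by (simp add: \<Phi>_def)
    then show False using big B(2)[OF \<zeta>] by simp
  qed
  moreover have "cmod \<xi> < \<rho>"
  proof (rule ccontr)
    assume "\<not> cmod \<xi> < \<rho>"
    then have "\<phi> (\<gamma> \<xi>) \<le> M" using \<xi> bd by simp
    moreover have "0 \<le> N * (norm c)\<^sup>2" using N(1) by simp
    moreover have "\<Phi> (c, \<xi>) = \<phi> (\<gamma> \<xi> + c) + \<eta> * (cmod \<xi>)\<^sup>2 - N * (norm c)\<^sup>2"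
      by (simp add: \<Phi>_def)
    ultimately have "\<Phi> (c, \<xi>) < M + m" using near \<xi>_sq m by linarith
    then show False using big by (simp add: m_def)
  qed
  ultimately have \<delta>: "min (\<sigma> - norm c) (\<rho> - cmod \<xi>) > 0" by simp
  show False
  proof (rule psh_along_curve_no_strict_max[OF \<phi> S(1) _ \<gamma> _ \<eta>(1) N(1) \<delta>])
    show "\<xi> \<in> S" using \<xi> S(2) by blast
    show "\<gamma> \<xi> + c \<in> \<Omega>" using \<sigma>(2)[OF \<xi> c] .
    fix \<tau> y assume a: "cmod \<tau> \<le> min (\<sigma> - norm c) (\<rho> - cmod \<xi>)" "norm (y - c) \<le> min (\<sigma> - norm c) (\<rho> - cmod \<xi>)"
    have 1: "norm y \<le> \<sigma>" using a(2) norm_triangle_ineq2[of y c] by simp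
    have 2: "\<xi> + \<tau> \<in> cball 0 \<rho>" using a(1) norm_triangle_ineq[of \<xi> \<tau>] by simp
    have "(y, \<xi> + \<tau>) \<in> K" using 1 2 by (simp add: K_def)
    then have "\<Phi> (y, \<xi> + \<tau>) \<le> \<Phi> (c, \<xi>)" using p(2) p_eq by simp
    then show "\<gamma> (\<xi> + \<tau>) + y \<in> \<Omega> \<and>
      \<phi> (\<gamma> (\<xi> + \<tau>) + y) + \<eta> * (cmod (\<xi> + \<tau>))\<^sup>2 - N * (norm y)\<^sup>2 \<le> \<phi> (\<gamma> \<xi> + c) + \<eta> * (cmod \<xi>)\<^sup>2 - N * (norm c)\<^sup>2"
      using \<sigma>(2)[OF 2 1] by (simp add: \<Phi>_def)
  qed
qed

section \<open>Plurisubharmonicity of minus the logarithm of the distance\<close>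

lemma holomorphic_curve_has_derivative:
  fixes \<gamma> :: "complex \<Rightarrow> complex ^ 'n"
  assumes \<gamma>: "holomorphic_curve_on S \<gamma>" and S: "open S" "x \<in> S"
  shows "(\<gamma> has_derivative (\<lambda>\<tau>. \<tau> *s (\<chi> i. deriv (\<lambda>\<zeta>. \<gamma> \<zeta> $ i) x))) (at x)"
proof (subst has_derivative_componentwise_within, rule ballI)
  fix e :: "complex ^ 'n" assume "e \<in> Basis"
  then obtain i u where e: "e = axis i u" unfolding Basis_vec_def by auto
  have "(\<lambda>\<zeta>. \<gamma> \<zeta> $ i) holomorphic_on S" using \<gamma> by (simp add: holomorphic_curve_on_def)
  then have "((\<lambda>\<zeta>. \<gamma> \<zeta> $ i) has_derivative (\<lambda>\<tau>. deriv (\<lambda>\<zeta>. \<gamma> \<zeta> $ i) x * \<tau>)) (at x)"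
    using holomorphic_derivI[OF _ S] by (simp add: has_field_derivative_def)
  then have "((\<lambda>\<zeta>. inner (\<gamma> \<zeta> $ i) u) has_derivative (\<lambda>\<tau>. inner (deriv (\<lambda>\<zeta>. \<gamma> \<zeta> $ i) x * \<tau>) u)) (at x)"
    by (rule has_derivative_inner_left)
  then show "((\<lambda>\<zeta>. inner (\<gamma> \<zeta>) e) has_derivative
      (\<lambda>\<tau>. inner (\<tau> *s (\<chi> i. deriv (\<lambda>\<zeta>. \<gamma> \<zeta> $ i) x)) e)) (at x)"
    by (simp add: e inner_axis mult.commute)
qed

lemma holomorphic_map_compose_curve:
  fixes \<gamma> :: "complex \<Rightarrow> complex ^ 'n"
  assumes H: "holomorphic_map_on B H" and \<gamma>: "holomorphic_curve_on S \<gamma>" and S: "open S"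
    and sub: "\<And>\<zeta>. \<zeta> \<in> S \<Longrightarrow> \<gamma> \<zeta> \<in> B"
  shows "holomorphic_curve_on S (\<lambda>\<zeta>. H (\<gamma> \<zeta>))"
  unfolding holomorphic_curve_on_def
proof
  fix i
  have "(\<lambda>\<zeta>. H (\<gamma> \<zeta>) $ i) field_differentiable at x" if x: "x \<in> S" for x
  proof -
    define b where "b = (\<chi> i. deriv (\<lambda>\<zeta>. \<gamma> \<zeta> $ i) x)"
    obtain D where D: "(H has_derivative D) (at (\<gamma> x))" "\<And>c v. D (c *s v) = c *s D v"
      using H sub[OF x] unfolding holomorphic_map_on_def by blast
    have "((\<lambda>\<zeta>. H (\<gamma> \<zeta>)) has_derivative (\<lambda>\<tau>. D (\<tau> *s b))) (at x)"
      using has_derivative_compose[OF holomorphic_curve_has_derivative[OF \<gamma> S x] D(1)] by (simp add: b_def)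
    then have "((\<lambda>\<zeta>. H (\<gamma> \<zeta>) $ i) has_derivative (\<lambda>\<tau>. D (\<tau> *s b) $ i)) (at x)"
      by (rule bounded_linear.has_derivative[OF bounded_linear_vec_nth])
    moreover have "(\<lambda>\<tau>. D (\<tau> *s b) $ i) = (*) (D b $ i)"
      by (rule ext) (simp add: D(2))
    ultimately have "((\<lambda>\<zeta>. H (\<gamma> \<zeta>) $ i) has_field_derivative D b $ i) (at x)"
      unfolding has_field_derivative_def by simp
    then show ?thesis by (auto simp: field_differentiable_def)
  qed
  then show "(\<lambda>\<zeta>. H (\<gamma> \<zeta>) $ i) holomorphic_on S"
    by (simp add: holomorphic_on_def field_differentiable_at_within)
qed

lemma holomorphic_map_continuous:
  assumes "holomorphic_map_on B H"
  shows "continuous_on B H"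
proof (rule continuous_at_imp_continuous_on, rule ballI)
  fix x assume "x \<in> B"
  then show "isCont H x"
    using assms has_derivative_continuous unfolding holomorphic_map_on_def by blast
qed

lemma holomorphic_curve_subset:
  "holomorphic_curve_on S \<gamma> \<Longrightarrow> T \<subseteq> S \<Longrightarrow> holomorphic_curve_on T \<gamma>"
  unfolding holomorphic_curve_on_def by (meson holomorphic_on_subset)

text \<open>
  Continuity principle: the parameters \<open>s\<close> whose disc lies in the domain form an open set, and a closed one
  because the maximum principle keeps all these discs in one relatively compact sublevel set.
\<close>

lemma disc_family_stays_inside:
  fixes \<gamma> \<delta> :: "complex \<Rightarrow> complex ^ 'n" and H :: "complex ^ 'n \<Rightarrow> complex ^ 'n"
  assumes \<phi>: "locally_psh_on \<Omega> \<phi>" and exh: "\<And>c. closure {z \<in> \<Omega>. \<phi> z < c} \<subseteq> \<Omega>"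
    and H: "holomorphic_map_on B H" "open B"
    and S: "open S" "cball 0 \<rho> \<subseteq> S" and \<rho>: "0 < \<rho>"
    and \<gamma>: "holomorphic_curve_on S \<gamma>" and \<delta>: "holomorphic_curve_on S \<delta>"
    and in_B: "\<And>s \<zeta>. s \<in> {0..1} \<Longrightarrow> \<zeta> \<in> cball 0 \<rho> \<Longrightarrow> \<gamma> \<zeta> + of_real s *s \<delta> \<zeta> \<in> B"
    and bdry: "\<And>s \<zeta>. s \<in> {0..1} \<Longrightarrow> \<zeta> \<in> sphere 0 \<rho> \<Longrightarrow> H (\<gamma> \<zeta> + of_real s *s \<delta> \<zeta>) \<in> \<Omega>"
    and start: "\<And>\<zeta>. \<zeta> \<in> cball 0 \<rho> \<Longrightarrow> H (\<gamma> \<zeta>) \<in> \<Omega>"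
    and \<zeta>: "\<zeta> \<in> cball 0 \<rho>"
  shows "H (\<gamma> \<zeta> + \<delta> \<zeta>) \<in> \<Omega>"
proof -
  define G where "G = (\<lambda>p. H (\<gamma> (snd p) + of_real (fst p) *s \<delta> (snd p)))"
  define J where "J = {0..1::real}"
  have J: "compact J" "closed J" by (auto simp: J_def)
  have c\<gamma>: "continuous_on (cball 0 \<rho>) \<gamma>" "continuous_on (cball 0 \<rho>) \<delta>"
    using holomorphic_curve_continuous[OF \<gamma>] holomorphic_curve_continuous[OF \<delta>] S(2)
    by (auto intro: continuous_on_subset)
  have cG: "continuous_on (J \<times> cball 0 \<rho>) G"
    unfolding G_def
  proof (rule continuous_on_compose2[OF holomorphic_map_continuous[OF H(1)]])
    show "continuous_on (J \<times> cball 0 \<rho>) (\<lambda>p. \<gamma> (snd p) + of_real (fst p) *s \<delta> (snd p))"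
      by (intro continuous_intros continuous_on_compose2[OF c\<gamma>(1)] continuous_on_compose2[OF c\<gamma>(2)]) auto
  qed (use in_B in \<open>auto simp: J_def\<close>)
  have "continuous_on (J \<times> sphere 0 \<rho>) (\<lambda>p. \<phi> (G p))"
  proof (rule continuous_on_compose2[OF locally_psh_on_continuous[OF \<phi>]])
    show "continuous_on (J \<times> sphere 0 \<rho>) G" by (rule continuous_on_subset[OF cG]) auto
  qed (use bdry in \<open>auto simp: J_def G_def\<close>)
  then have "bounded ((\<lambda>p. \<phi> (G p)) ` (J \<times> sphere 0 \<rho>))"
    by (intro compact_imp_bounded compact_continuous_image compact_Times J(1)) auto
  then obtain M where "\<forall>x\<in>(\<lambda>p. \<phi> (G p)) ` (J \<times> sphere 0 \<rho>). norm x \<le> M"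
    unfolding bounded_iff by blast
  then have M: "\<phi> (G (s, \<zeta>)) \<le> M" if "s \<in> J" "\<zeta> \<in> sphere 0 \<rho>" for s \<zeta>
    using that by force
  have bound: "\<phi> (G (s, \<zeta>)) \<le> M"
    if s: "s \<in> J" and ins: "\<And>\<zeta>. \<zeta> \<in> cball 0 \<rho> \<Longrightarrow> G (s, \<zeta>) \<in> \<Omega>" and \<zeta>: "\<zeta> \<in> cball 0 \<rho>" for s \<zeta>
  proof -
    define \<gamma>s where "\<gamma>s = (\<lambda>\<zeta>. \<gamma> \<zeta> + of_real s *s \<delta> \<zeta>)"
    define T where "T = S \<inter> \<gamma>s -` B"
    have hol: "holomorphic_curve_on S \<gamma>s"
      using \<gamma> \<delta> unfolding holomorphic_curve_on_def \<gamma>s_def by (auto intro!: holomorphic_intros)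
    have T: "open T"
      unfolding T_def by (intro continuous_open_preimage holomorphic_curve_continuous[OF hol] S(1) H(2))
    have holT: "holomorphic_curve_on T (\<lambda>\<zeta>. H (\<gamma>s \<zeta>))"
      by (rule holomorphic_map_compose_curve[OF H(1) holomorphic_curve_subset[OF hol] T]) (auto simp: T_def)
    have "cball 0 \<rho> \<subseteq> T" using S(2) in_B s by (auto simp: T_def \<gamma>s_def J_def)
    then have "\<phi> (H (\<gamma>s \<zeta>)) \<le> M"
      by (rule psh_max_principle_along_curve[OF \<phi> T _ \<rho> holT])
        (use ins M[OF s] \<zeta> in \<open>auto simp: \<gamma>s_def G_def\<close>)
    then show ?thesis by (simp add: G_def \<gamma>s_def)
  qed
  define K where "K = closure {z \<in> \<Omega>. \<phi> z < M + 1}"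
  define I where "I = {s \<in> J. \<forall>\<zeta>\<in>cball 0 \<rho>. G (s, \<zeta>) \<in> \<Omega>}"
  \<comment> \<open>Thanks to \<open>bound\<close>, membership in the open set
    \<open>\<Omega>\<close> may be replaced by membership in the closed set \<open>K\<close>; this
    is where closedness of \<open>I\<close> comes from.\<close>
  have I_eq: "I = {s \<in> J. \<forall>\<zeta>\<in>cball 0 \<rho>. G (s, \<zeta>) \<in> K}"
  proof (intro set_eqI iffI)
    fix s assume "s \<in> I"
    then have s: "s \<in> J" "\<And>\<zeta>. \<zeta> \<in> cball 0 \<rho> \<Longrightarrow> G (s, \<zeta>) \<in> \<Omega>" by (auto simp: I_def)
    have "G (s, \<zeta>) \<in> K" if "\<zeta> \<in> cball 0 \<rho>" for \<zeta>
      using s(2)[OF that] bound[OF s that] closure_subset[of "{z \<in> \<Omega>. \<phi> z < M + 1}"]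
      by (force simp: K_def)
    then show "s \<in> {s \<in> J. \<forall>\<zeta>\<in>cball 0 \<rho>. G (s, \<zeta>) \<in> K}" using s(1) by simp
  next
    fix s assume "s \<in> {s \<in> J. \<forall>\<zeta>\<in>cball 0 \<rho>. G (s, \<zeta>) \<in> K}"
    then show "s \<in> I" using exh[of "M + 1"] unfolding I_def K_def by blast
  qed
  have "closed I"
  proof -
    have "I = (\<Inter>\<zeta>\<in>cball 0 \<rho>. J \<inter> (\<lambda>s. G (s, \<zeta>)) -` K)"
      using \<rho> unfolding I_eq by (auto 4 4)
    moreover have "closed (J \<inter> (\<lambda>s. G (s, \<zeta>)) -` K)" if "\<zeta> \<in> cball 0 \<rho>" for \<zeta>
    proof (rule continuous_closed_preimage)
      show "continuous_on J (\<lambda>s. G (s, \<zeta>))"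
        by (rule continuous_on_compose2[OF cG]) (use that in \<open>auto intro!: continuous_intros\<close>)
    qed (auto simp: J K_def)
    ultimately show ?thesis by (metis (no_types, lifting) closed_INT)
  qed
  \<comment> \<open>Openness of \<open>I\<close> in \<open>J\<close>: the bad parameters are the
    projection of a compact set of pairs.\<close>
  moreover have "closed (J - I)"
  proof -
    have "J - I = fst ` ((J \<times> cball 0 \<rho>) \<inter> G -` (- \<Omega>))"
      unfolding I_def by force
    moreover have "compact ((J \<times> cball 0 \<rho>) \<inter> G -` (- \<Omega>))"
    proof -
      have "closed ((J \<times> cball 0 \<rho>) \<inter> G -` (- \<Omega>))"
        using locally_psh_on_open[OF \<phi>] by (intro continuous_closed_preimage cG closed_Times J) auto
      moreover have "(J \<times> cball 0 \<rho>) \<inter> G -` (- \<Omega>) = (J \<times> cball 0 \<rho>) \<inter> ((J \<times> cball 0 \<rho>) \<inter> G -` (- \<Omega>))"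
        by blast
      ultimately show ?thesis
        using compact_Int_closed[OF compact_Times[OF J(1) compact_cball]] by metis
    qed
    ultimately show ?thesis
      by (simp only:) (intro compact_imp_closed compact_continuous_image continuous_on_fst continuous_on_id)
  qed
  moreover have "0 \<in> I" using start by (auto simp: I_def G_def J_def)
  moreover have "connected J" unfolding J_def by simp
  ultimately have "I \<inter> J = {} \<or> (J - I) \<inter> J = {}"
    by (intro connected_closedD) auto
  moreover have "I \<inter> J \<noteq> {}" using \<open>0 \<in> I\<close> by (auto simp: I_def)
  ultimately have "J - I = {}" by blast
  then have "1 \<in> I" by (auto simp: J_def)
  then have "G (1, \<zeta>) \<in> \<Omega>" using \<zeta> by (simp add: I_def)
  then show ?thesis by (simp add: G_def)
qed

text \<open>Oka's argument. Let \<open>Re p\<close> lie just above minus the logarithm of the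
  distance on the circle, and \<open>q = exp (- p)\<close>. For \<open>norm v < 1\<close> the discs
  \<open>\<gamma> + s * q * v\<close> start from \<open>\<gamma>\<close> and, seen through
  \<open>H\<close>, have their boundary circles in \<open>\<Omega>\<close>, so they stay in it.
  Hence the ball of radius \<open>cmod (q 0)\<close> about \<open>\<gamma> 0\<close> misses
  \<open>E\<close>. This compares the distance at the centre with \<open>Re (poly p 0)\<close>,
  which is the mean of \<open>Re p\<close>.\<close>

lemma minus_ln_distance_submean:
  fixes \<gamma> :: "complex \<Rightarrow> complex ^ 'n" and H :: "complex ^ 'n \<Rightarrow> complex ^ 'n"
  assumes \<phi>: "locally_psh_on \<Omega> \<phi>" and exh: "\<And>c. closure {z \<in> \<Omega>. \<phi> z < c} \<subseteq> \<Omega>"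
    and H: "holomorphic_map_on (ball 0 r) H"
    and E: "E = {w \<in> ball 0 r. H w \<notin> \<Omega>}" "0 \<in> E"
    and S: "open S" "cball 0 \<rho> \<subseteq> S" and \<rho>: "0 < \<rho>"
    and \<gamma>: "holomorphic_curve_on S \<gamma>"
    and in_\<Omega>: "\<And>\<zeta>. \<zeta> \<in> cball 0 \<rho> \<Longrightarrow> norm (\<gamma> \<zeta>) < r / 4 \<and> H (\<gamma> \<zeta>) \<in> \<Omega>"
    and pos: "\<And>\<zeta>. \<zeta> \<in> cball 0 \<rho> \<Longrightarrow> infdist (\<gamma> \<zeta>) E > 0"
  shows "- ln (infdist (\<gamma> 0) E) \<le> circle_mean (\<lambda>\<zeta>. - ln (infdist (\<gamma> \<zeta>) E)) \<rho>"
proof (rule field_le_epsilon)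
  fix e :: real assume "e > 0"
  let ?f = "\<lambda>\<zeta>. - ln (infdist (\<gamma> \<zeta>) E)"
  have c\<gamma>: "continuous_on (cball 0 \<rho>) \<gamma>"
    using holomorphic_curve_continuous[OF \<gamma>] S(2) by (rule continuous_on_subset)
  have cf: "continuous_on (sphere 0 \<rho>) ?f"
    by (intro continuous_intros continuous_on_subset[OF c\<gamma>]) (use pos in force)+
  obtain p where p: "\<And>\<zeta>. \<zeta> \<in> sphere 0 \<rho> \<Longrightarrow> ?f \<zeta> \<le> Re (poly p \<zeta>)"
    "\<And>\<zeta>. \<zeta> \<in> sphere 0 \<rho> \<Longrightarrow> Re (poly p \<zeta>) \<le> ?f \<zeta> + e"
    using circle_poly_approx[OF cf \<open>e > 0\<close>] by blast
  \<comment> \<open>An exponential has no zeros, and its modulus is prescribed by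
    \<open>Re p\<close>.\<close>
  define q where "q = (\<lambda>\<zeta>. exp (- poly p \<zeta>))"
  have q_hol: "q holomorphic_on A" for A unfolding q_def by (intro holomorphic_intros)
  have q_sphere: "cmod (q \<zeta>) \<le> infdist (\<gamma> \<zeta>) E" if "\<zeta> \<in> sphere 0 \<rho>" for \<zeta>
  proof -
    have "cmod (q \<zeta>) = exp (- Re (poly p \<zeta>))" by (simp add: q_def norm_exp_eq_Re)
    also have "\<dots> \<le> exp (ln (infdist (\<gamma> \<zeta>) E))" using p(1)[OF that] by simp
    also have "\<dots> = infdist (\<gamma> \<zeta>) E" using pos[of \<zeta>] that by simp
    finally show ?thesis .
  qed
  \<comment> \<open>\<open>E\<close> is the complement of \<open>\<Omega>\<close> within the chart
    ball only, so the discs must not leave that ball. \<open>0 \<in> E\<close> bounds the distances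
    by \<open>r / 4\<close>, and the points of \<open>\<gamma>\<close> have norm below
    \<open>r / 4\<close>.\<close>
  have small: "infdist (\<gamma> \<zeta>) E \<le> r / 4" if "\<zeta> \<in> cball 0 \<rho>" for \<zeta>
    using infdist_le[OF E(2), of "\<gamma> \<zeta>"] in_\<Omega>[OF that] by simp
  have q_cball: "cmod (q \<zeta>) \<le> r / 4" if "\<zeta> \<in> cball 0 \<rho>" for \<zeta>
  proof (rule maximum_modulus_frontier[OF q_hol _ bounded_cball _ that])
    show "continuous_on (closure (cball 0 \<rho>)) q"
      using q_hol holomorphic_on_imp_continuous_on by blast
    show "cmod (q z) \<le> r / 4" if "z \<in> frontier (cball 0 \<rho>)" for z
      using that q_sphere[of z] small[of z] \<rho> by (auto simp: frontier_cball)
  qed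
  have inside: "H (\<gamma> 0 + q 0 *s v) \<in> \<Omega>" if v: "norm v < 1" for v
  proof (rule disc_family_stays_inside[where \<delta> = "\<lambda>\<zeta>. q \<zeta> *s v", OF \<phi> exh H open_ball S \<rho> \<gamma>])
    show "holomorphic_curve_on S (\<lambda>\<zeta>. q \<zeta> *s v)"
      unfolding holomorphic_curve_on_def using q_hol by (auto intro!: holomorphic_intros)
    have dist: "norm (of_real s *s (q \<zeta> *s v)) \<le> cmod (q \<zeta>) * norm v" if "s \<in> {0..1}" for s \<zeta>
    proof -
      have "s * (cmod (q \<zeta>) * norm v) \<le> cmod (q \<zeta>) * norm v"
        using that by (intro mult_left_le_one_le) auto
      then show ?thesis using that by (simp add: norm_mult mult.assoc)
    qed
    show "\<gamma> \<zeta> + of_real s *s (q \<zeta> *s v) \<in> ball 0 r" if "s \<in> {0..1}" "\<zeta> \<in> cball 0 \<rho>" for s \<zeta>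
    proof -
      have "cmod (q \<zeta>) * norm v \<le> cmod (q \<zeta>)" using v by (simp add: mult_left_le)
      then have "cmod (q \<zeta>) * norm v \<le> r / 4" using q_cball[OF that(2)] by linarith
      moreover have "norm (\<gamma> \<zeta>) < r / 4" using in_\<Omega>[OF that(2)] by simp
      ultimately have "norm (\<gamma> \<zeta> + of_real s *s (q \<zeta> *s v)) < r"
        using dist[OF that(1), of \<zeta>] norm_triangle_ineq[of "\<gamma> \<zeta>" "of_real s *s (q \<zeta> *s v)"] norm_ge_zero[of "\<gamma> \<zeta>"]
        by linarith
      then show ?thesis by (simp only: mem_ball_0)
    qed note in_B = this
    show "H (\<gamma> \<zeta> + of_real s *s (q \<zeta> *s v)) \<in> \<Omega>" if "s \<in> {0..1}" "\<zeta> \<in> sphere 0 \<rho>" for s \<zeta>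
    proof (rule ccontr)
      assume "H (\<gamma> \<zeta> + of_real s *s (q \<zeta> *s v)) \<notin> \<Omega>"
      then have "\<gamma> \<zeta> + of_real s *s (q \<zeta> *s v) \<in> E" using in_B[of s \<zeta>] that by (simp add: E(1))
      from infdist_le[OF this, of "\<gamma> \<zeta>"] have "infdist (\<gamma> \<zeta>) E \<le> norm (of_real s *s (q \<zeta> *s v))"
        by (simp add: dist_norm del: norm_vector_scalar_mult)
      also have "\<dots> \<le> cmod (q \<zeta>) * norm v" by (rule dist[OF that(1)])
      also have "\<dots> \<le> infdist (\<gamma> \<zeta>) E * norm v" using q_sphere[OF that(2)] by (intro mult_right_mono) auto
      also have "\<dots> < infdist (\<gamma> \<zeta>) E * 1" using v pos[of \<zeta>] that(2) by (intro mult_strict_left_mono) auto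
      finally show False by simp
    qed
    show "H (\<gamma> \<zeta>) \<in> \<Omega>" if "\<zeta> \<in> cball 0 \<rho>" for \<zeta> using in_\<Omega>[OF that] by simp
  qed (use \<rho> in auto)
  have "q 0 \<noteq> 0" by (simp add: q_def)
  have "cmod (q 0) \<le> infdist (\<gamma> 0) E"
  proof (subst infdist_notempty)
    show "E \<noteq> {}" using E(2) by blast
    show "cmod (q 0) \<le> (INF a\<in>E. dist (\<gamma> 0) a)"
    proof (rule cINF_greatest)
      fix y assume y: "y \<in> E"
      show "cmod (q 0) \<le> dist (\<gamma> 0) y"
      proof (rule ccontr)
        assume "\<not> cmod (q 0) \<le> dist (\<gamma> 0) y"
        then have lt: "norm (y - \<gamma> 0) < cmod (q 0)" by (simp add: dist_norm norm_minus_commute)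
        \<comment> \<open>A point \<open>y\<close> of \<open>E\<close> closer than
          \<open>cmod (q 0)\<close> would be the centre of the final disc for this
          \<open>v\<close>.\<close>
        define v where "v = inverse (q 0) *s (y - \<gamma> 0)"
        have "norm v = norm (y - \<gamma> 0) / cmod (q 0)"
          unfolding v_def norm_vector_scalar_mult by (simp add: norm_inverse divide_inverse mult.commute)
        then have "norm v < 1" using lt \<open>q 0 \<noteq> 0\<close> by simp
        moreover have "q 0 *s v = y - \<gamma> 0" using \<open>q 0 \<noteq> 0\<close> unfolding v_def vector_smult_assoc by simp
        ultimately show False using inside[of v] y by (simp add: E(1))
      qed
    qed (use E(2) in blast)
  qed
  moreover have "cmod (q 0) = exp (- Re (poly p 0))" by (simp add: q_def norm_exp_eq_Re)
  ultimately have "ln (exp (- Re (poly p 0))) \<le> ln (infdist (\<gamma> 0) E)"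
    by (subst ln_le_cancel_iff) (use pos[of 0] \<rho> in auto)
  then have "?f 0 \<le> Re (poly p 0)" by simp
  also have "\<dots> = circle_mean (\<lambda>\<zeta>. Re (poly p \<zeta>)) \<rho>"
    using \<rho> by (intro circle_mean_Re[symmetric]) (auto intro!: holomorphic_intros)
  also have "\<dots> \<le> circle_mean (\<lambda>\<zeta>. ?f \<zeta> + e) \<rho>"
      proof (rule circle_mean_mono)
    show "continuous_on (sphere 0 \<rho>) (\<lambda>\<zeta>. Re (poly p \<zeta>))" by (intro continuous_intros)
    show "continuous_on (sphere 0 \<rho>) (\<lambda>\<zeta>. ?f \<zeta> + e)" by (intro continuous_on_add cf continuous_on_const)
  qed (use p \<rho> in auto)
  also have "\<dots> = circle_mean ?f \<rho> + e" using \<rho> cf by (subst circle_mean_add) auto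
  finally show "?f 0 \<le> circle_mean ?f \<rho> + e" .
qed

section \<open>Graph domains\<close>

lemma infdist_frontier_le:
  fixes S :: "'a::euclidean_space set"
  assumes "z \<in> S" "q \<notin> S"
  shows "infdist z (frontier S) \<le> dist z q"
proof -
  have "closed_segment z q \<inter> frontier S \<noteq> {}"
    using assms by (intro connected_Int_frontier) auto
  then obtain x where x: "x \<in> closed_segment z q" "x \<in> frontier S" by blast
  have "infdist z (frontier S) \<le> dist z x" by (rule infdist_le[OF x(2)])
  also have "\<dots> \<le> dist z q" using dist_in_closed_segment[OF x(1)] by (simp add: dist_commute)
  finally show ?thesis .
qed

text \<open>\<open>holomorphic_map_on\<close> asks only for complex differentiability at each point,
  so a local bound on the derivative has to come from Cauchy estimates along the complex line
  through \<open>x\<close> and \<open>y\<close>.\<close>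

lemma holomorphic_map_lipschitz:
  fixes F :: "complex ^ 'n \<Rightarrow> complex ^ 'n"
  assumes F: "holomorphic_map_on U F" and U: "open U" "p \<in> U"
  obtains r K where "0 < r" "1 \<le> K" "ball p r \<subseteq> U"
    "\<And>x y. x \<in> ball p r \<Longrightarrow> y \<in> ball p r \<Longrightarrow> dist (F x) (F y) \<le> K * dist x y"
proof -
  obtain R where R: "R > 0" "cball p R \<subseteq> U" using U open_contains_cball by blast
  have "bounded (F ` cball p R)"
    by (intro compact_imp_bounded compact_continuous_image compact_cball
      continuous_on_subset[OF holomorphic_map_continuous[OF F] R(2)])
  then obtain M where M: "M > 0" "\<And>x. x \<in> cball p R \<Longrightarrow> norm (F x) \<le> M"
    unfolding bounded_pos by auto
  define K where "K = real CARD('n) * (M / (R / 4)) + 1"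
  have K: "K \<ge> 1" using M R by (simp add: K_def)
  \<comment> \<open>Two such points are less than \<open>R / 4\<close> apart. On their line a disc
    of radius \<open>3 * R / 4\<close> about \<open>x\<close> stays in \<open>cball p R\<close> and
    contains the Cauchy circles of radius \<open>R / 4\<close> about all parameters up to
    \<open>t\<close>.\<close>
  have "dist (F x) (F y) \<le> K * dist x y" if x: "x \<in> ball p (R / 8)" and y: "y \<in> ball p (R / 8)" for x y
  proof (cases "x = y")
    case False
    define t where "t = norm (y - x)"
    have t: "t > 0" "t < R / 4"
      using False x y dist_triangle_half_r[of p x "R / 4" y] by (auto simp: t_def dist_norm norm_minus_commute)
    define v where "v = inverse (of_real t) *s (y - x)"
    have "norm v = inverse t * t"
      unfolding v_def norm_vector_scalar_mult using t by (simp add: norm_inverse flip: t_def)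
    then have v: "norm v = 1" "x + of_real t *s v = y"
      using t unfolding v_def vector_smult_assoc by auto
    define S where "S = ball (0::complex) (R * (3/4))"
    have in_R: "x + \<zeta> *s v \<in> cball p R" if "\<zeta> \<in> S" for \<zeta>
    proof -
      have "dist p (x + \<zeta> *s v) \<le> dist p x + cmod \<zeta>"
        using norm_triangle_ineq4[of "p - x" "\<zeta> *s v"] v(1) by (simp add: dist_norm algebra_simps)
      then show ?thesis using that x R(1) by (simp add: S_def)
    qed
    have hol: "holomorphic_curve_on S (\<lambda>\<zeta>. F (x + \<zeta> *s v))"
    proof (rule holomorphic_map_compose_curve[OF F])
      show "holomorphic_curve_on S (\<lambda>\<zeta>. x + \<zeta> *s v)"
        by (auto simp: holomorphic_curve_on_def intro!: holomorphic_intros)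
    qed (use in_R R(2) in \<open>auto simp: S_def\<close>)
    have comp: "cmod (F y $ i - F x $ i) \<le> M / (R / 4) * t" for i
    proof -
      define f where "f = (\<lambda>\<zeta>. F (x + \<zeta> *s v) $ i)"
      have f: "f holomorphic_on S" using hol by (simp add: holomorphic_curve_on_def f_def)
      have der: "cmod (deriv f \<zeta>) \<le> M / (R / 4)" if "\<zeta> \<in> cball 0 t" for \<zeta>
      proof -
        have sub: "cball \<zeta> (R / 4) \<subseteq> S"
        proof
          fix x assume "x \<in> cball \<zeta> (R / 4)"
          then have "cmod x \<le> cmod \<zeta> + R / 4"
            using norm_triangle_sub[of x \<zeta>] by (simp add: dist_norm norm_minus_commute)
          then show "x \<in> S" using that t R(1) by (simp add: S_def)
        qed
        have "cmod ((deriv ^^ 1) f \<zeta>) \<le> fact 1 * M / (R / 4) ^ 1"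
        proof (rule Cauchy_inequality)
          show "f holomorphic_on ball \<zeta> (R / 4)"
            by (rule holomorphic_on_subset[OF f]) (use sub in auto)
          show "continuous_on (cball \<zeta> (R / 4)) f"
            by (rule continuous_on_subset[OF holomorphic_on_imp_continuous_on[OF f] sub])
          fix u assume "cmod (\<zeta> - u) = R / 4"
          then have "u \<in> S" using sub by (auto simp: dist_norm)
          then have "norm (F (x + u *s v)) \<le> M" using M(2) in_R by blast
          then show "cmod (f u) \<le> M" unfolding f_def by (meson Finite_Cartesian_Product.norm_nth_le order_trans)
        qed (use R(1) in auto)
        then show ?thesis by simp
      qed
      have "cmod (f (of_real t) - f 0) \<le> M / (R / 4) * cmod (of_real t - 0)"
      proof (rule field_differentiable_bound[where S = "cball 0 t"])
        fix z :: complex assume "z \<in> cball 0 t"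
        then have "z \<in> S" using t R by (simp add: S_def)
        then show "(f has_field_derivative deriv f z) (at z within cball 0 t)"
          using holomorphic_derivI[OF f] by (simp add: S_def has_field_derivative_at_within)
      qed (use der t in auto)
      then show ?thesis using t v(2) by (simp add: f_def)
    qed
    have "dist (F x) (F y) = norm (F y - F x)" by (simp add: dist_norm norm_minus_commute)
    also have "\<dots> \<le> (\<Sum>i\<in>UNIV. norm ((F y - F x) $ i))"
      unfolding norm_vec_def by (rule L2_set_le_sum) simp
    also have "\<dots> \<le> (\<Sum>i\<in>(UNIV::'n set). M / (R / 4) * t)" using comp by (intro sum_mono) simp
    also have "\<dots> = (K - 1) * t" by (simp add: K_def)
    also have "\<dots> \<le> K * dist x y" using t(1) by (simp add: t_def dist_norm norm_minus_commute algebra_simps)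
    finally show ?thesis .
  qed simp
  moreover have "ball p (R / 8) \<subseteq> U" using R by auto
  ultimately show ?thesis using that[of "R / 8" K] R(1) K by simp
qed

section \<open>Vertical shifts and Hoelder graphs\<close>

lemma norm_real_part_at_le: "norm (real_part_at k w) \<le> norm w"
  by (rule norm_le_componentwise_cart) (auto simp: real_part_at_def abs_Re_le_cmod)

lemma real_part_at_diff: "real_part_at k w - real_part_at k y = real_part_at k (w - y)"
  by (simp add: real_part_at_def vec_eq_iff)

lemma real_part_at_domain:
  "norm w < r \<Longrightarrow> real_part_at k w \<in> {w. Im (w $ k) = 0 \<and> norm w < r}"
  using norm_real_part_at_le[of k w] by (simp add: real_part_at_def)

lemma real_part_at_add_imaginary: "real_part_at k (w + axis k (\<i> * of_real c)) = real_part_at k w"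
  by (simp add: real_part_at_def vec_eq_iff axis_def)

text \<open>The chart \<open>F\<close> bends affine discs into holomorphic curves, which is why the
  submean inequality for the distance is proved along curves. The translation \<open>c\<close> will
  be the vertical shift.\<close>

lemma shifted_minus_ln_distance_psh:
  fixes F H :: "complex ^ 'n \<Rightarrow> complex ^ 'n"
  assumes \<phi>: "locally_psh_on \<Omega> \<phi>" and exh: "\<And>c. closure {z \<in> \<Omega>. \<phi> z < c} \<subseteq> \<Omega>"
    and H: "holomorphic_map_on (ball 0 r) H"
    and E: "E = {w \<in> ball 0 r. H w \<notin> \<Omega>}" "0 \<in> E"
    and F: "holomorphic_map_on W F" and W: "open W"
    and in_\<Omega>: "\<And>z. z \<in> W \<Longrightarrow> norm (F z + c) < r / 4 \<and> H (F z + c) \<in> \<Omega>"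
  shows "locally_psh_on W (\<lambda>z. - ln (infdist (F z + c) E))"
proof (rule locally_psh_onI[OF W])
  have pos: "infdist w E > 0" if "norm w < r / 4" "H w \<in> \<Omega>" for w
  proof -
    have "open (ball 0 r \<inter> H -` \<Omega>)"
      by (intro continuous_open_preimage holomorphic_map_continuous[OF H] locally_psh_on_open[OF \<phi>]) auto
    moreover have "norm w < r" using that(1) norm_ge_zero[of w] by linarith
    then have "w \<in> ball 0 r \<inter> H -` \<Omega>" using that(2) by simp
    ultimately obtain e where e: "e > 0" "ball w e \<subseteq> ball 0 r \<inter> H -` \<Omega>" by (meson openE)
    have "e \<le> infdist w E"
    proof (subst infdist_notempty)
      show "e \<le> (INF y\<in>E. dist w y)"
      proof (rule cINF_greatest)
        fix y assume "y \<in> E"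
        then have "y \<notin> ball w e" using e(2) by (auto simp: E(1))
        then show "e \<le> dist w y" by simp
      qed (use E(2) in blast)
    qed (use E(2) in blast)
    then show ?thesis using e(1) by linarith
  qed
  have cF: "continuous_on W (\<lambda>z. F z + c)"
    by (intro continuous_intros holomorphic_map_continuous[OF F])
  show "continuous_on W (\<lambda>z. - ln (infdist (F z + c) E))"
    by (intro continuous_intros cF) (use pos in_\<Omega> in force)
  fix a b assume "a \<in> W"
  show "\<exists>\<rho>>0. \<forall>s. 0 < s \<longrightarrow> s < \<rho> \<longrightarrow> (\<forall>\<tau>\<in>cball 0 s. a + \<tau> *s b \<in> W) \<longrightarrow>
      - ln (infdist (F a + c) E) \<le> circle_mean (\<lambda>\<tau>. - ln (infdist (F (a + \<tau> *s b) + c) E)) s"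
  proof (intro exI[of _ 1] conjI allI impI)
    fix s :: real assume s: "0 < s" "\<forall>\<tau>\<in>cball 0 s. a + \<tau> *s b \<in> W"
    define S where "S = (\<lambda>\<tau>. a + \<tau> *s b) -` W"
    have S: "open S" unfolding S_def by (rule open_vimage[OF W]) (intro continuous_intros)
    have sub: "cball 0 s \<subseteq> S" using s(2) by (auto simp: S_def)
    have "holomorphic_curve_on S (\<lambda>\<tau>. F (a + \<tau> *s b))"
      by (rule holomorphic_map_compose_curve[OF F _ S])
        (auto simp: S_def holomorphic_curve_on_def intro!: holomorphic_intros)
    then have hol: "holomorphic_curve_on S (\<lambda>\<tau>. F (a + \<tau> *s b) + c)"
      by (auto simp: holomorphic_curve_on_def intro!: holomorphic_intros)
    have "- ln (infdist (F (a + 0 *s b) + c) E)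
        \<le> circle_mean (\<lambda>\<tau>. - ln (infdist (F (a + \<tau> *s b) + c) E)) s"
      by (rule minus_ln_distance_submean[OF \<phi> exh H E S sub s(1) hol]) (use s(2) in_\<Omega> pos in auto)
    then show "- ln (infdist (F a + c) E) \<le> circle_mean (\<lambda>\<tau>. - ln (infdist (F (a + \<tau> *s b) + c) E)) s"
      by simp
  qed auto
qed

text \<open>Inverts the modulus \<open>t + C * t powr \<beta>\<close>: for \<open>t \<le> 1\<close>
  its second summand dominates up to a factor, and for \<open>t > 1\<close> the left-hand side is at
  most 1.\<close>

lemma le_powr_inverse:
  assumes "0 < \<beta>" "\<beta> < 1" "0 \<le> C" "0 < x" "x \<le> 1" "0 \<le> t" "x \<le> t + C * t powr \<beta>"
  shows "(x / (1 + C)) powr (1 / \<beta>) \<le> (t::real)"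
proof (cases "t \<le> 1")
  case True
  have t: "t > 0" using assms by (cases "t = 0") auto
  have "t powr 1 \<le> t powr \<beta>" using True t assms by (intro powr_mono') auto
  then have "x \<le> (1 + C) * t powr \<beta>" using assms(7) t by (simp add: algebra_simps)
  then have "x / (1 + C) \<le> t powr \<beta>" using assms by (simp add: pos_divide_le_eq mult.commute)
  then have "(x / (1 + C)) powr (1 / \<beta>) \<le> (t powr \<beta>) powr (1 / \<beta>)" using assms by (intro powr_mono2) auto
  also have "\<dots> = t" using t assms by (simp add: powr_powr)
  finally show ?thesis .
next
  case False
  have "(x / (1 + C)) powr (1 / \<beta>) \<le> 1 powr (1 / \<beta>)" using assms by (intro powr_mono2) auto
  then show ?thesis using False by simp
qed

text \<open>On the way to a point of \<open>E\<close> the height has to be used up, partly by moving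
  vertically and partly by the descent of the graph. Over a distance \<open>t\<close> these achieve
  at most \<open>t + C * t powr \<beta>\<close>.\<close>

lemma infdist_graph_ge:
  fixes g :: "complex ^ 'n \<Rightarrow> real"
  assumes g: "\<And>x y. x \<in> {w. Im (w $ k) = 0 \<and> norm w < r} \<Longrightarrow> y \<in> {w. Im (w $ k) = 0 \<and> norm w < r} \<Longrightarrow>
      \<bar>g x - g y\<bar> \<le> C * dist x y powr \<beta>"
    and \<beta>: "0 < \<beta>" "\<beta> < 1" and C: "0 \<le> C" and w: "norm w < r"
    and E: "E \<subseteq> {w \<in> ball 0 r. g (real_part_at k w) \<le> Im (w $ k)}" "E \<noteq> {}"
    and h: "0 < g (real_part_at k w) - Im (w $ k)" "g (real_part_at k w) - Im (w $ k) \<le> 1"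
  shows "((g (real_part_at k w) - Im (w $ k)) / (1 + C)) powr (1 / \<beta>) \<le> infdist w E"
proof -
  have "((g (real_part_at k w) - Im (w $ k)) / (1 + C)) powr (1 / \<beta>) \<le> dist w y" if "y \<in> E" for y
  proof (rule le_powr_inverse[OF \<beta> C h zero_le_dist])
    have y: "norm y < r" "g (real_part_at k y) \<le> Im (y $ k)" using that E(1) by auto
    have "dist (real_part_at k w) (real_part_at k y) \<le> dist w y"
      unfolding dist_norm real_part_at_diff by (rule norm_real_part_at_le)
    then have "dist (real_part_at k w) (real_part_at k y) powr \<beta> \<le> dist w y powr \<beta>"
      using \<beta> by (intro powr_mono2) auto
    then have "\<bar>g (real_part_at k w) - g (real_part_at k y)\<bar> \<le> C * dist w y powr \<beta>"
      using g[OF real_part_at_domain[OF w] real_part_at_domain[OF y(1)]] C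
      by (meson mult_left_mono order_trans)
    moreover have "\<bar>Im ((w - y) $ k)\<bar> \<le> dist w y"
      unfolding dist_norm by (meson Finite_Cartesian_Product.norm_nth_le abs_Im_le_cmod order_trans)
    ultimately show "g (real_part_at k w) - Im (w $ k) \<le> dist w y + C * dist w y powr \<beta>"
      using y(2) by (simp add: abs_le_iff)
  qed
  then show ?thesis using E(2) by (subst infdist_notempty) (auto intro!: cINF_greatest)
qed

section \<open>The boundary distance in a chart\<close>

definition log_depth :: "(complex ^ 'n) set \<Rightarrow> complex ^ 'n \<Rightarrow> real" where
  "log_depth \<Omega> z = - ln (infdist z (frontier \<Omega>))"

lemma infdist_frontier_pos:
  assumes "open \<Omega>" "p \<in> frontier \<Omega>" "z \<in> \<Omega>"
  shows "infdist z (frontier \<Omega>) > 0"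
  using assms by (intro infdist_pos_not_in_closed) (auto simp: frontier_def interior_open)

lemma norm_axis_complex [simp]: "norm (axis k x :: complex ^ 'n) = cmod x"
proof -
  have "axis k x = x *s (axis k 1 :: complex ^ 'n)"
    by (simp add: vec_eq_iff axis_def)
  then have "norm (axis k x :: complex ^ 'n) = cmod x * norm (axis k 1 :: complex ^ 'n)"
    by (simp only: norm_vector_scalar_mult)
  then show ?thesis by (simp add: norm_axis_1)
qed

text \<open>Put \<open>\<epsilon> = exp (- l)\<close>. Up to constants, the distance of the shifted
  point to \<open>E\<close> is at most \<open>d + \<epsilon>\<close> and at least its power with
  exponent \<open>1 / \<beta>\<close>. Since \<open>d = exp (- L)\<close>, the sum
  \<open>d + \<epsilon>\<close> is \<open>exp (- min L l)\<close> up to a factor 2. Making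
  \<open>L\<close> large on \<open>V\<close> absorbs all multiplicative constants and leaves
  \<open>A = 2 / \<beta>\<close>.\<close>

lemma local_truncated_depth:
  fixes F :: "complex ^ 'n \<Rightarrow> complex ^ 'n"
  assumes \<phi>: "locally_psh_on \<Omega> \<phi>" and exh: "\<And>c. closure {z \<in> \<Omega>. \<phi> z < c} \<subseteq> \<Omega>"
    and p: "p \<in> frontier \<Omega>" "p \<in> U" and r: "0 < r"
    and F: "biholomorphic_onto U (ball 0 r) F" "F p = 0"
    and \<beta>: "0 < \<beta>" "\<beta> < 1"
    and g: "holder_continuous_on \<beta> {w. Im (w $ k) = 0 \<and> norm w < r} g" "g 0 = 0"
    and graph: "F ` (U \<inter> \<Omega>) = {w \<in> ball 0 r. Im (w $ k) < g (real_part_at k w)}"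
  obtains V A l0 where "open V" "p \<in> V" "1 \<le> A" "0 < l0"
    "\<And>z. z \<in> V \<inter> \<Omega> \<Longrightarrow> l0 \<le> log_depth \<Omega> z"
    "\<And>l. l0 \<le> l \<Longrightarrow> \<exists>f. locally_psh_on (V \<inter> \<Omega>) f \<and>
       (\<forall>z\<in>V \<inter> \<Omega>. min (log_depth \<Omega> z) l / A \<le> f z \<and> f z \<le> A * min (log_depth \<Omega> z) l)"
proof -
  have \<Omega>: "open \<Omega>" by (rule locally_psh_on_open[OF \<phi>])
  have p_notin: "p \<notin> \<Omega>" using p(1) \<Omega> by (auto simp: frontier_def interior_open)
  define H where "H = inv_into U F"
  have bij: "bij_betw F U (ball 0 r)" and U: "open U"
    and holF: "holomorphic_map_on U F" and holH: "holomorphic_map_on (ball 0 r) H"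
    using F(1) by (auto simp: biholomorphic_onto_def H_def)
  have HF: "H (F z) = z" if "z \<in> U" for z
    using bij that by (simp add: H_def bij_betw_inv_into_left)
  have FH: "F (H w) = w" and HU: "H w \<in> U" if "w \<in> ball 0 r" for w
    using bij that by (simp_all add: H_def bij_betw_inv_into_right bij_betw_def inv_into_into)
  have FU: "F z \<in> ball 0 r" if "z \<in> U" for z using bij that by (auto simp: bij_betw_def)
  have in_\<Omega>_iff: "H w \<in> \<Omega> \<longleftrightarrow> Im (w $ k) < g (real_part_at k w)" if w: "w \<in> ball 0 r" for w
  proof
    assume "H w \<in> \<Omega>"
    then have "F (H w) \<in> F ` (U \<inter> \<Omega>)" using HU[OF w] by blast
    then show "Im (w $ k) < g (real_part_at k w)" unfolding graph FH[OF w] by simp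
  next
    assume "Im (w $ k) < g (real_part_at k w)"
    then have "w \<in> F ` (U \<inter> \<Omega>)" unfolding graph using w by simp
    then show "H w \<in> \<Omega>" using HF by auto
  qed
  define E where "E = {w \<in> ball 0 r. H w \<notin> \<Omega>}"
  have E0: "0 \<in> E" using HF[OF p(2)] F(2) p_notin r by (simp add: E_def)
  have E_graph: "E \<subseteq> {w \<in> ball 0 r. g (real_part_at k w) \<le> Im (w $ k)}"
    using in_\<Omega>_iff by (auto simp: E_def not_less)
  obtain r1 K1 where r1: "0 < r1" "1 \<le> K1" "ball p r1 \<subseteq> U"
    "\<And>x y. x \<in> ball p r1 \<Longrightarrow> y \<in> ball p r1 \<Longrightarrow> dist (F x) (F y) \<le> K1 * dist x y"
    using holomorphic_map_lipschitz[OF holF U p(2)] by metis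
  have "0 \<in> ball (0::complex^'n) r" using r by simp
  then obtain r2 K2 where r2: "0 < r2" "1 \<le> K2" "ball 0 r2 \<subseteq> ball (0::complex^'n) r"
    "\<And>x y. x \<in> ball 0 r2 \<Longrightarrow> y \<in> ball 0 r2 \<Longrightarrow> dist (H x) (H y) \<le> K2 * dist x y"
    using holomorphic_map_lipschitz[OF holH open_ball] by metis
  define K where "K = max K1 K2"
  have K: "1 \<le> K" using r1(2) by (simp add: K_def)
  have lipF: "dist (F x) (F y) \<le> K * dist x y" if "x \<in> ball p r1" "y \<in> ball p r1" for x y
    using r1(4)[OF that] mult_right_mono[of K1 K "dist x y"] by (simp add: K_def)
  have lipH: "dist (H x) (H y) \<le> K * dist x y" if "x \<in> ball 0 r2" "y \<in> ball 0 r2" for x y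
    using r2(4)[OF that] mult_right_mono[of K2 K "dist x y"] by (simp add: K_def)
  obtain C0 where C0: "\<And>x y. x \<in> {w. Im (w $ k) = 0 \<and> norm w < r} \<Longrightarrow> y \<in> {w. Im (w $ k) = 0 \<and> norm w < r} \<Longrightarrow>
      \<bar>g x - g y\<bar> \<le> C0 * dist x y powr \<beta>"
    using g(1) unfolding holder_continuous_on_def by meson
  define C where "C = max C0 0"
  have C: "0 \<le> C" by (simp add: C_def)
  have holder: "\<bar>g x - g y\<bar> \<le> C * dist x y powr \<beta>"
    if "x \<in> {w. Im (w $ k) = 0 \<and> norm w < r}" "y \<in> {w. Im (w $ k) = 0 \<and> norm w < r}" for x y
    using C0[OF that] mult_right_mono[of C0 C "dist x y powr \<beta>"] by (simp add: C_def)
  \<comment> \<open>Points of norm below \<open>t1\<close> have height at most \<open>m\<close>, by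
    Hoelder continuity and \<open>g 0 = 0\<close>; then \<open>t1 + m < r2\<close> leaves room in
    \<open>ball 0 r2\<close> for the graph point above them.\<close>
  define m where "m = min (r2 / 4) (1 / 4)"
  define t1 where "t1 = min (min (r / 16) (r2 / 4)) (min 1 ((m / (C + 1)) powr (1 / \<beta>)))"
  have m: "0 < m" "m \<le> r2 / 4" "m \<le> 1 / 4" using r2(1) by (auto simp: m_def)
  have t1: "0 < t1" "t1 \<le> r / 16" "t1 \<le> r2 / 4" "t1 \<le> 1" "t1 \<le> (m / (C + 1)) powr (1 / \<beta>)"
    using r r2(1) m C by (auto simp: t1_def)
  have height_le: "g (real_part_at k w) - Im (w $ k) \<le> m" if w: "norm w < t1" for w
  proof -
    have w_r: "norm w < r" using w t1(2) r by linarith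
    have "real_part_at k 0 = 0" by (simp add: real_part_at_def vec_eq_iff)
    then have "\<bar>g (real_part_at k w) - g 0\<bar> \<le> C * dist (real_part_at k w) 0 powr \<beta>"
      using holder[OF real_part_at_domain[OF w_r], of 0] r by simp
    also have "\<dots> \<le> C * t1 powr \<beta>"
      using norm_real_part_at_le[of k w] w C \<beta> by (intro mult_left_mono powr_mono2) auto
    finally have 1: "g (real_part_at k w) \<le> C * t1 powr \<beta>" using g(2) by simp
    have "\<bar>Im (w $ k)\<bar> \<le> norm w"
      by (meson Finite_Cartesian_Product.norm_nth_le abs_Im_le_cmod order_trans)
    moreover have "t1 powr 1 \<le> t1 powr \<beta>" using t1 \<beta> by (intro powr_mono') auto
    ultimately have 2: "- Im (w $ k) \<le> t1 powr \<beta>" using w t1(1) by simp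
    have "t1 powr \<beta> \<le> ((m / (C + 1)) powr (1 / \<beta>)) powr \<beta>" using t1 \<beta> by (intro powr_mono2) auto
    also have "\<dots> = m / (C + 1)" using m C \<beta> by (simp add: powr_powr)
    finally have "(C + 1) * t1 powr \<beta> \<le> m" using C by (simp add: pos_le_divide_eq mult.commute)
    then show ?thesis using 1 2 by (simp add: algebra_simps)
  qed
  \<comment> \<open>With \<open>M = min L l \<ge> l0\<close>, the entries make \<open>M\<close> at
    least 1, make the shift small against the chart, absorb \<open>K + 1\<close> in the lower bound
    \<open>M / 2\<close>, and absorb \<open>(1 + C) * K\<close> in the upper bound
    \<open>2 * M\<close>.\<close>
  define l0 where "l0 = Max {1, - ln (min (r / 16) (1 / 4)), 2 * ln (K + 1), ln (1 + C) + ln K}"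
  have l0: "1 \<le> l0" "- ln (min (r / 16) (1 / 4)) \<le> l0" "2 * ln (K + 1) \<le> l0" "ln (1 + C) + ln K \<le> l0"
    unfolding l0_def by (simp_all only: Max_ge finite_insert finite.emptyI insert_iff simp_thms)
  \<comment> \<open>\<open>r1 / 2\<close> keeps the nearest boundary point in
    \<open>ball p r1\<close>, \<open>t1 / K\<close> bounds \<open>norm (F z)\<close>, and
    \<open>exp (- l0)\<close> forces the depth to be at least \<open>l0\<close> on all of
    \<open>V\<close>.\<close>
  define d0 where "d0 = min (r1 / 2) (min (t1 / K) (exp (- l0)))"
  have d0: "0 < d0" "d0 \<le> r1 / 2" "d0 \<le> t1 / K" "d0 \<le> exp (- l0)"
    using r1(1) t1(1) K unfolding d0_def by (simp, linarith, linarith, linarith)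
  define V where "V = ball p d0"
  have V_U: "z \<in> ball p r1" "z \<in> U" if "z \<in> V" for z using that d0 r1 by (auto simp: V_def)
  have F_small: "norm (F z) < t1" if "z \<in> V" for z
  proof -
    have "norm (F z) = dist (F z) (F p)" using F(2) by simp
    also have "\<dots> \<le> K * dist z p" using V_U[OF that] r1(1) by (intro lipF) auto
    also have "\<dots> < K * d0" using that K by (intro mult_strict_left_mono) (auto simp: V_def dist_commute)
    also have "\<dots> \<le> t1" using d0(3) K by (simp add: pos_le_divide_eq mult.commute)
    finally show ?thesis .
  qed
  define d where "d = (\<lambda>z. infdist z (frontier \<Omega>))"
  have d_pos: "d z > 0" if "z \<in> \<Omega>" for z
    unfolding d_def by (rule infdist_frontier_pos[OF \<Omega> p(1) that])
  have d_small: "d z < d0" if "z \<in> V" for z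
    using infdist_le[OF p(1), of z] that by (simp add: V_def d_def dist_commute)
  have depth: "l0 \<le> log_depth \<Omega> z" if "z \<in> V \<inter> \<Omega>" for z
  proof -
    have "ln (d z) \<le> ln (exp (- l0))"
      using d_small[of z] d_pos[of z] that d0(4) by (subst ln_le_cancel_iff) auto
    then show ?thesis by (simp add: log_depth_def d_def)
  qed
  have F_graph: "0 < g (real_part_at k (F z)) - Im (F z $ k)" if "z \<in> V \<inter> \<Omega>" for z
    using that V_U[of z] in_\<Omega>_iff[OF FU, of z] HF[of z] by simp
  have dist_E: "infdist (F z) E \<le> K * d z" if z: "z \<in> V \<inter> \<Omega>" for z
  proof -
    obtain q where q: "q \<in> frontier \<Omega>" "d z = dist z q"
      using infdist_attains_inf[OF frontier_closed, of \<Omega> z] p(1) unfolding d_def by blast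
    have "dist p q < r1" using dist_triangle[of p q z] q(2) d_small[of z] z d0(2) by (simp add: V_def)
    then have q1: "q \<in> ball p r1" by simp
    then have "q \<in> U" using r1(3) by blast
    then have "F q \<in> E" using FU[of q] HF[of q] q(1) \<Omega> by (auto simp: E_def frontier_def interior_open)
    then have "infdist (F z) E \<le> dist (F z) (F q)" by (rule infdist_le)
    also have "\<dots> \<le> K * dist z q" using V_U[of z] z q1 by (intro lipF) auto
    finally show ?thesis by (simp add: q(2))
  qed
  have d_le_height: "d z \<le> K * (g (real_part_at k (F z)) - Im (F z $ k))" if z: "z \<in> V \<inter> \<Omega>" for z
  proof -
    define h where "h = g (real_part_at k (F z)) - Im (F z $ k)"
    have h: "0 < h" "h \<le> m" using F_graph[OF z] height_le[OF F_small, of z] z by (auto simp: h_def)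
    \<comment> \<open>The point of the graph straight above \<open>F z\<close>: its preimage
      \<open>H y\<close> lies outside the domain, at distance at most \<open>K * h\<close> from
      \<open>z\<close>.\<close>
    define y where "y = F z + axis k (\<i> * of_real h)"
    have small: "norm (F z) < t1" using F_small z by simp
    have "norm y \<le> norm (F z) + h"
      unfolding y_def using norm_triangle_ineq[of "F z" "axis k (\<i> * of_real h)"] h(1) by (simp add: norm_mult)
    then have y: "y \<in> ball 0 r2" using small h(2) m(2) t1(3) r2(1) by simp
    have Fz: "F z \<in> ball 0 r2" using small t1(3) r2(1) by simp
    have "g (real_part_at k y) = Im (y $ k)"
      unfolding y_def real_part_at_add_imaginary by (simp add: h_def axis_def)
    then have "H y \<notin> \<Omega>" using in_\<Omega>_iff[of y] y r2(3) by auto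
    then have "d z \<le> dist z (H y)" unfolding d_def using z by (intro infdist_frontier_le) auto
    also have "\<dots> = dist (H (F z)) (H y)" using HF[of z] V_U[of z] z by simp
    also have "\<dots> \<le> K * dist (F z) y" by (rule lipH[OF Fz y])
    also have "dist (F z) y = h" using h(1) by (simp add: y_def dist_norm norm_mult)
    finally show ?thesis by (simp add: h_def)
  qed
  have main: "\<exists>f. locally_psh_on (V \<inter> \<Omega>) f \<and>
       (\<forall>z\<in>V \<inter> \<Omega>. min (log_depth \<Omega> z) l / (2 / \<beta>) \<le> f z \<and> f z \<le> 2 / \<beta> * min (log_depth \<Omega> z) l)"
    if l: "l0 \<le> l" for l
  proof -
    define \<epsilon> where "\<epsilon> = exp (- l)"
    have "exp (- l) \<le> exp (ln (min (r / 16) (1 / 4)))" using l l0(2) by simp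
    also have "\<dots> = min (r / 16) (1 / 4)" using r by simp
    finally have \<epsilon>: "0 < \<epsilon>" "\<epsilon> \<le> r / 16" "\<epsilon> \<le> 1 / 4" by (auto simp: \<epsilon>_def)
    \<comment> \<open>Downwards, since the domain lies below the graph: all heights grow by
      \<open>\<epsilon>\<close>, and the distance to \<open>E\<close> stays above a positive
      constant up to the boundary.\<close>
    define c where "c = axis k (\<i> * of_real (- \<epsilon>))"
    have c: "norm c = \<epsilon>" using \<epsilon>(1) by (simp add: c_def norm_mult)
    define W where "W = (\<lambda>z. F z + c)"
    have W_norm: "norm (W z) < r / 8" if "z \<in> V" for z
      using norm_triangle_ineq[of "F z" c] F_small[OF that] c \<epsilon> t1(2) by (simp add: W_def)
    have W_height: "g (real_part_at k (W z)) - Im (W z $ k) = g (real_part_at k (F z)) - Im (F z $ k) + \<epsilon>" for z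
      unfolding W_def c_def real_part_at_add_imaginary by (simp add: axis_def)
    have W_\<Omega>: "norm (W z) < r / 4 \<and> H (W z) \<in> \<Omega>" if z: "z \<in> V \<inter> \<Omega>" for z
      using W_norm[of z] F_graph[OF z] W_height[of z] in_\<Omega>_iff[of "W z"] z r \<epsilon>(1) by auto
    have psh: "locally_psh_on (V \<inter> \<Omega>) (\<lambda>z. - ln (infdist (F z + c) E))"
    proof (rule shifted_minus_ln_distance_psh[OF \<phi> exh holH E_def E0])
      show "holomorphic_map_on (V \<inter> \<Omega>) F" using holF V_U(2) unfolding holomorphic_map_on_def by blast
      show "open (V \<inter> \<Omega>)" using \<Omega> by (auto simp: V_def)
    qed (use W_\<Omega> in \<open>simp add: W_def\<close>)
    have bounds: "min (log_depth \<Omega> z) l / (2 / \<beta>) \<le> - ln (infdist (W z) E) \<and>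
        - ln (infdist (W z) E) \<le> 2 / \<beta> * min (log_depth \<Omega> z) l" if z: "z \<in> V \<inter> \<Omega>" for z
    proof -
      define h where "h = g (real_part_at k (F z)) - Im (F z $ k)"
      define M where "M = min (log_depth \<Omega> z) l"
      have M: "l0 \<le> M" using depth[OF z] l by (simp add: M_def)
      have h: "0 < h" "h \<le> 1 / 4" using F_graph[OF z] height_le[OF F_small, of z] z m(3) by (auto simp: h_def)
      have dz: "d z > 0" using d_pos z by simp
      have d_exp: "d z = exp (- log_depth \<Omega> z)" using dz by (simp add: log_depth_def d_def)
      have "((h + \<epsilon>) / (1 + C)) powr (1 / \<beta>) \<le> infdist (W z) E"
        using infdist_graph_ge[OF holder \<beta> C _ E_graph, of "W z"] W_norm[of z] z r E0 h \<epsilon> W_height[of z]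
        by (auto simp: h_def)
      then have low: "((h + \<epsilon>) / (1 + C)) powr (1 / \<beta>) \<le> infdist (W z) E" .
      have pw: "0 < ((h + \<epsilon>) / (1 + C)) powr (1 / \<beta>)" using h \<epsilon> C by simp
      have D: "0 < infdist (W z) E" using low pw by linarith
      have "- ln (infdist (W z) E) \<le> - ln (((h + \<epsilon>) / (1 + C)) powr (1 / \<beta>))"
        using low pw D by (subst neg_le_iff_le, subst ln_le_cancel_iff)
      also have "\<dots> = (ln (1 + C) - ln (h + \<epsilon>)) / \<beta>"
        using h \<epsilon> C by (simp add: ln_powr ln_divide_pos minus_divide_left)
      also have "\<dots> \<le> (2 * M) / \<beta>"
      proof -
        have "exp (- M) / K \<le> h + \<epsilon>"
        proof (cases "log_depth \<Omega> z \<le> l")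
          case True
          then have "exp (- M) / K = d z / K" by (simp add: M_def d_exp)
          also have "\<dots> \<le> h" using d_le_height[OF z] K by (simp add: h_def pos_divide_le_eq mult.commute)
          finally show ?thesis using \<epsilon>(1) by simp
        next
          case False
          then have "exp (- M) = \<epsilon>" by (simp add: M_def \<epsilon>_def)
          moreover have "\<epsilon> / K \<le> \<epsilon> / 1" using K \<epsilon>(1) by (intro divide_left_mono) auto
          ultimately show ?thesis using h(1) by simp
        qed
        then have "ln (exp (- M) / K) \<le> ln (h + \<epsilon>)" using K h(1) \<epsilon>(1) by (subst ln_le_cancel_iff) auto
        then have "- ln (h + \<epsilon>) \<le> M + ln K" using K by (simp add: ln_divide_pos)
        then have "ln (1 + C) - ln (h + \<epsilon>) \<le> 2 * M" using M l0(4) by linarith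
        then show ?thesis using \<beta>(1) by (intro divide_right_mono) auto
      qed
      finally have up: "- ln (infdist (W z) E) \<le> 2 / \<beta> * M" by simp
      have "infdist (W z) E \<le> infdist (F z) E + dist (W z) (F z)" by (rule infdist_triangle)
      also have "dist (W z) (F z) = \<epsilon>" using c by (simp add: W_def dist_norm)
      also have "infdist (F z) E \<le> K * d z" by (rule dist_E[OF z])
      finally have "infdist (W z) E \<le> K * d z + \<epsilon>" by simp
      moreover have "d z \<le> exp (- M)" "\<epsilon> \<le> exp (- M)" by (simp_all add: d_exp \<epsilon>_def M_def)
      ultimately have "infdist (W z) E \<le> K * exp (- M) + exp (- M)"
        using mult_left_mono[of "d z" "exp (- M)" K] K by linarith
      then have "infdist (W z) E \<le> (K + 1) * exp (- M)" by (simp add: algebra_simps)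
      then have "ln (infdist (W z) E) \<le> ln ((K + 1) * exp (- M))" using D K by (subst ln_le_cancel_iff) auto
      also have "\<dots> = ln (K + 1) - M" using K by (simp add: ln_mult_pos)
      finally have "M / 2 \<le> - ln (infdist (W z) E)" using M l0(3) by linarith
      moreover have "M / (2 / \<beta>) \<le> M / 2"
        using \<beta> M l0(1) mult_right_mono[of \<beta> 1 M] by simp
      ultimately have "M / (2 / \<beta>) \<le> - ln (infdist (W z) E)" by linarith
      then show ?thesis using up unfolding M_def by blast
    qed
    show ?thesis using psh bounds by (intro exI[of _ "\<lambda>z. - ln (infdist (F z + c) E)"]) (simp add: W_def)
  qed
  show ?thesis
  proof (rule that[of V "2 / \<beta>" l0])
    show "open V" "p \<in> V" using d0(1) by (auto simp: V_def)
    show "1 \<le> 2 / \<beta>" "0 < l0" using \<beta> l0(1) by auto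
  qed (use depth main in auto)
qed

section \<open>Iteration over the scales\<close>

text \<open>One step of the iteration, with the same constants at every scale. The bound by
  \<open>- 1\<close> on the collar \<open>l < L z < 2 * l\<close> permits pasting with a function
  that is at least \<open>- 1\<close>, the bound by \<open>- q\<close> beyond \<open>M * l\<close>
  is the gain, and \<open>- s\<close> keeps the result negative.\<close>

definition has_stages :: "(complex ^ 'n) set \<Rightarrow> (complex ^ 'n \<Rightarrow> real) \<Rightarrow> real \<Rightarrow> real \<Rightarrow> real \<Rightarrow> real \<Rightarrow> bool" where
  "has_stages W L q s M l0 \<longleftrightarrow> (\<forall>l\<ge>l0. \<exists>v. locally_psh_on {z \<in> W. l < L z} v \<and>
     (\<forall>z\<in>W. l < L z \<longrightarrow> v z \<le> - s \<and> (L z < 2 * l \<longrightarrow> v z \<le> - 1) \<and> (M * l \<le> L z \<longrightarrow> - q \<le> v z)))"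

text \<open>The second and third clauses pin \<open>- \<psi> k\<close> to the order
  \<open>q ^ j\<close> on the \<open>j\<close>-th scale, with constants independent of
  \<open>k\<close>. By the last one the sequence is eventually constant on sublevel sets of
  \<open>L\<close>, so its limit is locally one of its members.\<close>

definition barrier_sequence ::
    "(complex ^ 'n) set \<Rightarrow> (complex ^ 'n \<Rightarrow> real) \<Rightarrow> real \<Rightarrow> real \<Rightarrow> real \<Rightarrow> real \<Rightarrow> (nat \<Rightarrow> complex ^ 'n \<Rightarrow> real) \<Rightarrow> bool" where
  "barrier_sequence W L q s M l0 \<psi> \<longleftrightarrow> (\<forall>k. locally_psh_on W (\<psi> k)) \<and>
     (\<forall>k j. \<forall>z\<in>W. j \<le> k \<longrightarrow> j = 0 \<or> M ^ j * l0 \<le> L z \<longrightarrow> - (q ^ j) \<le> \<psi> k z) \<and>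
     (\<forall>k j. \<forall>z\<in>W. L z \<le> M ^ j * l0 \<longrightarrow> \<psi> k z \<le> - (s * q ^ j)) \<and>
     (\<forall>k. \<forall>z\<in>W. \<psi> k z \<le> - (s * q ^ k)) \<and>
     (\<forall>k j. \<forall>z\<in>W. L z \<le> M ^ k * l0 \<longrightarrow> k \<le> j \<longrightarrow> \<psi> j z = \<psi> k z)"

text \<open>\<open>\<psi> (Suc k)\<close> is the maximum of \<open>\<psi> k\<close> and
  \<open>q ^ k * v k\<close>. Beyond the \<open>k\<close>-th scale \<open>\<psi> k\<close> is at
  least \<open>- (q ^ k)\<close>, so the rescaled \<open>v k\<close> loses on its collar and the
  pasting is seamless; beyond the next scale it improves the bound by the factor
  \<open>q\<close>.\<close>

lemma barrier_iteration:
  fixes L :: "complex ^ 'n \<Rightarrow> real"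
  assumes W: "open W" and L: "continuous_on W L"
    and q: "0 < q" "q < 1" and s: "0 < s" "s \<le> 1" and M: "2 \<le> M" and l0: "0 < l0"
    and stages: "has_stages W L q s M l0"
  shows "\<exists>\<psi>. barrier_sequence W L q s M l0 \<psi>"
proof -
  have l0_le: "l0 \<le> M ^ k * l0" for k
    using M l0 mult_right_mono[of 1 "M ^ k" l0] by simp
  have "\<forall>k. \<exists>v. locally_psh_on {z \<in> W. M ^ k * l0 < L z} v \<and>
     (\<forall>z\<in>W. M ^ k * l0 < L z \<longrightarrow> v z \<le> - s \<and> (L z < 2 * (M ^ k * l0) \<longrightarrow> v z \<le> - 1) \<and>
        (M * (M ^ k * l0) \<le> L z \<longrightarrow> - q \<le> v z))"
    using stages l0_le unfolding has_stages_def by blast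
  from choice[OF this] obtain v where "\<forall>k. locally_psh_on {z \<in> W. M ^ k * l0 < L z} (v k) \<and>
     (\<forall>z\<in>W. M ^ k * l0 < L z \<longrightarrow> v k z \<le> - s \<and> (L z < 2 * (M ^ k * l0) \<longrightarrow> v k z \<le> - 1) \<and>
        (M * (M ^ k * l0) \<le> L z \<longrightarrow> - q \<le> v k z))" ..
  then have v: "\<And>k. locally_psh_on {z \<in> W. M ^ k * l0 < L z} (v k)"
    "\<And>k z. z \<in> W \<Longrightarrow> M ^ k * l0 < L z \<Longrightarrow> v k z \<le> - s"
    "\<And>k z. z \<in> W \<Longrightarrow> M ^ k * l0 < L z \<Longrightarrow> L z < 2 * (M ^ k * l0) \<Longrightarrow> v k z \<le> - 1"
    "\<And>k z. z \<in> W \<Longrightarrow> M ^ k * l0 < L z \<Longrightarrow> M * (M ^ k * l0) \<le> L z \<Longrightarrow> - q \<le> v k z"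
    by simp_all
  define \<psi> :: "nat \<Rightarrow> complex ^ 'n \<Rightarrow> real" where
    "\<psi> = rec_nat (\<lambda>z. - 1) (\<lambda>k u z. if z \<in> {z \<in> W. M ^ k * l0 < L z} then max (u z) (q ^ k * v k z) else u z)"
  have \<psi>_0: "\<psi> 0 = (\<lambda>z. - 1)" by (simp add: \<psi>_def)
  have \<psi>_Suc: "\<psi> (Suc k) = (\<lambda>z. if z \<in> {z \<in> W. M ^ k * l0 < L z} then max (\<psi> k z) (q ^ k * v k z) else \<psi> k z)" for k
    unfolding \<psi>_def by (rule trans[OF nat.rec(2)]) (rule refl)
  have lower: "- (q ^ j) \<le> \<psi> k z" if "z \<in> W" "j \<le> k" "j = 0 \<or> M ^ j * l0 \<le> L z" for k j z
    using that
  proof (induction k)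
    case (Suc k)
    show ?case
    proof (cases "j = Suc k")
      case True
      then have *: "M * (M ^ k * l0) \<le> L z" using Suc.prems by (simp add: mult.assoc)
      have "M ^ k * l0 < M * (M ^ k * l0)" using M l0 l0_le[of k] by simp
      then have "M ^ k * l0 < L z" using * by linarith
      then have "- q \<le> v k z" and "z \<in> {z \<in> W. M ^ k * l0 < L z}" using v(4)[OF Suc.prems(1) _ *] Suc.prems(1) by auto
      then have "q ^ k * (- q) \<le> \<psi> (Suc k) z"
        unfolding \<psi>_Suc using mult_left_mono[of "- q" "v k z" "q ^ k"] q by (simp add: le_max_iff_disj)
      then show ?thesis using True by (simp add: mult.commute)
    next
      case False
      then have "- (q ^ j) \<le> \<psi> k z" using Suc by simp
      then show ?thesis unfolding \<psi>_Suc by (simp add: le_max_iff_disj)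
    qed
  qed (auto simp: \<psi>_0)
  have psh: "locally_psh_on W (\<psi> k)" for k
  proof (induction k)
    case 0
    show ?case unfolding \<psi>_0 by (rule locally_psh_on_const[OF W])
  next
    case (Suc k)
    show ?case unfolding \<psi>_Suc
    proof (rule locally_psh_on_glue[OF Suc])
      show "locally_psh_on {z \<in> W. M ^ k * l0 < L z} (\<lambda>z. q ^ k * v k z)"
        using v(1) q by (intro locally_psh_on_cmult) auto
      fix x assume x: "x \<in> W - {z \<in> W. M ^ k * l0 < L z}"
      define N where "N = W \<inter> L -` {..<2 * (M ^ k * l0)}"
      have "open N" unfolding N_def by (intro continuous_open_preimage L W) auto
      moreover have "0 < M ^ k * l0" using l0_le[of k] l0 by linarith
      then have "x \<in> N" using x by (auto simp: N_def not_less)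
      moreover have "q ^ k * v k y \<le> \<psi> k y" if "y \<in> N \<inter> {z \<in> W. M ^ k * l0 < L z}" for y
      proof -
        have "v k y \<le> - 1" using that by (intro v(3)) (auto simp: N_def)
        then have "q ^ k * v k y \<le> - (q ^ k)" using mult_left_mono[of "v k y" "- 1" "q ^ k"] q by simp
        also have "\<dots> \<le> \<psi> k y" using that by (intro lower) auto
        finally show ?thesis .
      qed
      ultimately show "\<exists>N. open N \<and> x \<in> N \<and> (\<forall>y\<in>N \<inter> {z \<in> W. M ^ k * l0 < L z}. q ^ k * v k y \<le> \<psi> k y)"
        by blast
    qed auto
  qed
  have stage_le: "q ^ k * v k z \<le> - (s * q ^ j)" if "z \<in> W" "M ^ k * l0 < L z" "k \<le> j" for k j z
  proof -
    have "q ^ k * v k z \<le> q ^ k * (- s)" using v(2)[OF that(1,2)] q by (intro mult_left_mono) auto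
    also have "\<dots> \<le> - (s * q ^ j)"
      using power_decreasing[OF that(3), of q] q s by simp
    finally show ?thesis .
  qed
  have s_le: "- 1 \<le> - (s * q ^ j)" "- 1 \<le> - s" for j
    using s q power_le_one[of q j] mult_mono[of s 1 "q ^ j" 1] by auto
  \<comment> \<open>Where \<open>L z \<le> M ^ j * l0\<close>, only stages with index at most
    \<open>j\<close> can have taken part, and each is at most \<open>- (s * q ^ j)\<close>.\<close>
  have upper: "\<psi> k z \<le> - (s * q ^ j)" if "z \<in> W" "L z \<le> M ^ j * l0" for k j z
  proof (induction k)
    case 0
    then show ?case using s_le by (simp add: \<psi>_0)
  next
    case (Suc k)
    show ?case
    proof (cases "M ^ k * l0 < L z")
      case True
      then have "M ^ k < M ^ j" using that(2) l0 by (meson less_le_trans mult_less_cancel_right_pos)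
      then have "k \<le> j" using M by (simp add: power_strict_increasing_iff)
      then show ?thesis using Suc stage_le[OF that(1) True] by (simp add: \<psi>_Suc)
    qed (simp add: \<psi>_Suc Suc)
  qed
  have upper': "\<psi> k z \<le> - (s * q ^ k)" if "z \<in> W" for k z
  proof (induction k)
    case 0
    then show ?case using s_le by (simp add: \<psi>_0)
  next
    case (Suc k)
    have "- (s * q ^ k) \<le> - (s * q ^ Suc k)" using power_decreasing[of k "Suc k" q] q s by simp
    then show ?case using Suc stage_le[OF that, of k "Suc k"] by (simp add: \<psi>_Suc)
  qed
  have stable: "\<psi> j z = \<psi> k z" if "z \<in> W" "L z \<le> M ^ k * l0" "k \<le> j" for k j z
    using that(3)
  proof (induction j rule: dec_induct)
    case (step j)
    have "M ^ k * l0 \<le> M ^ j * l0" using step.hyps M l0 by (intro mult_right_mono power_increasing) auto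
    then show ?case using step.IH that by (simp add: \<psi>_Suc)
  qed simp
  have "barrier_sequence W L q s M l0 \<psi>"
    unfolding barrier_sequence_def using psh lower upper upper' stable by (intro conjI allI ballI impI)
  then show ?thesis by (rule exI[of _ \<psi>])
qed

definition level :: "real \<Rightarrow> real \<Rightarrow> nat \<Rightarrow> real \<Rightarrow> nat" where
  "level M l K x = Max {j. j \<le> K \<and> (j = 0 \<or> M ^ j * l \<le> x)}"

lemma level_props:
  shows "level M l K x \<le> K" "level M l K x = 0 \<or> M ^ level M l K x * l \<le> x"
    and "j \<le> K \<Longrightarrow> M ^ j * l \<le> x \<Longrightarrow> j \<le> level M l K x"
proof -
  have fin: "finite {j. j \<le> K \<and> (j = 0 \<or> M ^ j * l \<le> x)}" by simp
  have "level M l K x \<in> {j. j \<le> K \<and> (j = 0 \<or> M ^ j * l \<le> x)}"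
    unfolding level_def by (rule Max_in[OF fin]) blast
  then show "level M l K x \<le> K" "level M l K x = 0 \<or> M ^ level M l K x * l \<le> x" by auto
  show "j \<le> K \<Longrightarrow> M ^ j * l \<le> x \<Longrightarrow> j \<le> level M l K x"
    unfolding level_def by (rule Max_ge[OF fin]) simp
qed

text \<open>\<open>A\<close> is the same for all caps \<open>l\<close>; this uniformity gives every
  scale the same gain.\<close>

definition has_truncations :: "(complex ^ 'n) set \<Rightarrow> (complex ^ 'n \<Rightarrow> real) \<Rightarrow> real \<Rightarrow> real \<Rightarrow> bool" where
  "has_truncations W L A l0 \<longleftrightarrow> (\<forall>l\<ge>l0. \<exists>f. locally_psh_on W f \<and>
     (\<forall>z\<in>W. min (L z) l / A \<le> f z \<and> f z \<le> A * min (L z) l))"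

lemma has_truncations_mono:
  assumes t: "has_truncations W L A l0" and W: "open W'" "W' \<subseteq> W" and A: "1 \<le> A" "A \<le> A'" and l: "0 < l0" "l0 \<le> l1"
    and pos: "\<And>z. z \<in> W \<Longrightarrow> 0 \<le> L z"
  shows "has_truncations W' L A' l1"
  unfolding has_truncations_def
proof (intro allI impI)
  fix l assume l1: "l1 \<le> l"
  then obtain f where f: "locally_psh_on W f" "\<And>z. z \<in> W \<Longrightarrow> min (L z) l / A \<le> f z \<and> f z \<le> A * min (L z) l"
    using t l unfolding has_truncations_def by (meson order_trans)
  have "min (L z) l / A' \<le> f z \<and> f z \<le> A' * min (L z) l" if "z \<in> W'" for z
  proof -
    have z: "z \<in> W" using that W(2) by blast
    have m: "0 \<le> min (L z) l" using pos[OF z] l l1 by simp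
    have "min (L z) l / A' \<le> min (L z) l / A" using m A by (intro divide_left_mono) auto
    moreover have "A * min (L z) l \<le> A' * min (L z) l" using m A by (intro mult_right_mono) auto
    ultimately show ?thesis using f(2)[OF z] by linarith
  qed
  then show "\<exists>f. locally_psh_on W' f \<and> (\<forall>z\<in>W'. min (L z) l / A' \<le> f z \<and> f z \<le> A' * min (L z) l)"
    using locally_psh_on_subset[OF f(1) W] by blast
qed

text \<open>Cap at \<open>M * l\<close> and divide by \<open>A * M * l\<close>. The result is at
  most 1, at most \<open>2 / M\<close> on the collar and at least \<open>1 / A\<^sup>2\<close>
  beyond \<open>M * l\<close>. With \<open>M = 8 * A\<^sup>2\<close> the collar value is a quarter
  of the last one, and subtracting \<open>1 + 2 / M\<close> leaves a gain of three quarters of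
  \<open>1 / A\<^sup>2\<close>.\<close>

lemma truncations_imp_stages:
  fixes L :: "complex ^ 'n \<Rightarrow> real"
  assumes W: "open W" and L: "continuous_on W L" and A: "1 \<le> A" and l0: "0 < l0"
    and t: "has_truncations W L A l0"
  shows "has_stages W L (1 - 3 / (4 * A\<^sup>2)) (1 / (4 * A\<^sup>2)) (8 * A\<^sup>2) l0"
  unfolding has_stages_def
proof (intro allI impI)
  fix l assume l: "l0 \<le> l"
  define M where "M = 8 * A\<^sup>2"
  have A2: "1 \<le> A\<^sup>2" using A by simp
  have M: "8 \<le> M" using A2 by (simp add: M_def)
  have lpos: "0 < l" using l l0 by simp
  have "1 * l \<le> M * l" using M lpos by (intro mult_right_mono) auto
  then have "l0 \<le> M * l" using l by simp
  then obtain f where f: "locally_psh_on W f" "\<And>z. z \<in> W \<Longrightarrow> min (L z) (M * l) / A \<le> f z"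
    "\<And>z. z \<in> W \<Longrightarrow> f z \<le> A * min (L z) (M * l)"
    using t unfolding has_truncations_def by meson
  define c where "c = 1 / (A * (M * l))"
  have c: "0 < c" using A M lpos by (simp add: c_def)
  define v where "v = (\<lambda>z. c * f z + (- 1 - 1 / (4 * A\<^sup>2)))"
  have "open {z \<in> W. l < L z}"
    using continuous_open_preimage[OF L W open_greaterThan[of l]] by (simp add: vimage_def Int_def)
  then have psh: "locally_psh_on {z \<in> W. l < L z} v"
    unfolding v_def using c by (intro locally_psh_on_affine locally_psh_on_subset[OF f(1)]) auto
  have up: "c * f z \<le> min (L z) (M * l) / (M * l)" if "z \<in> W" for z
  proof -
    have "c * f z \<le> c * (A * min (L z) (M * l))" using f(3)[OF that] c by (intro mult_left_mono) auto
    also have "\<dots> = min (L z) (M * l) / (M * l)" using A by (simp add: c_def)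
    finally show ?thesis .
  qed
  show "\<exists>v. locally_psh_on {z \<in> W. l < L z} v \<and>
     (\<forall>z\<in>W. l < L z \<longrightarrow> v z \<le> - (1 / (4 * A\<^sup>2)) \<and> (L z < 2 * l \<longrightarrow> v z \<le> - 1) \<and>
       (8 * A\<^sup>2 * l \<le> L z \<longrightarrow> - (1 - 3 / (4 * A\<^sup>2)) \<le> v z))"
  proof (intro exI[of _ v] conjI ballI impI psh)
    fix z assume z: "z \<in> W" "l < L z"
    have "min (L z) (M * l) / (M * l) \<le> 1" using M lpos by (simp add: divide_le_eq)
    then show "v z \<le> - (1 / (4 * A\<^sup>2))" using up[OF z(1)] unfolding v_def by linarith
    show "v z \<le> - 1" if "L z < 2 * l"
    proof -
      have "min (L z) (M * l) / (M * l) \<le> (2 * l) / (M * l)"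
        using that M lpos by (intro divide_right_mono) auto
      also have "\<dots> = 1 / (4 * A\<^sup>2)" using lpos by (simp add: M_def)
      finally show ?thesis using up[OF z(1)] unfolding v_def by linarith
    qed
    show "- (1 - 3 / (4 * A\<^sup>2)) \<le> v z" if "8 * A\<^sup>2 * l \<le> L z"
    proof -
      have "M * l / A \<le> f z" using f(2)[OF z(1)] that by (simp add: M_def min_absorb2)
      then have "c * (M * l / A) \<le> c * f z" using c by (intro mult_left_mono) auto
      moreover have "c * (M * l / A) = 1 / A\<^sup>2" using M lpos by (simp add: c_def power2_eq_square)
      moreover have "1 / A\<^sup>2 = 4 * (1 / (4 * A\<^sup>2))" "3 / (4 * A\<^sup>2) = 3 * (1 / (4 * A\<^sup>2))" by simp_all
      ultimately show ?thesis unfolding v_def by linarith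
    qed
  qed
qed

text \<open>The logarithm turns the factor between the two bounds on \<open>\<psi> K\<close> into
  the additive gap \<open>- ln q - ln s\<close>, in which \<open>K\<close> does not occur.\<close>

lemma logarithmic_barrier:
  fixes L :: "complex ^ 'n \<Rightarrow> real"
  assumes W: "open W" and L: "continuous_on W L"
    and q: "0 < q" "q < 1" and s: "0 < s" "s \<le> 1" and M: "2 \<le> M" and l: "0 < l"
    and stages: "has_stages W L q s M l"
  shows "\<exists>T. locally_psh_on W T \<and> (\<forall>z\<in>W. - ln q * level M l K (L z) \<le> T z \<and>
     T z \<le> - ln q * level M l K (L z) + (- ln q - ln s))"
proof -
  obtain \<psi> where "barrier_sequence W L q s M l \<psi>"
    using barrier_iteration[OF W L q s M l stages] ..
  then have \<psi>:
    "\<And>k. locally_psh_on W (\<psi> k)"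
    "\<And>k j z. z \<in> W \<Longrightarrow> j \<le> k \<Longrightarrow> j = 0 \<or> M ^ j * l \<le> L z \<Longrightarrow> - (q ^ j) \<le> \<psi> k z"
    "\<And>k j z. z \<in> W \<Longrightarrow> L z \<le> M ^ j * l \<Longrightarrow> \<psi> k z \<le> - (s * q ^ j)"
    "\<And>k z. z \<in> W \<Longrightarrow> \<psi> k z \<le> - (s * q ^ k)"
    unfolding barrier_sequence_def by fast+
  have neg: "\<psi> K z < 0" if "z \<in> W" for z
  proof -
    have "0 < s * q ^ K" using q s by simp
    then show ?thesis using \<psi>(4)[OF that, of K] by linarith
  qed
  have "- ln q * level M l K (L z) \<le> - ln (- \<psi> K z) \<and>
     - ln (- \<psi> K z) \<le> - ln q * level M l K (L z) + (- ln q - ln s)" if z: "z \<in> W" for z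
  proof
    define j where "j = level M l K (L z)"
    have j: "j \<le> K" "j = 0 \<or> M ^ j * l \<le> L z" unfolding j_def by (rule level_props)+
    have "ln (- \<psi> K z) \<le> ln (q ^ j)" using \<psi>(2)[OF z j] neg[OF z] q by (subst ln_le_cancel_iff) auto
    also have "\<dots> = j * ln q" using q by (simp add: ln_realpow)
    finally show "- ln q * level M l K (L z) \<le> - ln (- \<psi> K z)" by (simp add: j_def algebra_simps)
    \<comment> \<open>By maximality of the level, \<open>z\<close> lies below scale
      \<open>Suc j\<close>, so only the power \<open>Suc j\<close> is certain; this is the term
      \<open>- ln q\<close> of the gap. At the cap \<open>j = K\<close> the global bound on
      \<open>\<psi> K\<close> takes over.\<close>
    have "\<psi> K z \<le> - (s * q ^ Suc j)"
    proof (cases "j = K")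
      case True
      have "s * q ^ Suc K \<le> s * q ^ K" using power_decreasing[of K "Suc K" q] q s by simp
      then show ?thesis using \<psi>(4)[OF z, of K] True by simp
    next
      case False
      have "\<not> M ^ Suc j * l \<le> L z"
        using level_props(3)[of "Suc j" K M l "L z"] False j(1) by (auto simp: j_def)
      then show ?thesis by (intro \<psi>(3)[OF z]) simp
    qed
    then have "ln (s * q ^ Suc j) \<le> ln (- \<psi> K z)" using s q neg[OF z] by (subst ln_le_cancel_iff) auto
    also have "ln (s * q ^ Suc j) = ln s + Suc j * ln q"
      using s q by (simp only: ln_mult_pos zero_less_power ln_realpow)
    finally show "- ln (- \<psi> K z) \<le> - ln q * level M l K (L z) + (- ln q - ln s)"
      by (simp add: j_def algebra_simps)
  qed
  then show ?thesis using locally_psh_on_neg_ln[OF \<psi>(1), of K] neg by blast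
qed

section \<open>From local to global\<close>

text \<open>In its ball, each \<open>T p\<close> is the common function \<open>lev\<close> up to
  \<open>C1\<close>. The weights \<open>B * \<theta> p\<close> make a function near the edge of its
  ball lose against one with a nearby centre, and they are bounded by \<open>C2\<close>, which is
  independent of \<open>K\<close>. So \<open>U\<close> is \<open>lev\<close> up to constants, while
  \<open>lev\<close> runs from 0 to \<open>D\<close>.\<close>

lemma glued_stages:
  fixes L :: "complex ^ 'n \<Rightarrow> real"
  assumes \<Omega>: "open \<Omega>" and L: "continuous_on \<Omega> L"
    and R: "\<And>z. z \<in> \<Omega> \<Longrightarrow> norm z \<le> R" "\<And>p. p \<in> P \<Longrightarrow> norm p \<le> R"
    and P: "finite P" and r: "0 < r"
    and q: "0 < q" "q < 1" and s: "0 < s" "s \<le> 1" and M: "2 \<le> M" and l1: "0 < l1"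
    and stages: "\<And>p. p \<in> P \<Longrightarrow> has_stages (ball p (2 * r) \<inter> \<Omega>) L q s M l1"
    and cover: "\<And>z. z \<in> \<Omega> \<Longrightarrow> l1 < L z \<Longrightarrow> \<exists>p\<in>P. dist z p < r"
  shows "\<exists>K s'. 1 \<le> K \<and> 0 < s' \<and> s' \<le> 1 \<and> has_stages \<Omega> L (1 / 2) s' (M ^ K) l1"
proof -
  define \<Lambda> where "\<Lambda> = - ln q"
  define C1 where "C1 = - ln q - ln s"
  define B where "B = C1 / r\<^sup>2"
  define C2 where "C2 = B * (3 * R\<^sup>2)"
  have \<Lambda>: "0 < \<Lambda>" using q by (simp add: \<Lambda>_def)
  have "ln s \<le> 0" using s by simp
  then have C1: "0 < C1" using \<Lambda> by (simp add: C1_def \<Lambda>_def)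
  have B: "0 < B" using C1 r by (simp add: B_def)
  have C2: "0 \<le> C2" using B by (simp add: C2_def)
  \<comment> \<open>The range \<open>D = K * \<Lambda>\<close> of \<open>lev\<close> is at least
    twice the total loss \<open>C1 + 2 * C2 + 1\<close>; this produces the value
    \<open>1 / 2\<close> after division by \<open>D\<close>.\<close>
  obtain K :: nat where "2 * (C1 + 2 * C2 + 1) / \<Lambda> \<le> real K" using real_arch_simple by blast
  then have K: "2 * (C1 + 2 * C2 + 1) \<le> K * \<Lambda>" using \<Lambda> by (simp add: pos_divide_le_eq)
  define D where "D = K * \<Lambda>"
  have D: "2 \<le> D" "2 * (C1 + 2 * C2 + 1) \<le> D" using K C1 C2 by (auto simp: D_def)
  have K1: "1 \<le> K" using D(1) by (cases K) (auto simp: D_def)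
  \<comment> \<open>\<open>|z|\<^sup>2 - |z - p|\<^sup>2\<close> is pluriharmonic, so localising by it costs no positivity.\<close>
  define \<theta> where "\<theta> = (\<lambda>p z. 2 * inner z p - (norm (p::complex^'n))\<^sup>2)"
  have \<theta>: "\<theta> p z = (norm z)\<^sup>2 - (dist z p)\<^sup>2" for p z
    unfolding \<theta>_def dist_norm power2_norm_eq_inner by (simp add: inner_diff_left inner_diff_right inner_commute)
  have \<theta>_bound: "\<bar>B * \<theta> p z\<bar> \<le> C2" if "p \<in> P" "z \<in> \<Omega>" for p z
  proof -
    have "\<bar>inner z p\<bar> \<le> norm z * norm p" by (rule Cauchy_Schwarz_ineq2)
    also have "\<dots> \<le> R * R" using R(1)[OF that(2)] R(2)[OF that(1)] by (intro mult_mono) (auto intro: order_trans[OF norm_ge_zero])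
    finally have 1: "\<bar>inner z p\<bar> \<le> R\<^sup>2" by (simp add: power2_eq_square)
    have 2: "(norm p)\<^sup>2 \<le> R\<^sup>2" using R(2)[OF that(1)] by (intro power_mono) auto
    have "0 \<le> (norm p)\<^sup>2" by simp
    then have "\<bar>\<theta> p z\<bar> \<le> 3 * R\<^sup>2" unfolding \<theta>_def using 1 2 by linarith
    then show ?thesis using B unfolding C2_def abs_mult by (intro mult_mono) auto
  qed
  have "has_stages \<Omega> L (1 / 2) (1 / D) (M ^ K) l1"
    unfolding has_stages_def
  proof (intro allI impI)
    fix l assume l: "l1 \<le> l"
    define lev where "lev = (\<lambda>z. \<Lambda> * level M l K (L z))"
    have "\<forall>p\<in>P. \<exists>T. locally_psh_on (ball p (2 * r) \<inter> \<Omega>) T \<and>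
        (\<forall>z\<in>ball p (2 * r) \<inter> \<Omega>. lev z \<le> T z \<and> T z \<le> lev z + C1)"
    proof
      fix p assume "p \<in> P"
      have st: "has_stages (ball p (2 * r) \<inter> \<Omega>) L q s M l"
        using stages[OF \<open>p \<in> P\<close>] l unfolding has_stages_def by simp
      have "open (ball p (2 * r) \<inter> \<Omega>)" using \<Omega> by auto
      moreover have "continuous_on (ball p (2 * r) \<inter> \<Omega>) L" using L by (rule continuous_on_subset) auto
      moreover have "0 < l" using l l1 by simp
      ultimately show "\<exists>T. locally_psh_on (ball p (2 * r) \<inter> \<Omega>) T \<and>
        (\<forall>z\<in>ball p (2 * r) \<inter> \<Omega>. lev z \<le> T z \<and> T z \<le> lev z + C1)"
        unfolding lev_def C1_def \<Lambda>_def by (intro logarithmic_barrier[OF _ _ q s M _ st])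
    qed
    from bchoice[OF this] obtain T where T0: "\<forall>p\<in>P. locally_psh_on (ball p (2 * r) \<inter> \<Omega>) (T p) \<and>
        (\<forall>z\<in>ball p (2 * r) \<inter> \<Omega>. lev z \<le> T p z \<and> T p z \<le> lev z + C1)" ..
    have T: "locally_psh_on (ball p (2 * r) \<inter> \<Omega>) (T p)" if "p \<in> P" for p using T0 that by blast
    have T_bound: "lev z \<le> T p z" "T p z \<le> lev z + C1" if "p \<in> P" "dist z p < 2 * r" "z \<in> \<Omega>" for p z
    proof -
      have "z \<in> ball p (2 * r) \<inter> \<Omega>" using that by (simp add: dist_commute)
      then show "lev z \<le> T p z" "T p z \<le> lev z + C1" using T0 that(1) by blast+
    qed
    define u where "u = (\<lambda>p z. T p z + B * \<theta> p z)"
    define act where "act = (\<lambda>z. {p \<in> P. dist z p < 2 * r})"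
    have fin_act: "finite (act z)" for z using P by (simp add: act_def)
    define \<Omega>l where "\<Omega>l = {z \<in> \<Omega>. l < L z}"
    have open_\<Omega>l: "open \<Omega>l"
      using continuous_open_preimage[OF L \<Omega> open_greaterThan[of l]] by (simp add: \<Omega>l_def vimage_def Int_def)
    have near: "\<exists>p\<in>P. dist z p < r" if "z \<in> \<Omega>l" for z
      using cover[of z] that l by (auto simp: \<Omega>l_def)
    have act_ne: "act z \<noteq> {}" if "z \<in> \<Omega>l" for z
      using near[OF that] r by (force simp: act_def)
    \<comment> \<open>Any ratio below 2 whose square is at least 2 could replace
      \<open>9 / 5\<close>: the squared distances to the two centres then differ by at least
      \<open>r\<^sup>2\<close>, and \<open>B * r\<^sup>2 = C1\<close>.\<close>
    have dominated: "u p z \<le> u m z"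
      if "p \<in> P" "m \<in> P" "z \<in> \<Omega>" "dist z p < 2 * r" "9 / 5 * r < dist z p" "dist z m < r" for p m z
    proof -
      have "dist z m < 2 * r" using that(6) r by simp
      then have "T p z \<le> T m z + C1" using T_bound(2)[OF that(1,4,3)] T_bound(1)[OF that(2) _ that(3)] by linarith
      moreover have "C1 \<le> B * (\<theta> m z - \<theta> p z)"
      proof -
        have "(9 / 5 * r)\<^sup>2 \<le> (dist z p)\<^sup>2" using that(5) r by (intro power_mono) auto
        moreover have "(dist z m)\<^sup>2 \<le> r\<^sup>2" using that(6) by (intro power_mono) auto
        moreover have "(9 / 5 * r)\<^sup>2 = 81 / 25 * r\<^sup>2" by (simp add: power2_eq_square)
        moreover have "0 \<le> r\<^sup>2" by simp
        ultimately have "r\<^sup>2 \<le> \<theta> m z - \<theta> p z" unfolding \<theta> by linarith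
        then have "B * r\<^sup>2 \<le> B * (\<theta> m z - \<theta> p z)" using B by (intro mult_left_mono) auto
        then show ?thesis using r by (simp add: B_def)
      qed
      ultimately show ?thesis unfolding u_def by (simp add: algebra_simps)
    qed
    define U where "U = (\<lambda>z. Max ((\<lambda>p. u p z) ` act z))"
    have psh: "locally_psh_on \<Omega>l U"
    proof (rule locally_psh_on_local)
      fix z0 assume z0: "z0 \<in> \<Omega>l"
      \<comment> \<open>On \<open>N\<close> the centres active at \<open>z0\<close> stay active, and
        every further centre is beyond \<open>9 / 5 * r\<close>, hence dominated. There
        \<open>U\<close> is a maximum over the fixed set \<open>act z0\<close>.\<close>
      define N where "N = \<Omega>l \<inter> (\<Inter>p\<in>act z0. ball p (2 * r)) \<inter> (\<Inter>p\<in>P - act z0. - cball p (9 / 5 * r))"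
      have "open N" unfolding N_def
        using open_\<Omega>l fin_act P by (intro open_Int open_INT ballI) (auto simp: open_Compl)
      have zN: "z0 \<in> N" using z0 r by (auto simp: N_def act_def dist_commute)
      have psh_u: "locally_psh_on N (u p)" if p: "p \<in> act z0" for p
      proof -
        have "locally_psh_on (ball p (2 * r) \<inter> \<Omega>) (\<lambda>z. T p z + (B * 2 * inner z p + (- (B * (norm p)\<^sup>2))))"
          using p B \<Omega> by (intro locally_psh_on_add[OF T] locally_psh_on_affine locally_psh_on_inner) (auto simp: act_def)
        then have "locally_psh_on (ball p (2 * r) \<inter> \<Omega>) (u p)"
          by (simp add: u_def \<theta>_def algebra_simps)
        then show ?thesis
          by (rule locally_psh_on_subset[OF _ \<open>open N\<close>]) (use p in \<open>auto simp: N_def \<Omega>l_def\<close>)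
      qed
      have "U y = Max ((\<lambda>p. u p y) ` act z0)" if y: "y \<in> N" for y
        unfolding U_def
      proof (rule Max_eq_if)
        have sub: "act z0 \<subseteq> act y" using y by (auto simp: N_def act_def dist_commute)
        show "\<forall>m\<in>(\<lambda>p. u p y) ` act z0. \<exists>n\<in>(\<lambda>p. u p y) ` act y. m \<le> n"
          using sub by blast
        have y\<Omega>: "y \<in> \<Omega>l" "y \<in> \<Omega>" using y by (auto simp: N_def \<Omega>l_def)
        have far: "9 / 5 * r < dist y p" if "p \<in> P - act z0" for p
          using y that by (auto simp: N_def dist_commute not_le)
        obtain m where m: "m \<in> P" "dist y m < r" using near[OF y\<Omega>(1)] by blast
        have m0: "m \<in> act z0"
        proof (rule ccontr)
          assume "m \<notin> act z0"
          then have "9 / 5 * r < dist y m" using far m(1) by blast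
          then show False using m(2) r by simp
        qed
        show "\<forall>m\<in>(\<lambda>p. u p y) ` act y. \<exists>n\<in>(\<lambda>p. u p y) ` act z0. m \<le> n"
        proof
          fix x assume "x \<in> (\<lambda>p. u p y) ` act y"
          then obtain p where p: "p \<in> P" "dist y p < 2 * r" "x = u p y" by (auto simp: act_def)
          show "\<exists>n\<in>(\<lambda>p. u p y) ` act z0. x \<le> n"
          proof (cases "p \<in> act z0")
            case False
            then have "u p y \<le> u m y" using far p m y\<Omega> by (intro dominated) auto
            then show ?thesis using m0 p(3) by blast
          qed (use p(3) in blast)
        qed
      qed (use fin_act in auto)
      moreover have "locally_psh_on N (\<lambda>z. Max ((\<lambda>p. u p z) ` act z0))"
        by (intro locally_psh_on_Max fin_act act_ne z0 psh_u)
      ultimately show "\<exists>N v. z0 \<in> N \<and> N \<subseteq> \<Omega>l \<and> locally_psh_on N v \<and> (\<forall>y\<in>N. U y = v y)"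
        using zN by (intro exI[of _ N] exI[of _ "\<lambda>z. Max ((\<lambda>p. u p z) ` act z0)"]) (auto simp: N_def)
    qed
    have U_bound: "lev z - C2 \<le> U z \<and> U z \<le> lev z + C1 + C2" if z: "z \<in> \<Omega>l" for z
    proof -
      have "U z \<in> (\<lambda>p. u p z) ` act z" unfolding U_def using fin_act act_ne[OF z] by (intro Max_in) auto
      then obtain p where p: "p \<in> P" "dist z p < 2 * r" "U z = u p z" by (auto simp: act_def)
      have z\<Omega>: "z \<in> \<Omega>" using z by (simp add: \<Omega>l_def)
      show ?thesis using T_bound[OF p(1,2) z\<Omega>] \<theta>_bound[OF p(1) z\<Omega>] unfolding p(3) u_def by linarith
    qed
    \<comment> \<open>Chosen so that the largest possible value \<open>D + C1 + C2\<close> of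
      \<open>U\<close> goes to \<open>- 1 / D\<close>; at level 0, where
      \<open>U \<le> C1 + C2\<close>, the result is then below \<open>- 1\<close>.\<close>
    define v where "v = (\<lambda>z. (1 / D) * U z + (- 1 - (C1 + C2 + 1) / D))"
    have Dv: "D * v z = U z - D - (C1 + C2 + 1)" for z
      using D(1) by (simp add: v_def field_simps)
    have scale: "v z \<le> a" if "D * v z \<le> D * a" for z a using that D(1) by simp
    show "\<exists>v. locally_psh_on {z \<in> \<Omega>. l < L z} v \<and>
     (\<forall>z\<in>\<Omega>. l < L z \<longrightarrow> v z \<le> - (1 / D) \<and> (L z < 2 * l \<longrightarrow> v z \<le> - 1) \<and> (M ^ K * l \<le> L z \<longrightarrow> - (1 / 2) \<le> v z))"
    proof (intro exI[of _ v] conjI ballI impI)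
      show "locally_psh_on {z \<in> \<Omega>. l < L z} v"
        using psh D(1) unfolding v_def \<Omega>l_def by (intro locally_psh_on_affine) auto
      fix z assume z: "z \<in> \<Omega>" "l < L z"
      then have zl: "z \<in> \<Omega>l" by (simp add: \<Omega>l_def)
      have "real (level M l K (L z)) \<le> real K" using level_props(1)[of M l K "L z"] by simp
      then have "lev z \<le> \<Lambda> * real K" unfolding lev_def using \<Lambda> by (intro mult_left_mono) auto
      then have levD: "lev z \<le> D" by (simp add: D_def mult.commute)
      show "v z \<le> - (1 / D)"
        by (rule scale) (use Dv[of z] U_bound[OF zl] levD D(1) in simp)
      show "v z \<le> - 1" if "L z < 2 * l"
      proof -
        have "level M l K (L z) = 0"
        proof (rule ccontr)
          assume *: "level M l K (L z) \<noteq> 0"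
          define j where "j = level M l K (L z)"
          have "M ^ j * l \<le> L z" using level_props(2)[of M l K "L z"] * by (simp add: j_def)
          moreover have "M ^ 1 \<le> M ^ j" using M * by (intro power_increasing) (auto simp: j_def)
          then have "2 * l \<le> M ^ j * l" using M l l1 by (intro mult_right_mono) auto
          ultimately show False using that by simp
        qed
        then have "lev z = 0" by (simp add: lev_def)
        then show ?thesis by (intro scale) (use Dv[of z] U_bound[OF zl] in simp)
      qed
      show "- (1 / 2) \<le> v z" if "M ^ K * l \<le> L z"
      proof -
        have "level M l K (L z) = K" using level_props(1)[of M l K "L z"] level_props(3)[of K K M l "L z"] that
          by (simp add: le_antisym)
        then have "lev z = D" by (simp add: lev_def D_def mult.commute)
        then have "D * v z \<ge> D * (- (1 / 2))" using Dv[of z] U_bound[OF zl] D(2) by simp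
        then show ?thesis using D(1) by (simp only: mult_le_cancel_left_pos)
      qed
    qed
  qed
  then show ?thesis using K1 D(1) by (intro exI[of _ K] exI[of _ "1 / D"]) simp
qed

text \<open>A factor \<open>1 / 2\<close> for each factor \<open>M\<close> in \<open>L\<close> is a
  power law with exponent \<open>ln 2 / ln M\<close>.\<close>

lemma stages_imp_psh_power_bound:
  fixes L :: "complex ^ 'n \<Rightarrow> real"
  assumes \<Omega>: "open \<Omega>" and L: "continuous_on \<Omega> L"
    and s: "0 < s" "s \<le> 1" and M: "2 \<le> M" and l0: "0 < l0"
    and stages: "has_stages \<Omega> L (1 / 2) s M l0"
  shows "\<exists>\<Psi> \<alpha> C. locally_psh_on \<Omega> \<Psi> \<and> (\<forall>z\<in>\<Omega>. \<Psi> z < 0) \<and> 0 < \<alpha> \<and> 0 < C \<and>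
    (\<forall>z\<in>\<Omega>. l0 < L z \<longrightarrow> - \<Psi> z \<le> C * L z powr (- \<alpha>))"
proof -
  have half: "0 < (1 / 2 :: real)" "(1 / 2 :: real) < 1" by auto
  obtain \<psi> where "barrier_sequence \<Omega> L (1 / 2) s M l0 \<psi>"
    using barrier_iteration[OF \<Omega> L half s M l0 stages] by blast
  then have \<psi>: "\<And>k. locally_psh_on \<Omega> (\<psi> k)"
    "\<And>k j z. z \<in> \<Omega> \<Longrightarrow> j \<le> k \<Longrightarrow> j = 0 \<or> M ^ j * l0 \<le> L z \<Longrightarrow> - ((1 / 2) ^ j) \<le> \<psi> k z"
    "\<And>k z. z \<in> \<Omega> \<Longrightarrow> \<psi> k z \<le> - (s * (1 / 2) ^ k)"
    "\<And>k j z. z \<in> \<Omega> \<Longrightarrow> L z \<le> M ^ k * l0 \<Longrightarrow> k \<le> j \<Longrightarrow> \<psi> j z = \<psi> k z"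
    unfolding barrier_sequence_def by fast+
  have ex: "\<exists>k. x < M ^ k * l0" for x
  proof -
    obtain k where "x / l0 < M ^ k" using real_arch_pow[of M "x / l0"] M by auto
    then show ?thesis using l0 by (auto simp: pos_divide_less_eq)
  qed
  \<comment> \<open>The strict inequality makes the sets \<open>L z < M ^ k * l0\<close> open; by
    stability \<open>\<Psi>\<close> is \<open>\<psi> k\<close> on the whole of the
    \<open>k\<close>-th one.\<close>
  define n where "n = (\<lambda>z. LEAST k. L z < M ^ k * l0)"
  define \<Psi> where "\<Psi> = (\<lambda>z. \<psi> (n z) z)"
  have n: "L z < M ^ n z * l0" for z unfolding n_def using ex by (rule LeastI_ex)
  have \<Psi>: "\<Psi> z = \<psi> k z" if "z \<in> \<Omega>" "L z < M ^ k * l0" for z k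
  proof -
    have "n z \<le> k" unfolding n_def using that(2) by (rule Least_le)
    then show ?thesis unfolding \<Psi>_def using \<psi>(4)[OF that(1), of "n z" k] n[of z] by simp
  qed
  have psh: "locally_psh_on \<Omega> \<Psi>"
  proof (rule locally_psh_on_local)
    fix z assume z: "z \<in> \<Omega>"
    define N where "N = \<Omega> \<inter> L -` {..<M ^ n z * l0}"
    have "open N" unfolding N_def by (intro continuous_open_preimage L \<Omega>) auto
    then have "locally_psh_on N (\<psi> (n z))"
      by (intro locally_psh_on_subset[OF \<psi>(1)]) (auto simp: N_def)
    moreover have "\<forall>y\<in>N. \<Psi> y = \<psi> (n z) y" using \<Psi> by (auto simp: N_def)
    moreover have "z \<in> N" "N \<subseteq> \<Omega>" using z n by (auto simp: N_def)
    ultimately show "\<exists>N v. z \<in> N \<and> N \<subseteq> \<Omega> \<and> locally_psh_on N v \<and> (\<forall>y\<in>N. \<Psi> y = v y)" by blast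
  qed
  have neg: "\<Psi> z < 0" if "z \<in> \<Omega>" for z
  proof -
    have "0 < s * (1 / 2) ^ n z" using s by simp
    then show ?thesis using \<psi>(3)[OF that, of "n z"] unfolding \<Psi>_def by linarith
  qed
  define \<alpha> where "\<alpha> = ln 2 / ln M"
  have \<alpha>: "0 < \<alpha>" using M by (simp add: \<alpha>_def)
  have M\<alpha>: "M powr \<alpha> = 2" using M by (simp add: \<alpha>_def powr_def)
  have bound: "- \<Psi> z \<le> (2 * l0 powr \<alpha>) * L z powr (- \<alpha>)" if z: "z \<in> \<Omega>" "l0 < L z" for z
  proof -
    have "n z \<noteq> 0" using n[of z] z(2) by (intro notI) simp
    \<comment> \<open>Minimality of \<open>n z\<close> puts \<open>L z\<close> between the scales
      \<open>j\<close> and \<open>Suc j\<close>; the one scale lost is the factor 2 in the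
      constant.\<close>
    then obtain j where j: "n z = Suc j" by (cases "n z") auto
    have "\<not> L z < M ^ j * l0" using not_less_Least[of j "\<lambda>k. L z < M ^ k * l0"] j by (simp add: n_def)
    then have "- ((1 / 2) ^ j) \<le> \<Psi> z" unfolding \<Psi>_def using z j by (intro \<psi>(2)) auto
    then have 1: "- \<Psi> z \<le> (1 / 2) ^ j" by simp
    have Lpos: "0 < L z" using z l0 by simp
    have "L z powr \<alpha> \<le> (M ^ Suc j * l0) powr \<alpha>" using n[of z] j Lpos \<alpha> by (intro powr_mono2) auto
    also have "\<dots> = (M ^ Suc j) powr \<alpha> * l0 powr \<alpha>" by (rule powr_mult)
    also have "(M ^ Suc j) powr \<alpha> = (M powr \<alpha>) ^ Suc j"
      using M by (simp add: powr_powr powr_realpow[symmetric] mult.commute del: power_Suc)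
    finally have "L z powr \<alpha> \<le> 2 * 2 ^ j * l0 powr \<alpha>" by (simp add: M\<alpha>)
    then have "(1 / 2) ^ j * L z powr \<alpha> \<le> (1 / 2) ^ j * (2 * 2 ^ j * l0 powr \<alpha>)" by (intro mult_left_mono) auto
    also have "\<dots> = 2 * l0 powr \<alpha>" by (simp add: power_one_over)
    finally have "(1 / 2) ^ j \<le> (2 * l0 powr \<alpha>) / L z powr \<alpha>" using Lpos by (simp add: pos_le_divide_eq)
    also have "\<dots> = (2 * l0 powr \<alpha>) * L z powr (- \<alpha>)" by (simp add: powr_minus_divide)
    finally show ?thesis using 1 by linarith
  qed
  have "0 < 2 * l0 powr \<alpha>" using l0 by simp
  then show ?thesis using psh neg \<alpha> bound by blast
qed

text \<open>A Lebesgue number of finitely many charts yields one radius, and maxima over these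
  charts yield one \<open>A\<close> and one \<open>l\<close>. The net \<open>P\<close> is chosen
  afterwards, since its mesh depends on that radius.\<close>

lemma finite_truncation_cover:
  fixes L :: "complex ^ 'n \<Rightarrow> real"
  assumes \<Omega>: "open \<Omega>" and B: "compact B"
    and loc: "\<And>p. p \<in> B \<Longrightarrow> \<exists>V A l. open V \<and> p \<in> V \<and> 1 \<le> A \<and> 0 < l \<and>
      (\<forall>z\<in>V \<inter> \<Omega>. l \<le> L z) \<and> has_truncations (V \<inter> \<Omega>) L A l"
  shows "\<exists>r A l P. 0 < r \<and> 1 \<le> A \<and> 0 < l \<and> finite P \<and> P \<subseteq> B \<and> (\<forall>x\<in>B. \<exists>p\<in>P. dist x p < r / 2) \<and>
    (\<forall>p\<in>P. has_truncations (ball p (2 * r) \<inter> \<Omega>) L A l \<and> (\<forall>z\<in>ball p (2 * r) \<inter> \<Omega>. 0 \<le> L z))"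
proof -
  define good where "good = (\<lambda>p V A l. open V \<and> p \<in> V \<and> 1 \<le> A \<and> 0 < l \<and>
      (\<forall>z\<in>V \<inter> \<Omega>. l \<le> L z) \<and> has_truncations (V \<inter> \<Omega>) L A l)"
  have "\<exists>V A l. good p V A l" if "p \<in> B" for p using loc[OF that] by (simp only: good_def)
  then obtain V A l where "\<And>p. p \<in> B \<Longrightarrow> good p (V p) (A p) (l p)" by metis
  then have V: "\<And>p. p \<in> B \<Longrightarrow> open (V p)" "\<And>p. p \<in> B \<Longrightarrow> p \<in> V p"
    and A: "\<And>p. p \<in> B \<Longrightarrow> 1 \<le> A p" and l: "\<And>p. p \<in> B \<Longrightarrow> 0 < l p"
    and pos: "\<And>p z. p \<in> B \<Longrightarrow> z \<in> V p \<inter> \<Omega> \<Longrightarrow> l p \<le> L z"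
    and tr: "\<And>p. p \<in> B \<Longrightarrow> has_truncations (V p \<inter> \<Omega>) L (A p) (l p)"
    by (auto simp: good_def)
  have "B \<subseteq> (\<Union>p\<in>B. V p)" using V(2) by blast
  then obtain Q where Q: "Q \<subseteq> B" "finite Q" "B \<subseteq> (\<Union>p\<in>Q. V p)"
    using compactE_image[OF B, of B V] V(1) by metis
  define A' where "A' = Max (insert 1 (A ` Q))"
  define l' where "l' = Max (insert 1 (l ` Q))"
  have A': "1 \<le> A'" "\<And>p. p \<in> Q \<Longrightarrow> A p \<le> A'" unfolding A'_def using Q(2) by auto
  have l': "1 \<le> l'" "\<And>p. p \<in> Q \<Longrightarrow> l p \<le> l'" unfolding l'_def using Q(2) by auto
  obtain e where e: "0 < e" "\<And>x. x \<in> B \<Longrightarrow> \<exists>G\<in>V ` Q. ball x e \<subseteq> G"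
    by (rule Heine_Borel_lemma[OF B Q(3)]) (use Q(1) V(1) in auto)
  define r where "r = e / 2"
  have r: "0 < r" "2 * r = e" using e(1) by (auto simp: r_def)
  have "B \<subseteq> (\<Union>p\<in>B. ball p (r / 2))" using r(1) by force
  then obtain P where P: "P \<subseteq> B" "finite P" "B \<subseteq> (\<Union>p\<in>P. ball p (r / 2))"
    using compactE_image[OF B, of B "\<lambda>p. ball p (r / 2)"] by (metis open_ball)
  have "has_truncations (ball p (2 * r) \<inter> \<Omega>) L A' l' \<and> (\<forall>z\<in>ball p (2 * r) \<inter> \<Omega>. 0 \<le> L z)" if p: "p \<in> P" for p
  proof -
    obtain x where x: "x \<in> Q" "ball p (2 * r) \<subseteq> V x" using e(2)[of p] p P(1) r(2) by auto
    have xB: "x \<in> B" using x Q by blast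
    have nonneg: "0 \<le> L z" if "z \<in> V x \<inter> \<Omega>" for z using pos[OF xB that] l[OF xB] by simp
    have "has_truncations (ball p (2 * r) \<inter> \<Omega>) L A' l'"
      by (rule has_truncations_mono[OF tr[OF xB] _ _ A[OF xB] A'(2)[OF x(1)] l[OF xB] l'(2)[OF x(1)] nonneg])
        (use x(2) \<Omega> in auto)
    then show ?thesis using nonneg x(2) by blast
  qed
  moreover have "\<forall>x\<in>B. \<exists>p\<in>P. dist x p < r / 2" using P(3) by (force simp: dist_commute)
  ultimately show ?thesis using r(1) A'(1) l'(1) P
    by (intro exI[of _ r] exI[of _ A'] exI[of _ l'] exI[of _ P]) auto
qed

section \<open>Application to the boundary distance\<close>

lemma continuous_on_log_depth:
  assumes "open \<Omega>" "p \<in> frontier \<Omega>"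
  shows "continuous_on \<Omega> (log_depth \<Omega>)"
  unfolding log_depth_def[abs_def]
  using infdist_frontier_pos[OF assms] by (intro continuous_intros) force

lemma holder_boundary_truncations:
  assumes \<phi>: "locally_psh_on \<Omega> \<phi>" and exh: "\<And>c. closure {z \<in> \<Omega>. \<phi> z < c} \<subseteq> \<Omega>"
    and holder: "holder_boundary \<Omega>" and p: "p \<in> frontier \<Omega>"
  shows "\<exists>V A l. open V \<and> p \<in> V \<and> 1 \<le> A \<and> 0 < l \<and>
      (\<forall>z\<in>V \<inter> \<Omega>. l \<le> log_depth \<Omega> z) \<and> has_truncations (V \<inter> \<Omega>) (log_depth \<Omega>) A l"
proof -
  from bspec[OF holder[unfolded holder_boundary_def] p] show ?thesis
  proof (elim exE conjE)
    fix U r F k g \<beta>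
    assume *: "p \<in> U" "0 < r" "biholomorphic_onto U (ball 0 r) F" "F p = 0"
      "0 < \<beta>" "\<beta> < 1" "holder_continuous_on \<beta> {w. Im (w $ k) = 0 \<and> norm w < r} g" "g 0 = 0"
      "F ` (U \<inter> \<Omega>) = {w \<in> ball 0 r. Im (w $ k) < g (real_part_at k w)}"
    show ?thesis
    proof (rule local_truncated_depth[OF \<phi> exh p *])
      fix V A l
      assume V: "open V" "p \<in> V" "1 \<le> (A::real)" "0 < (l::real)"
        "\<And>z. z \<in> V \<inter> \<Omega> \<Longrightarrow> l \<le> log_depth \<Omega> z"
        "\<And>l'. l \<le> l' \<Longrightarrow> \<exists>f. locally_psh_on (V \<inter> \<Omega>) f \<and>
           (\<forall>z\<in>V \<inter> \<Omega>. min (log_depth \<Omega> z) l' / A \<le> f z \<and> f z \<le> A * min (log_depth \<Omega> z) l')"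
      then have tr: "has_truncations (V \<inter> \<Omega>) (log_depth \<Omega>) A l" unfolding has_truncations_def by blast
      show ?thesis by (intro exI[of _ V] exI[of _ A] exI[of _ l] conjI ballI V(1-5) tr)
    qed
  qed
qed

theorem mainTheorem2:
  fixes \<Omega> :: "(complex ^ 'n) set"
  assumes "open \<Omega>" and "connected \<Omega>" and "\<Omega> \<noteq> {}" and "bounded \<Omega>"
    and "pseudoconvex \<Omega>"
    and "holder_boundary \<Omega>"
  shows "log_hyperconvexity_index \<Omega> > 0"
proof -
  have "\<Omega> \<noteq> UNIV" using \<open>bounded \<Omega>\<close> not_bounded_UNIV by blast
  \<comment> \<open>A boundary point has to exist for \<open>L\<close> to be meaningful:
    \<open>infdist\<close> from an empty set is 0.\<close>
  then obtain p0 where p0: "p0 \<in> frontier \<Omega>" using \<open>\<Omega> \<noteq> {}\<close> frontier_eq_empty by blast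
  obtain \<phi> where "continuous_plurisubharmonic_on \<Omega> \<phi>" and exh: "\<And>c. closure {z \<in> \<Omega>. \<phi> z < c} \<subseteq> \<Omega>"
    using \<open>pseudoconvex \<Omega>\<close> unfolding pseudoconvex_def by blast
  then have \<phi>: "locally_psh_on \<Omega> \<phi>" using \<open>open \<Omega>\<close> by (intro continuous_psh_imp_locally_psh)
  define L where "L = log_depth \<Omega>"
  have cL: "continuous_on \<Omega> L" unfolding L_def by (rule continuous_on_log_depth[OF \<open>open \<Omega>\<close> p0])
  have L_exp: "infdist z (frontier \<Omega>) = exp (- L z)" if "z \<in> \<Omega>" for z
    using infdist_frontier_pos[OF \<open>open \<Omega>\<close> p0 that] by (simp add: L_def log_depth_def)
  have comp: "compact (frontier \<Omega>)" using \<open>bounded \<Omega>\<close> by (rule compact_frontier_bounded)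
  have "\<exists>r A l P. 0 < r \<and> 1 \<le> A \<and> 0 < l \<and> finite P \<and> P \<subseteq> frontier \<Omega> \<and>
      (\<forall>x\<in>frontier \<Omega>. \<exists>p\<in>P. dist x p < r / 2) \<and>
      (\<forall>p\<in>P. has_truncations (ball p (2 * r) \<inter> \<Omega>) L A l \<and> (\<forall>z\<in>ball p (2 * r) \<inter> \<Omega>. 0 \<le> L z))"
    unfolding L_def
    by (rule finite_truncation_cover[OF \<open>open \<Omega>\<close> comp])
      (rule holder_boundary_truncations[OF \<phi> exh \<open>holder_boundary \<Omega>\<close>])
  then obtain r A l P where "0 < r \<and> 1 \<le> A \<and> 0 < l \<and> finite P \<and> P \<subseteq> frontier \<Omega> \<and>
      (\<forall>x\<in>frontier \<Omega>. \<exists>p\<in>P. dist x p < r / 2) \<and>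
      (\<forall>p\<in>P. has_truncations (ball p (2 * r) \<inter> \<Omega>) L A l \<and> (\<forall>z\<in>ball p (2 * r) \<inter> \<Omega>. 0 \<le> L z))"
    by (elim exE) (rule that)
  then have r: "0 < r" and A: "1 \<le> A" and l: "0 < l" and P: "finite P" "P \<subseteq> frontier \<Omega>"
    and net: "\<And>x. x \<in> frontier \<Omega> \<Longrightarrow> \<exists>p\<in>P. dist x p < r / 2"
    and tr: "\<And>p. p \<in> P \<Longrightarrow> has_truncations (ball p (2 * r) \<inter> \<Omega>) L A l"
    and nonneg: "\<And>p z. p \<in> P \<Longrightarrow> z \<in> ball p (2 * r) \<inter> \<Omega> \<Longrightarrow> 0 \<le> L z"
    by simp_all
  \<comment> \<open>\<open>L z > ln (2 / r)\<close> means that \<open>z\<close> is within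
    \<open>r / 2\<close> of the boundary, hence within \<open>r\<close> of the net \<open>P\<close>
    of mesh \<open>r / 2\<close>.\<close>
  define l1 where "l1 = max l (ln (2 / r))"
  have l1: "l \<le> l1" "0 < l1" "ln (2 / r) \<le> l1" using l by (auto simp: l1_def)
  define q where "q = 1 - 3 / (4 * A\<^sup>2)"
  define s where "s = 1 / (4 * A\<^sup>2)"
  define M where "M = 8 * A\<^sup>2"
  have A2: "1 \<le> A\<^sup>2" using A by simp
  have q: "0 < q" "q < 1" and s: "0 < s" "s \<le> 1" and M: "2 \<le> M"
    using A2 by (auto simp: q_def s_def M_def divide_simps)
  have stages: "has_stages (ball p (2 * r) \<inter> \<Omega>) L q s M l1" if p: "p \<in> P" for p
    unfolding q_def s_def M_def
  proof (rule truncations_imp_stages[OF _ _ A l1(2)])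
    show "open (ball p (2 * r) \<inter> \<Omega>)" using \<open>open \<Omega>\<close> by auto
    then show "has_truncations (ball p (2 * r) \<inter> \<Omega>) L A l1"
      by (rule has_truncations_mono[OF tr[OF p] _ order_refl A order_refl l l1(1) nonneg[OF p]])
    show "continuous_on (ball p (2 * r) \<inter> \<Omega>) L" using cL by (rule continuous_on_subset) auto
  qed
  obtain R where R: "\<And>z. z \<in> closure \<Omega> \<Longrightarrow> norm z \<le> R"
    using bounded_closure[OF \<open>bounded \<Omega>\<close>] unfolding bounded_iff by blast
  have cover: "\<exists>p\<in>P. dist z p < r" if z: "z \<in> \<Omega>" "l1 < L z" for z
  proof -
    obtain x where x: "x \<in> frontier \<Omega>" "infdist z (frontier \<Omega>) = dist z x"
      using infdist_attains_inf[OF frontier_closed, of \<Omega> z] p0 by blast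
    have "dist z x = exp (- L z)" using L_exp[OF z(1)] x(2) by simp
    also have "\<dots> < exp (- ln (2 / r))" using z(2) l1(3) by simp
    also have "\<dots> = r / 2" using r by (simp add: exp_minus)
    finally have "dist z x < r / 2" .
    moreover obtain p where "p \<in> P" "dist x p < r / 2" using net[OF x(1)] by blast
    ultimately have "dist z p < r" using dist_triangle[of z p x] by simp
    then show ?thesis using \<open>p \<in> P\<close> by blast
  qed
  have "\<exists>K s'. 1 \<le> K \<and> 0 < s' \<and> s' \<le> 1 \<and> has_stages \<Omega> L (1 / 2) s' (M ^ K) l1"
  proof (rule glued_stages[OF \<open>open \<Omega>\<close> cL _ _ P(1) r q s M l1(2) stages cover])
    show "norm z \<le> R" if "z \<in> \<Omega>" for z using R that closure_subset by blast
    show "norm p \<le> R" if "p \<in> P" for p using R P(2) that by (auto simp: frontier_def)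
  qed
  then obtain K s' where K: "1 \<le> K" and s': "0 < s'" "s' \<le> 1" and st: "has_stages \<Omega> L (1 / 2) s' (M ^ K) l1"
    by blast
  have "M ^ 1 \<le> M ^ K" using K M by (intro power_increasing) auto
  then have MK: "2 \<le> M ^ K" using M by simp
  obtain \<Psi> \<alpha> C where \<Psi>: "locally_psh_on \<Omega> \<Psi>" "\<And>z. z \<in> \<Omega> \<Longrightarrow> \<Psi> z < 0" "0 < \<alpha>" "0 < C"
    "\<And>z. z \<in> \<Omega> \<Longrightarrow> l1 < L z \<Longrightarrow> - \<Psi> z \<le> C * L z powr (- \<alpha>)"
    using stages_imp_psh_power_bound[OF \<open>open \<Omega>\<close> cL s' MK l1(2) st] by blast
  \<comment> \<open>The witness for \<open>\<delta>\<close> is \<open>exp (- l1)\<close>, as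
    \<open>d < exp (- l1)\<close> says \<open>L > l1\<close>.\<close>
  have "- \<Psi> z \<le> C * (- ln (infdist z (frontier \<Omega>))) powr (- \<alpha>)"
    if z: "z \<in> \<Omega>" "infdist z (frontier \<Omega>) < exp (- l1)" for z
  proof -
    have "l1 < L z" using z L_exp[OF z(1)] by simp
    then show ?thesis using \<Psi>(5)[OF z(1)] by (simp add: L_def log_depth_def)
  qed
  moreover have "exp (- l1) < 1" using l1(2) by simp
  ultimately have "ereal \<alpha> \<le> log_hyperconvexity_index \<Omega>"
    unfolding log_hyperconvexity_index_def
    using \<Psi>(2-4) locally_psh_imp_continuous_psh[OF \<Psi>(1)]
    by (intro Sup_upper imageI CollectI conjI exI[of _ \<Psi>] exI[of _ C] exI[of _ "exp (- l1)"]) auto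
  moreover have "0 < ereal \<alpha>" using \<Psi>(3) by simp
  ultimately show ?thesis by (rule less_le_trans[rotated])
qed

end
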